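(* Let $d\geq 3$ be an integer and let $s=(d-3)+2\lambda$, with $0<\lambda<1$. Let $q>0$, $\alpha\geq 1$, and consider the monomial external field $$Q(x)=q\,r^\alpha,\quad x=(0,r\overline{x})\in\mathbb{D},\ \overline{x}\in\mathbb{S}^{d-2},\ 0\leq r\leq 1.$$ The $s$-extremal measure $\mu_Q$ corresponding to $Q$ is supported on the disk $\mathbb{D}_{R_\ast}$, where $R_\ast$ is defined as $$R_\ast=\left(\frac{(d+2\lambda-3)\,\pi\,\Gamma((d+\alpha+2\lambda-1)/2)}{q\,\alpha\,\sin(\lambda\pi)\,\Gamma(\lambda)\,\Gamma((d+\alpha-1)/2)}\right)^{1/(d+\alpha+2\lambda-3)}.$$ For the extremal measure $\mu_Q$ we have $$d\mu_Q(x)=f(r)\,r^{d-2}\,dr\,d\sigma_{d-1}(\overline{x}),\quad x=(0,r\overline{x})\in\mathbb{D}_{R_\ast},\ \overline{x}\in\mathbb{S}^{d-2},\ 0\leq r\leq R_\ast,$$ with the density $f$ given by $$f(r)=C_Q\,(R_\ast^2-r^2)^{\lambda-1}+F(r),\quad 0\leq r\leq R_\ast,$$ where $$\begin{aligned}F(r)=\ &\frac{q\,\sin(\lambda\pi)\,\Gamma((d+\alpha-1)/2)\,\Gamma((d+2\lambda-3)/2)}{\pi^{(d+1)/2}\,\Gamma((d+\alpha+2\lambda-3)/2)}\,R_\ast^\alpha\,(R_\ast^2-r^2)^{\lambda-1}\\&\times\bigg\{-{}_2F_1\Big(-\frac{\alpha}{2},1;\lambda+1;1-\Big(\frac{r}{R_\ast}\Big)^2\Big)\\&\quad+\frac{\alpha}{2\lambda(\lambda+1)}\Big(1-\Big(\frac{r}{R_\ast}\Big)^2\Big)\,{}_2F_1\Big(1-\frac{\alpha}{2},2;\lambda+2;1-\Big(\frac{r}{R_\ast}\Big)^2\Big)\bigg\},\quad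 0\leq r\leq R_\ast,\end{aligned}$$ and the constant $C_Q$ is defined as $$C_Q=\frac{\Gamma((d+2\lambda-1)/2)}{\pi^{(d-1)/2}\,\Gamma(\lambda)}\left\{\frac{1}{R_\ast^{d+2\lambda-3}}+\frac{q\,\sin(\lambda\pi)\,\Gamma((d+\alpha-1)/2)\,\Gamma(\lambda)}{\pi\,\Gamma((d+\alpha+2\lambda-1)/2)}\,R_\ast^\alpha\right\}.$$
   Context: $|\cdot|$ is the Euclidean norm on $\mathbb{R}^d$, $\mathbb{S}^{d-2}$ is the unit sphere of $\mathbb{R}^{d-1}$, and $\sigma_{d-1}$ is the (unnormalized) surface area measure on $\mathbb{S}^{d-2}$. The disk of radius $R$ is $\mathbb{D}_R=\{(x_1,\ldots,x_d)\in\mathbb{R}^d:x_1=0,\ x_2^2+\cdots+x_d^2\leq R^2\}$, and $\mathbb{D}=\mathbb{D}_1$; its points are written $x=(0,r\overline{x})$ with $\overline{x}\in\mathbb{S}^{d-2}$. $\Gamma$ is the Gamma function, and ${}_2F_1(a,b;c;z)=\sum_{n=0}^\infty\frac{(a)_n(b)_n}{(c)_n}\frac{z^n}{n!}$, $|z|<1$, is the Gauss hypergeometric function, with $(a)_0=1$, $(a)_n=a(a+1)\cdots(a+n-1)$ for $n\geq 1$. $\mathcal{M}(\mathbb{D})$ is the class of unit positive Borel measures supported on $\mathbb{D}$, and $I_s(\mu)=\iint|x-y|^{-s}\,d\mu(x)\,d\mu(y)$ is the Riesz $s$-energy. For the external field $Q$ on $\mathbb{D}$, the weighted energy is $I_Q(\mu)=I_s(\mu)+2\int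 Q\,d\mu$, $V_Q=\inf\{I_Q(\mu):\mu\in\mathcal{M}(\mathbb{D})\}$, and the $s$-extremal measure $\mu_Q\in\mathcal{M}(\mathbb{D})$ is the (unique) measure with $I_Q(\mu_Q)=V_Q$.
   Formalization: The formal statement additionally assumes R_* ≤ 1; when R_* > 1 (small q) the stated density is positive beyond r = 1, so it would put mass outside the unit disk D and cannot be the density of μ_Q ∈ M(D). *)

theory Defs
  imports "HOL-Probability.Probability"
begin

text \<open>
  The ambient space $R^d$ is \<^typ>\<open>real \<times> (real ^ 'n)\<close> with \<open>d = CARD('n) + 1\<close>: the first component is
  $x_1$, the second is $(x_2,\dots,x_d)$. The norm of the product type is the Euclidean norm.
\<close>

definition disk :: "real \<Rightarrow> (real \<times> (real ^ 'n)) set" where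
  "disk R = {x. fst x = 0 \<and> norm (snd x) \<le> R}"

definition supported_on :: "'a measure \<Rightarrow> 'a set \<Rightarrow> bool" where
  "supported_on \<mu> A \<longleftrightarrow> (AE x in \<mu>. x \<in> A)"

definition disk_measures :: "(real \<times> (real ^ 'n)) measure set" where
  "disk_measures = {\<mu>. sets \<mu> = sets borel \<and> prob_space \<mu> \<and> supported_on \<mu> (disk 1)}"

text \<open>
  The kernel is infinite on the diagonal. This has to be said explicitly because
  \<open>0 powr a = 0\<close> for every \<open>a\<close>.
\<close>

definition riesz_kernel :: "real \<Rightarrow> 'a::metric_space \<Rightarrow> 'a \<Rightarrow> ennreal" where
  "riesz_kernel s x y = (if x = y then \<infinity> else ennreal (dist x y powr (- s)))"

definition riesz_energy :: "real \<Rightarrow> 'a::metric_space measure \<Rightarrow> ennreal" where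
  "riesz_energy s \<mu> = (\<integral>\<^sup>+ x. \<integral>\<^sup>+ y. riesz_kernel s x y \<partial>\<mu> \<partial>\<mu>)"

text \<open>
  \<open>Q\<close> is an external field on the unit disk, so only its values there are used. The Bochner
  integral is the intended one for fields that are integrable on the disk, such as the bounded
  continuous ones.
\<close>

definition weighted_energy ::
    "real \<Rightarrow> (real \<times> (real ^ 'n) \<Rightarrow> real) \<Rightarrow> (real \<times> (real ^ 'n)) measure \<Rightarrow> ereal" where
  "weighted_energy s Q \<mu> = enn2ereal (riesz_energy s \<mu>) + ereal (2 * (LINT x:disk 1|\<mu>. Q x))"

definition minimal_energy :: "real \<Rightarrow> (real \<times> (real ^ 'n) \<Rightarrow> real) \<Rightarrow> ereal" where
  "minimal_energy s Q = (INF \<mu>\<in>disk_measures. weighted_energy s Q \<mu>)"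

definition extremal_measure ::
    "real \<Rightarrow> (real \<times> (real ^ 'n) \<Rightarrow> real) \<Rightarrow> (real \<times> (real ^ 'n)) measure" where
  "extremal_measure s Q =
     (THE \<mu>. \<mu> \<in> disk_measures \<and> weighted_energy s Q \<mu> = minimal_energy s Q)"

text \<open>
  Unnormalized surface area measure on the unit sphere of \<open>real ^ 'n\<close>, regarded as a Borel measure
  on the whole space: the area of \<open>A\<close> is \<open>CARD('n)\<close> times the Lebesgue measure of the cone
  \<open>{t *\<^sub>R u | t u. 0 < t \<le> 1 \<and> u \<in> A}\<close> over it. For \<open>u \<noteq> 0\<close>, \<open>sgn u = u /\<^sub>R norm u\<close>.
\<close>

definition surface_measure :: "(real ^ 'n) measure" where
  "surface_measure =
     distr (density lborel (\<lambda>x. of_nat CARD('n) * indicator (cball 0 1 - {0}) x)) borel sgn"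

lemma emeasure_surface_measure:
  fixes A :: "(real ^ 'n) set"
  assumes "A \<in> sets borel" "A \<subseteq> sphere 0 1"
  shows "emeasure surface_measure A =
           of_nat CARD('n) * emeasure lborel {t *\<^sub>R u | t u. 0 < t \<and> t \<le> 1 \<and> u \<in> A}"
proof -
  have sgn: "(sgn :: real ^ 'n \<Rightarrow> _) \<in> borel_measurable borel"
    unfolding sgn_div_norm by measurable
  have cone: "{t *\<^sub>R u | t u. 0 < t \<and> t \<le> 1 \<and> u \<in> A} = (cball 0 1 - {0}) \<inter> sgn -` A"
  proof (intro equalityI subsetI)
    fix x assume "x \<in> {t *\<^sub>R u | t u. 0 < t \<and> t \<le> 1 \<and> u \<in> A}"
    then obtain t u where x: "x = t *\<^sub>R u" "0 < t" "t \<le> 1" "u \<in> A" by blast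
    then have "norm u = 1" using assms(2) by auto
    then show "x \<in> (cball 0 1 - {0}) \<inter> sgn -` A"
      using x by (auto simp: sgn_div_norm)
  next
    fix x assume x: "x \<in> (cball 0 1 - {0}) \<inter> sgn -` A"
    then have "x = norm x *\<^sub>R sgn x" by (simp add: sgn_div_norm)
    moreover have "0 < norm x" "norm x \<le> 1" "sgn x \<in> A" using x by auto
    ultimately show "x \<in> {t *\<^sub>R u | t u. 0 < t \<and> t \<le> 1 \<and> u \<in> A}" by blast
  qed
  have pre: "sgn -` A \<in> sets borel"
    using measurable_sets[OF sgn assms(1)] by simp
  have dens: "(\<lambda>x::real ^ 'n. of_nat CARD('n) * indicator (cball 0 1 - {0}) x :: ennreal)
      \<in> borel_measurable lborel"
    by (intro borel_measurable_times_ennreal borel_measurable_const borel_measurable_indicator) auto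
  have "emeasure surface_measure A =
      (\<integral>\<^sup>+ x. (of_nat CARD('n) * indicator (cball 0 1 - {0}) x) * indicator (sgn -` A) x \<partial>lborel)"
    unfolding surface_measure_def using sgn pre assms(1)
    by (subst emeasure_distr) (auto simp: emeasure_density[OF dens])
  also have "\<dots> = (\<integral>\<^sup>+ x. of_nat CARD('n) * indicator ((cball 0 1 - {0}) \<inter> sgn -` A) x \<partial>lborel)"
    by (intro nn_integral_cong) (auto simp: indicator_def)
  also have "\<dots> = of_nat CARD('n) * emeasure lborel ((cball 0 1 - {0}) \<inter> sgn -` A)"
    using pre by (subst nn_integral_cmult_indicator) auto
  finally show ?thesis unfolding cone .
qed

text \<open>
  $d\mu(x) = f(r)\, r^{d-2}\, dr\, d\sigma_{d-1}(\overline{x})$ for $x = (0, r\overline{x})$,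
  $0 \le r \le R$, with no mass elsewhere; here \<open>d - 2 = CARD('n) - 1\<close>. The first conjunct says that
  \<open>ennreal\<close>, which maps negative numbers to \<open>0\<close>, leaves the density unchanged.
\<close>

definition has_radial_density ::
    "(real \<times> (real ^ 'n)) measure \<Rightarrow> real \<Rightarrow> (real \<Rightarrow> real) \<Rightarrow> bool" where
  "has_radial_density \<mu> R f \<longleftrightarrow>
     (AE r in lborel. r \<in> {0..R} \<longrightarrow> 0 \<le> f r) \<and>
     \<mu> = distr
           (density lborel (\<lambda>r. ennreal (indicator {0..R} r * f r * r ^ (CARD('n) - 1)))
              \<Otimes>\<^sub>M surface_measure)
           borel (\<lambda>(r, u). (0, r *\<^sub>R u))"

text \<open>
  At \<open>z = 1\<close>, which occurs below only for \<open>r = 0\<close>, the series need not converge; there the value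
  is irrelevant because the density is only used up to null sets.
\<close>

definition gauss_2F1 :: "real \<Rightarrow> real \<Rightarrow> real \<Rightarrow> real \<Rightarrow> real" where
  "gauss_2F1 a b c z =
     (\<Sum>n. pochhammer a n * pochhammer b n / pochhammer c n * (z ^ n / fact n))"

definition R_star :: "real \<Rightarrow> real \<Rightarrow> real \<Rightarrow> real \<Rightarrow> real" where
  "R_star d lam q \<alpha> =
     ((d + 2 * lam - 3) * pi * Gamma ((d + \<alpha> + 2 * lam - 1) / 2) /
      (q * \<alpha> * sin (lam * pi) * Gamma lam * Gamma ((d + \<alpha> - 1) / 2)))
     powr (1 / (d + \<alpha> + 2 * lam - 3))"

definition C_Q :: "real \<Rightarrow> real \<Rightarrow> real \<Rightarrow> real \<Rightarrow> real" where
  "C_Q d lam q \<alpha> =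
     (let R = R_star d lam q \<alpha> in
      Gamma ((d + 2 * lam - 1) / 2) / (pi powr ((d - 1) / 2) * Gamma lam) *
      (1 / R powr (d + 2 * lam - 3) +
       q * sin (lam * pi) * Gamma ((d + \<alpha> - 1) / 2) * Gamma lam /
       (pi * Gamma ((d + \<alpha> + 2 * lam - 1) / 2)) * R powr \<alpha>))"

definition F_Q :: "real \<Rightarrow> real \<Rightarrow> real \<Rightarrow> real \<Rightarrow> real \<Rightarrow> real" where
  "F_Q d lam q \<alpha> r =
     (let R = R_star d lam q \<alpha> in
      q * sin (lam * pi) * Gamma ((d + \<alpha> - 1) / 2) * Gamma ((d + 2 * lam - 3) / 2) /
      (pi powr ((d + 1) / 2) * Gamma ((d + \<alpha> + 2 * lam - 3) / 2)) *
      R powr \<alpha> * (R\<^sup>2 - r\<^sup>2) powr (lam - 1) *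
      (- gauss_2F1 (- \<alpha> / 2) 1 (lam + 1) (1 - (r / R)\<^sup>2) +
       \<alpha> / (2 * lam * (lam + 1)) * (1 - (r / R)\<^sup>2) *
       gauss_2F1 (1 - \<alpha> / 2) 2 (lam + 2) (1 - (r / R)\<^sup>2)))"

definition f_Q :: "real \<Rightarrow> real \<Rightarrow> real \<Rightarrow> real \<Rightarrow> real \<Rightarrow> real" where
  "f_Q d lam q \<alpha> r =
     C_Q d lam q \<alpha> * ((R_star d lam q \<alpha>)\<^sup>2 - r\<^sup>2) powr (lam - 1) + F_Q d lam q \<alpha> r"

end

theory Submission
  imports Defs
begin

text \<open>
  With \<open>N = d - 1\<close>, the density is a mixture \<open>f(r) = c\<^sub>0 \<integral> \<tau>\<^sup>\<alpha>\<^sup>-\<^sup>1 (\<tau>\<^sup>2 - r\<^sup>2)\<^sup>\<lambda>\<^sup>-\<^sup>1 d\<tau>\<close> over \<open>r < \<tau> < R\<close> of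
  equilibrium densities of disks. Its potential is computed from the spherical mean
  \<open>\<integral> |x - r u|\<^sup>-\<^sup>s d\<sigma>(u) = C (|x| r)\<^sup>2\<^sup>-\<^sup>N \<integral> t\<^sup>s\<^sup>-\<^sup>1 ((|x|\<^sup>2 - t\<^sup>2) (r\<^sup>2 - t\<^sup>2))\<^sup>-\<^sup>\<lambda> dt\<close> over
  \<open>0 < t < min |x| r\<close>, which a fractional integration reduces to the mean of \<open>|x - r u|\<^sup>-\<^sup>N\<close>, the
  Poisson kernel; the latter follows from polar coordinates about an interior point, because the
  distances to the sphere in opposite directions have a constant product. The potential of \<open>f\<close> plus
  the field is then constant on the disk of radius \<open>R\<close> and not smaller outside, so \<open>f\<close> is minimal.
  For uniqueness, the Riesz kernel is a superposition of products of Gaussians, which makes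
  \<open>I(\<mu>) + I(\<nu>) - 2 I(\<mu>, \<nu>)\<close> an integral of squares; it vanishes only if the Gaussian averages of
  \<open>\<mu>\<close> and \<open>\<nu>\<close> agree, and letting their width tend to \<open>0\<close> gives \<open>\<mu> = \<nu>\<close>.
\<close>

section \<open>One-dimensional integrals\<close>

text \<open>The constants have two origins. The coefficient \<open>c\<^sub>0\<close> of the mixture
  is fixed by requiring that its potential cancel the field exactly (\<open>field_const\<close>);
  the radius \<open>R_star\<close> is then fixed by requiring total mass 1
  (\<open>mass_const\<close>). For this radius \<open>C_Q\<close> coincides with the prefactor of
  \<open>F_Q\<close> and supplies the constant term missing in its braces (\<open>C_Q_eq\<close>),
  so the density vanishes at R like (R^2 - r^2)^\<lambda> instead of blowing up like (R^2 -
  r^2)^(\<lambda>-1). Its positivity, not visible in the hypergeometric form, is immediate for the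
  mixture. The mixture has a simple potential because the kernel (\<tau>^2 - r^2)^(\<lambda>-1) is
  inverted, in the sense of Abel, by the factor (r^2 - t^2)^(-\<lambda>) of the spherical mean. Most
  integrals are taken in \<open>ennreal\<close>, so exchanges of integration need no prior
  convergence argument; in return energies are compared by adding terms, never by subtracting them.
  The formula for the potential excludes the origin, which must therefore be a null set, both for
  the candidate and for every competitor of finite energy.\<close>

lemma set_nn_integral_eq_iff:
  fixes h :: "real \<Rightarrow> real"
  assumes [measurable]: "S \<in> sets borel" "h \<in> borel_measurable borel"
    and nonneg: "\<And>x. x \<in> S \<Longrightarrow> 0 \<le> h x" and "0 \<le> r"
  shows "(\<integral>\<^sup>+x\<in>S. ennreal (h x) \<partial>lborel) = ennreal r \<longleftrightarrow>
         h absolutely_integrable_on S \<and> integral S h = r"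
proof
  assume I: "(\<integral>\<^sup>+x\<in>S. ennreal (h x) \<partial>lborel) = ennreal r"
  have "(\<integral>\<^sup>+x. ennreal (indicator S x * h x) \<partial>lborel) = ennreal r"
    unfolding I[symmetric] by (intro nn_integral_cong) (auto simp: indicator_def)
  then have "((\<lambda>x. indicator S x * h x) has_integral r) UNIV"
    using nonneg \<open>0 \<le> r\<close> by (intro nn_integral_has_integral) (auto simp: indicator_def)
  also have "(\<lambda>x. indicator S x * h x) = (\<lambda>x. if x \<in> S then h x else 0)"
    by (auto simp: indicator_def)
  finally have "(h has_integral r) S" by (simp add: has_integral_restrict_UNIV)
  with nonneg show "h absolutely_integrable_on S \<and> integral S h = r"
    by (auto intro!: nonnegative_absolutely_integrable_1 integral_unique simp: has_integral_integrable)
next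
  assume "h absolutely_integrable_on S \<and> integral S h = r"
  then have "(h has_integral r) S"
    using set_lebesgue_integral_eq_integral(1) by blast
  with nonneg show "(\<integral>\<^sup>+x\<in>S. ennreal (h x) \<partial>lborel) = ennreal r"
    by (intro nn_integral_has_integral_lebesgue')
qed

text \<open>Transfer of the substitution rule for absolutely integrable functions: a value in
  \<open>ennreal\<close> is determined by the finite reals it equals, so the equivalence
  \<open>iff\<close> for every r also settles the case that both integrals are infinite. No
  integrability has to be known beforehand.\<close>

lemma nn_integral_change_of_variables:
  fixes f g g' :: "real \<Rightarrow> real"
  assumes [measurable]: "S \<in> sets borel" "g ` S \<in> sets borel"
      "f \<in> borel_measurable borel" "g \<in> borel_measurable borel" "g' \<in> borel_measurable borel"
    and der: "\<And>x. x \<in> S \<Longrightarrow> (g has_real_derivative g' x) (at x)"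
    and inj: "inj_on g S"
    and nonneg: "\<And>y. y \<in> g ` S \<Longrightarrow> 0 \<le> f y"
  shows "(\<integral>\<^sup>+y\<in>g ` S. ennreal (f y) \<partial>lborel) = (\<integral>\<^sup>+x\<in>S. ennreal (\<bar>g' x\<bar> * f (g x)) \<partial>lborel)"
    (is "?L = ?R")
proof -
  have leb: "S \<in> sets lebesgue" by (simp add: sets_completionI_sets)
  have iff: "?L = ennreal r \<longleftrightarrow> ?R = ennreal r" if r: "0 \<le> r" for r
  proof -
    have "?L = ennreal r \<longleftrightarrow> f absolutely_integrable_on (g ` S) \<and> integral (g ` S) f = r"
      using nonneg r by (intro set_nn_integral_eq_iff) auto
    also have "\<dots> \<longleftrightarrow> (\<lambda>x. \<bar>g' x\<bar> * f (g x)) absolutely_integrable_on S \<and>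
        integral S (\<lambda>x. \<bar>g' x\<bar> * f (g x)) = r"
      using der
      by (intro has_absolute_integral_change_of_variables_1'[OF leb _ inj, symmetric])
         (auto intro: has_field_derivative_at_within)
    also have "\<dots> \<longleftrightarrow> ?R = ennreal r"
      using nonneg r by (intro set_nn_integral_eq_iff[symmetric]) auto
    finally show ?thesis .
  qed
  show ?thesis
  proof (cases ?L)
    case (real r)
    with iff[of r] show ?thesis by simp
  next
    case top
    show ?thesis
    proof (cases ?R)
      case (real r)
      with iff[of r] top show ?thesis by simp
    qed (use top in simp)
  qed
qed

lemma power2_powr: "(x\<^sup>2) powr a = x powr (2 * a)" if "0 < x" for x a :: real
  using that powr_powr[of x 2 a] by (simp add: powr_numeral)

text \<open>The substitution v = (r^2 - t^2) / (\<tau>^2 - t^2) turns this into the Beta integral.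
  When a + b = 1 the result does not depend on t and \<tau>, which makes the Abel inversion in
  \<open>radial_profile_abel\<close> work.\<close>

lemma beta_annulus:
  fixes t \<tau> a b :: real
  assumes t: "0 \<le> t" "t < \<tau>" and ab: "0 < a" "0 < b"
  shows "(\<integral>\<^sup>+r\<in>{t<..<\<tau>}. ennreal (r * (r\<^sup>2 - t\<^sup>2) powr (a - 1) * (\<tau>\<^sup>2 - r\<^sup>2) powr (b - 1)) \<partial>lborel) =
         ennreal ((\<tau>\<^sup>2 - t\<^sup>2) powr (a + b - 1) * Beta a b / 2)"
proof -
  let ?k = "\<lambda>r. r * (r\<^sup>2 - t\<^sup>2) powr (a - 1) * (\<tau>\<^sup>2 - r\<^sup>2) powr (b - 1)"
  define L where "L = \<tau>\<^sup>2 - t\<^sup>2"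
  have L: "L > 0" using t by (simp add: L_def power_strict_mono)
  define g where "g r = (r\<^sup>2 - t\<^sup>2) / L" for r
  define g' where "g' r = 2 * r / L" for r
  define f where "f v = v powr (a - 1) * (1 - v) powr (b - 1)" for v :: real
  have im: "g ` {t<..<\<tau>} = {0<..<1}"
  proof (intro equalityI subsetI)
    fix v assume "v \<in> g ` {t<..<\<tau>}"
    then obtain r where r: "t < r" "r < \<tau>" "v = g r" by auto
    have "t\<^sup>2 < r\<^sup>2" "r\<^sup>2 < \<tau>\<^sup>2" using r t by (auto intro!: power_strict_mono)
    then show "v \<in> {0<..<1}" using L r by (simp add: g_def L_def)
  next
    fix v :: real assume v: "v \<in> {0<..<1}"
    define r where "r = sqrt (t\<^sup>2 + v * L)"
    have vL: "0 < v * L" "v * L < L" using v L by auto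
    have "t\<^sup>2 + v * L < \<tau>\<^sup>2" using vL by (simp add: L_def)
    then have "r < \<tau>" unfolding r_def using t by (intro real_less_lsqrt) auto
    moreover have "t < r" unfolding r_def using t vL by (intro real_less_rsqrt) auto
    moreover have "g r = v" unfolding g_def r_def using vL L by simp
    ultimately show "v \<in> g ` {t<..<\<tau>}" by force
  qed
  have "(\<integral>\<^sup>+v\<in>{0<..<1}. ennreal (f v) \<partial>lborel) =
        (\<integral>\<^sup>+r\<in>{t<..<\<tau>}. ennreal (\<bar>g' r\<bar> * f (g r)) \<partial>lborel)"
    unfolding im[symmetric]
  proof (rule nn_integral_change_of_variables)
    show "g ` {t<..<\<tau>} \<in> sets borel" by (simp add: im)
    show "(g has_real_derivative g' x) (at x)" for x
      unfolding g_def g'_def using L by (auto intro!: derivative_eq_intros)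
    show "inj_on g {t<..<\<tau>}"
      using L t by (auto simp: inj_on_def g_def)
  qed (auto simp: f_def g_def[abs_def] g'_def[abs_def])
  moreover have beta: "(\<integral>\<^sup>+v\<in>{0<..<1}. ennreal (f v) \<partial>lborel) = ennreal (Beta a b)"
  proof -
    have "(\<integral>\<^sup>+v\<in>{0<..<1}. ennreal (f v) \<partial>lborel) = (\<integral>\<^sup>+v\<in>{0..1}. ennreal (f v) \<partial>lborel)"
    proof (rule nn_integral_cong_AE)
      show "AE x in lborel. ennreal (f x) * indicator {0<..<1} x = ennreal (f x) * indicator {0..1} x"
        using AE_lborel_singleton[of 0] AE_lborel_singleton[of 1]
        by eventually_elim (auto simp: indicator_def)
    qed
    also have "\<dots> = ennreal (Beta a b)"
      using has_integral_Beta_real[OF ab]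
      by (intro nn_integral_has_integral_lebesgue') (auto simp: f_def)
    finally show ?thesis .
  qed
  ultimately have *: "(\<integral>\<^sup>+r\<in>{t<..<\<tau>}. ennreal (\<bar>g' r\<bar> * f (g r)) \<partial>lborel) = ennreal (Beta a b)"
    by simp
  have "(\<integral>\<^sup>+r\<in>{t<..<\<tau>}. ennreal (?k r) \<partial>lborel)
    = (\<integral>\<^sup>+r\<in>{t<..<\<tau>}. ennreal (L powr (a + b - 1) / 2) * ennreal (\<bar>g' r\<bar> * f (g r)) \<partial>lborel)"
  proof (intro set_nn_integral_cong refl)
    fix r assume "r \<in> space lborel \<inter> {t<..<\<tau>}"
    then have r: "t < r" "r < \<tau>" by auto
    have sq: "t\<^sup>2 < r\<^sup>2" "r\<^sup>2 < \<tau>\<^sup>2" using r t by (auto intro!: power_strict_mono)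
    have "1 - g r = (\<tau>\<^sup>2 - r\<^sup>2) / L" using L by (simp add: g_def L_def field_simps)
    then have f: "f (g r) = (r\<^sup>2 - t\<^sup>2) powr (a - 1) * (\<tau>\<^sup>2 - r\<^sup>2) powr (b - 1) / (L powr (a - 1) * L powr (b - 1))"
      using sq L by (simp add: f_def g_def powr_divide)
    have "L powr (a + b - 1) = L powr (a - 1) * L powr (b - 1) * L powr 1"
      by (simp only: powr_add[symmetric]) (simp add: algebra_simps)
    moreover have "\<bar>g' r\<bar> = 2 * r / L" using r t L by (simp add: g'_def)
    ultimately have "?k r =
          (L powr (a + b - 1) / 2) * (\<bar>g' r\<bar> * f (g r))"
      using L f by simp
    then show "ennreal (?k r) =
       ennreal (L powr (a + b - 1) / 2) * ennreal (\<bar>g' r\<bar> * f (g r))"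
      by (simp only: ennreal_mult' powr_ge_zero divide_nonneg_pos zero_less_numeral)
  qed
  also have "\<dots> = ennreal (L powr (a + b - 1) / 2) * (\<integral>\<^sup>+r\<in>{t<..<\<tau>}. ennreal (\<bar>g' r\<bar> * f (g r)) \<partial>lborel)"
    unfolding f_def g_def g'_def mult.assoc by (subst nn_integral_cmult) auto
  also have "\<dots> = ennreal (L powr (a + b - 1) / 2 * Beta a b)"
    unfolding * by (subst ennreal_mult) (use ab in \<open>auto simp: Beta_def Gamma_real_pos less_imp_le\<close>)
  finally show ?thesis by (simp add: L_def)
qed

lemma beta_ball:
  fixes \<rho> a b :: real
  assumes "0 < \<rho>" "0 < a" "0 < b"
  shows "(\<integral>\<^sup>+r\<in>{0<..<\<rho>}. ennreal (r powr (a - 1) * (\<rho>\<^sup>2 - r\<^sup>2) powr (b - 1)) \<partial>lborel) =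
         ennreal (\<rho> powr (a + 2 * b - 2) * Beta (a / 2) b / 2)"
proof -
  have eq: "r powr (a - 1) * (\<rho>\<^sup>2 - r\<^sup>2) powr (b - 1) =
        r * (r\<^sup>2 - 0\<^sup>2) powr (a / 2 - 1) * (\<rho>\<^sup>2 - r\<^sup>2) powr (b - 1)" if "0 < r" for r
  proof -
    have "r * (r\<^sup>2) powr (a / 2 - 1) = r powr (a - 1)"
      using that by (simp add: power2_powr powr_mult_base)
    then show ?thesis by simp
  qed
  have "(\<integral>\<^sup>+r\<in>{0<..<\<rho>}. ennreal (r powr (a - 1) * (\<rho>\<^sup>2 - r\<^sup>2) powr (b - 1)) \<partial>lborel) =
    (\<integral>\<^sup>+r\<in>{0<..<\<rho>}. ennreal (r * (r\<^sup>2 - 0\<^sup>2) powr (a / 2 - 1) * (\<rho>\<^sup>2 - r\<^sup>2) powr (b - 1)) \<partial>lborel)"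
    by (intro set_nn_integral_cong refl arg_cong[where f = ennreal]) (rule eq, simp)
  also have "\<dots> = ennreal ((\<rho>\<^sup>2 - 0\<^sup>2) powr (a / 2 + b - 1) * Beta (a / 2) b / 2)"
    using assms by (intro beta_annulus) auto
  also have "(\<rho>\<^sup>2 - 0\<^sup>2) powr (a / 2 + b - 1) = \<rho> powr (a + 2 * b - 2)"
    using assms by (simp add: power2_powr algebra_simps)
  finally show ?thesis .
qed

text \<open>The substitution x = D v / (1 - v) leads to the Beta integral. Read from right to left,
  the formula writes D^(-b) as a superposition of the powers (x + D)^(-a-b); in this way the
  exponent of the Riesz kernel is reached from that of the Poisson kernel.\<close>

lemma beta_half_line:
  fixes D a b :: real
  assumes D: "0 < D" and ab: "0 < a" "0 < b"
  shows "(\<integral>\<^sup>+x\<in>{0<..}. ennreal (x powr (a - 1) * (x + D) powr (- a - b)) \<partial>lborel) =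
         ennreal (D powr (- b) * Beta a b)"
proof -
  define g where "g v = D * v / (1 - v)" for v :: real
  define g' where "g' v = D / (1 - v)\<^sup>2" for v :: real
  let ?k = "\<lambda>v. \<bar>g' v\<bar> * (g v powr (a - 1) * (g v + D) powr (- a - b))"
  let ?l = "\<lambda>v. v powr (a - 1) * (1 - v) powr (b - 1)"
  have im: "g ` {0<..<1} = {0<..}"
  proof (intro equalityI subsetI)
    fix x assume "x \<in> g ` {0<..<1}"
    then show "x \<in> {0<..}" using D by (auto simp: g_def)
  next
    fix x :: real assume x: "x \<in> {0<..}"
    then have "1 - x / (x + D) = D / (x + D)" using D by (simp add: field_simps)
    then have "x / (x + D) \<in> {0<..<1}" "g (x / (x + D)) = x"
      using D x by (simp_all add: g_def)
    then show "x \<in> g ` {0<..<1}" by force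
  qed
  have "(\<integral>\<^sup>+x\<in>{0<..}. ennreal (x powr (a - 1) * (x + D) powr (- a - b)) \<partial>lborel) =
        (\<integral>\<^sup>+v\<in>{0<..<1}. ennreal (?k v) \<partial>lborel)"
    unfolding im[symmetric]
  proof (rule nn_integral_change_of_variables)
    show "g ` {0<..<1} \<in> sets borel" by (simp add: im)
    show "(g has_real_derivative g' x) (at x)" if "x \<in> {0<..<1}" for x
      unfolding g_def g'_def using that
      by (auto intro!: derivative_eq_intros simp: divide_simps power2_eq_square)
         (simp add: algebra_simps)
    show "inj_on g {0<..<1}"
    proof (rule inj_onI)
      fix x y assume xy: "x \<in> {0<..<1}" "y \<in> {0<..<1}" "g x = g y"
      then have "D * (x * (1 - y)) = D * (y * (1 - x))"
        by (simp add: g_def frac_eq_eq mult.assoc)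
      then have "x * (1 - y) = y * (1 - x)" using D by simp
      then show "x = y" by (simp add: algebra_simps)
    qed
  qed (auto simp: g_def[abs_def] g'_def[abs_def])
  also have "\<dots> = (\<integral>\<^sup>+v\<in>{0..1}. ennreal (D powr (- b) * (?l v)) \<partial>lborel)"
  proof (rule nn_integral_cong_AE)
    have eq: "?k v =
          D powr (- b) * (?l v)" if "0 < v" "v < 1" for v
    proof -
      have gD: "g v + D = D / (1 - v)" using that by (simp add: g_def field_simps)
      have "g' v = D powr 1 * (1 - v) powr (- 2)"
        using that D by (simp add: g'_def powr_minus powr_numeral field_simps)
      moreover have "g v powr (a - 1) = D powr (a - 1) * v powr (a - 1) * (1 - v) powr (1 - a)"
        using that D by (simp add: g_def powr_divide powr_mult powr_diff powr_minus field_simps)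
      moreover have "(g v + D) powr (- a - b) = D powr (- a - b) * (1 - v) powr (a + b)"
        unfolding gD using that D by (simp add: powr_divide powr_diff powr_minus powr_add field_simps)
      ultimately have "?k v =
        (D powr 1 * D powr (a - 1) * D powr (- a - b)) *
        (v powr (a - 1) * ((1 - v) powr (- 2) * (1 - v) powr (1 - a) * (1 - v) powr (a + b)))"
        using D by simp
      also have "D powr 1 * D powr (a - 1) * D powr (- a - b) = D powr (- b)"
        by (simp only: powr_add[symmetric]) simp
      also have "(1 - v) powr (- 2) * (1 - v) powr (1 - a) * (1 - v) powr (a + b) = (1 - v) powr (b - 1)"
        by (simp only: powr_add[symmetric]) simp
      finally show ?thesis .
    qed
    show "AE v in lborel. ennreal (?k v) * indicator {0<..<1} v =
        ennreal (D powr (- b) * (?l v)) * indicator {0..1} v"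
      using AE_lborel_singleton[of 0] AE_lborel_singleton[of 1]
      by eventually_elim (auto simp: indicator_def eq)
  qed
  also have "\<dots> = ennreal (D powr (- b) * Beta a b)"
    using has_integral_mult_right[OF has_integral_Beta_real[OF ab], of "D powr (- b)"]
    by (intro nn_integral_has_integral_lebesgue') auto
  finally show ?thesis .
qed

section \<open>Polar coordinates\<close>

lemma nn_integral_lborel_scaleR:
  fixes f :: "'a::euclidean_space \<Rightarrow> ennreal"
  assumes [measurable]: "f \<in> borel_measurable borel" and c: "c \<noteq> 0"
  shows "(\<integral>\<^sup>+x. f x \<partial>lborel) = ennreal (\<bar>c\<bar> ^ DIM('a)) * (\<integral>\<^sup>+x. f (t + c *\<^sub>R x) \<partial>lborel)"
  by (subst lborel_affine[OF c, of t])
     (simp add: nn_integral_density nn_integral_distr nn_integral_cmult)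

lemma borel_measurable_sgn_vec [measurable]: "(sgn :: real ^ 'n \<Rightarrow> real ^ 'n) \<in> borel_measurable borel"
  unfolding sgn_div_norm by measurable

lemma sets_surface_measure [simp, measurable_cong]: "sets surface_measure = sets borel"
  by (simp add: surface_measure_def)

lemma space_surface_measure [simp]: "space surface_measure = UNIV"
  by (simp add: surface_measure_def)

lemma punctured_ball_borel [measurable]: "cball 0 1 - {0 :: real ^ 'n} \<in> sets borel"
  by simp

lemma nn_integral_surface_measure:
  fixes f :: "real ^ 'n \<Rightarrow> ennreal"
  assumes [measurable]: "f \<in> borel_measurable borel"
  shows "(\<integral>\<^sup>+u. f u \<partial>surface_measure) =
    (\<integral>\<^sup>+x. ennreal (real CARD('n)) * indicator (cball 0 1 - {0}) x * f (sgn x) \<partial>lborel)"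
  unfolding surface_measure_def
  by (subst nn_integral_distr, simp, simp, subst nn_integral_density)
     (simp_all add: ennreal_of_nat_eq_real_of_nat)

lemma AE_surface_measure: "AE u in (surface_measure :: (real ^ 'n) measure). norm u = 1"
  unfolding surface_measure_def
  by (subst AE_distr_iff, simp, simp, subst AE_density) (auto simp: norm_sgn indicator_def)

definition sphere_area :: "nat \<Rightarrow> real" where
  "sphere_area n = real n * unit_ball_vol (real n)"

lemma emeasure_surface_measure_UNIV:
  "emeasure (surface_measure :: (real ^ 'n) measure) UNIV = ennreal (sphere_area CARD('n))"
proof -
  have "emeasure (surface_measure :: (real ^ 'n) measure) UNIV = (\<integral>\<^sup>+u. 1 \<partial>(surface_measure :: (real ^ 'n) measure))"
    by simp
  also have "\<dots> = (\<integral>\<^sup>+x. ennreal (real CARD('n)) * indicator (cball 0 1 - {0 :: real ^ 'n}) x \<partial>lborel)"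
    by (subst nn_integral_surface_measure) auto
  also have "\<dots> = (\<integral>\<^sup>+x. ennreal (real CARD('n)) * indicator (cball (0 :: real ^ 'n) 1) x \<partial>lborel)"
    using AE_lborel_singleton[of "0 :: real ^ 'n"]
    by (intro nn_integral_cong_AE) (auto elim!: eventually_mono simp: indicator_def)
  also have "\<dots> = ennreal (sphere_area CARD('n))"
    by (subst nn_integral_cmult_indicator) (auto simp: emeasure_cball sphere_area_def ennreal_mult')
  finally show ?thesis .
qed

lemma finite_measure_surface_measure: "finite_measure (surface_measure :: (real ^ 'n) measure)"
  by (rule finite_measureI) (simp add: emeasure_surface_measure_UNIV)

lemma sphere_area_pos: "0 < n \<Longrightarrow> 0 < sphere_area n"
  by (simp add: sphere_area_def)

lemma nn_integral_surface_measure_uminus: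
  fixes f :: "real ^ 'n \<Rightarrow> ennreal"
  assumes [measurable]: "f \<in> borel_measurable borel"
  shows "(\<integral>\<^sup>+u. f (- u) \<partial>surface_measure) = (\<integral>\<^sup>+u. f u \<partial>surface_measure)"
proof -
  have "(\<integral>\<^sup>+u. f u \<partial>surface_measure) =
    (\<integral>\<^sup>+x. ennreal (real CARD('n)) * indicator (cball 0 1 - {0}) (- x) * f (sgn (- x)) \<partial>lborel)"
    by (subst nn_integral_surface_measure, simp, subst nn_integral_lborel_scaleR[of _ "-1" 0]) auto
  also have "\<dots> = (\<integral>\<^sup>+u. f (- u) \<partial>surface_measure)"
    by (subst nn_integral_surface_measure) (auto intro!: nn_integral_cong simp: indicator_def sgn_minus)
  finally show ?thesis by simp
qed

text \<open>Supplies the weight that cancels |y|^N at the end of the proof of the polar coordinate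
  formula.\<close>

lemma nn_integral_power_tail:
  fixes c :: real
  assumes "0 < c" "0 < n"
  shows "(\<integral>\<^sup>+r\<in>{c..}. ennreal (real n * (1 / r) ^ Suc n) \<partial>lborel) = ennreal ((1 / c) ^ n)"
proof -
  have "(\<integral>\<^sup>+r\<in>{c..}. ennreal (real n * (1 / r) ^ Suc n) \<partial>lborel) = ennreal (0 - (- ((1 / c) ^ n)))"
  proof (rule nn_integral_FTC_atLeast)
    fix r assume "c \<le> r"
    with assms have "0 < r" by simp
    have "real n * ((1 / r) ^ (n - 1) * (1 / r\<^sup>2)) = real n * (1 / r) ^ Suc n"
      using \<open>0 < n\<close> by (cases n) (auto simp: power2_eq_square power_one_over)
    then show "((\<lambda>r. - ((1 / r) ^ n)) has_real_derivative real n * (1 / r) ^ Suc n) (at r)"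
      using \<open>0 < r\<close> by (auto intro!: derivative_eq_intros simp: power2_eq_square)
    show "0 \<le> real n * (1 / r) ^ Suc n" using \<open>0 < r\<close> by simp
  next
    have "((\<lambda>r::real. inverse r ^ n) \<longlongrightarrow> 0 ^ n) at_top"
      by (intro tendsto_power tendsto_inverse_0_at_top filterlim_ident)
    from tendsto_minus[OF this] show "((\<lambda>r::real. - ((1 / r) ^ n)) \<longlongrightarrow> 0) at_top"
      using \<open>0 < n\<close> by (simp add: inverse_eq_divide power_0_left)
  qed simp
  then show ?thesis by simp
qed

text \<open>Both sides are reduced to \<open>\<integral>\<integral> N |y|\<^sup>N \<rho>\<^sup>-\<^sup>N\<^sup>-\<^sup>1 F(y) d\<rho> dy\<close> over \<open>\<rho> \<ge> |y|\<close>, by scaling the radius by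
  \<open>|x|\<close> and then the vector by \<open>\<rho>\<close>.\<close>

lemma nn_integral_polar:
  fixes F :: "real ^ 'n \<Rightarrow> ennreal"
  assumes [measurable]: "F \<in> borel_measurable borel"
  shows "(\<integral>\<^sup>+x. F x \<partial>lborel) =
    (\<integral>\<^sup>+u. (\<integral>\<^sup>+r\<in>{0<..}. ennreal (r ^ (CARD('n) - 1)) * F (r *\<^sub>R u) \<partial>lborel) \<partial>surface_measure)"
proof -
  define N where "N = CARD('n)"
  have N: "0 < N" by (simp add: N_def)
  define B :: "(real ^ 'n) set" where "B = cball 0 1 - {0}"
  let ?a = "\<lambda>y. ennreal (norm y ^ N) * F y"
  let ?b = "\<lambda>y \<rho>. ennreal (real N * (1 / \<rho>) ^ Suc N) * (if norm y \<le> \<rho> then 1 else 0)"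
  let ?P = "\<lambda>x \<rho>. ennreal (norm x ^ N * \<rho> ^ (N - 1)) * F (\<rho> *\<^sub>R x)"
  let ?R = "\<lambda>x r. ennreal (r ^ (N - 1)) * F (r *\<^sub>R x)"
  have [measurable]: "B \<in> sets borel" by (simp add: B_def)
  have radial: "(\<integral>\<^sup>+r\<in>{0<..}. ?R (sgn x) r \<partial>lborel) =
     (\<integral>\<^sup>+\<rho>\<in>{0<..}. ?P x \<rho> \<partial>lborel)" if "x \<noteq> 0" for x :: "real ^ 'n"
  proof -
    have x: "norm x \<noteq> 0" using that by simp
    have "(\<integral>\<^sup>+r\<in>{0<..}. ?R (sgn x) r \<partial>lborel) =
      ennreal (norm x) * (\<integral>\<^sup>+\<rho>. ennreal ((norm x * \<rho>) ^ (N - 1)) * F ((norm x * \<rho>) *\<^sub>R sgn x) *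
         indicator {0<..} (norm x * \<rho>) \<partial>lborel)"
      by (subst nn_integral_real_affine[where t = 0, OF _ x]) auto
    also have "\<dots> = (\<integral>\<^sup>+\<rho>. ennreal (norm x) * (ennreal ((norm x * \<rho>) ^ (N - 1)) * F ((norm x * \<rho>) *\<^sub>R sgn x) *
         indicator {0<..} (norm x * \<rho>)) \<partial>lborel)"
      by (subst nn_integral_cmult) auto
    also have "\<dots> = (\<integral>\<^sup>+\<rho>\<in>{0<..}. ?P x \<rho> \<partial>lborel)"
    proof (intro nn_integral_cong)
      fix \<rho> :: real
      have "(norm x * \<rho>) *\<^sub>R sgn x = \<rho> *\<^sub>R x" using x by (simp add: sgn_div_norm)
      moreover have "norm x * (norm x * \<rho>) ^ (N - 1) = norm x ^ N * \<rho> ^ (N - 1)"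
        using N by (cases N) (auto simp: power_mult_distrib)
      ultimately show "ennreal (norm x) * (ennreal ((norm x * \<rho>) ^ (N - 1)) * F ((norm x * \<rho>) *\<^sub>R sgn x) *
         indicator {0<..} (norm x * \<rho>)) = ?P x \<rho> * indicator {0<..} \<rho>"
        using that by (auto simp: indicator_def zero_less_mult_iff mult.assoc[symmetric] ennreal_mult'[symmetric])
    qed
    finally show ?thesis .
  qed
  have ray: "(\<integral>\<^sup>+x. ennreal (real N) * indicator B x * (?P x \<rho>) \<partial>lborel) =
     (\<integral>\<^sup>+y. ?a y * (?b y \<rho>) \<partial>lborel)"
    (is "?l = ?r") if \<rho>: "0 < \<rho>" for \<rho> :: real
  proof -
    have "?r = ennreal (\<rho> ^ N) * (\<integral>\<^sup>+x. ?a (\<rho> *\<^sub>R x) *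
        (?b (\<rho> *\<^sub>R x) \<rho>) \<partial>lborel)"
      using \<rho> by (subst nn_integral_lborel_scaleR[of _ \<rho> 0]) (auto simp: N_def)
    also have "\<dots> = (\<integral>\<^sup>+x. ennreal (\<rho> ^ N) * (?a (\<rho> *\<^sub>R x) *
        (?b (\<rho> *\<^sub>R x) \<rho>)) \<partial>lborel)"
      by (subst nn_integral_cmult) auto
    also have "\<dots> = ?l"
    proof (intro nn_integral_cong_AE)
      have "ennreal (\<rho> ^ N) * (?a (\<rho> *\<^sub>R x) *
          (?b (\<rho> *\<^sub>R x) \<rho>)) =
         ennreal (real N) * indicator B x * (?P x \<rho>)"
        if "x \<noteq> 0" for x :: "real ^ 'n"
      proof -
        have ind: "(if norm (\<rho> *\<^sub>R x) \<le> \<rho> then 1 else 0) = (indicator B x :: ennreal)"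
          using \<rho> that by (auto simp: indicator_def B_def)
        have "\<rho> ^ N * norm (\<rho> *\<^sub>R x) ^ N * (real N * (1 / \<rho>) ^ Suc N) = real N * (norm x ^ N * \<rho> ^ (N - 1))"
          using \<rho> N by (cases N) (auto simp: power_mult_distrib field_simps)
        then have "ennreal (\<rho> ^ N) * ennreal (norm (\<rho> *\<^sub>R x) ^ N) * ennreal (real N * (1 / \<rho>) ^ Suc N) =
           ennreal (real N) * ennreal (norm x ^ N * \<rho> ^ (N - 1))"
          using \<rho> by (simp add: ennreal_mult'[symmetric])
        note eq = this
        have "ennreal (\<rho> ^ N) * (?a (\<rho> *\<^sub>R x) *
            (ennreal (real N * (1 / \<rho>) ^ Suc N) * indicator B x)) =
          (ennreal (\<rho> ^ N) * ennreal (norm (\<rho> *\<^sub>R x) ^ N) * ennreal (real N * (1 / \<rho>) ^ Suc N)) *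
            (indicator B x * F (\<rho> *\<^sub>R x))"
          by (simp only: mult_ac)
        then show ?thesis unfolding ind eq by (simp only: mult_ac)
      qed
      from AE_lborel_singleton[of "0 :: real ^ 'n"] this
      show "AE x in lborel. ennreal (\<rho> ^ N) * (?a (\<rho> *\<^sub>R x) *
          (?b (\<rho> *\<^sub>R x) \<rho>)) =
         ennreal (real N) * indicator B x * (?P x \<rho>)"
        by (rule eventually_mono)
    qed
    finally show ?thesis by simp
  qed
  have "(\<integral>\<^sup>+u. (\<integral>\<^sup>+r\<in>{0<..}. ?R u r \<partial>lborel) \<partial>surface_measure) =
    (\<integral>\<^sup>+x. ennreal (real N) * indicator B x *
      (\<integral>\<^sup>+r\<in>{0<..}. ?R (sgn x) r \<partial>lborel) \<partial>lborel)"
    unfolding N_def B_def by (subst nn_integral_surface_measure) auto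
  also have "\<dots> = (\<integral>\<^sup>+x. ennreal (real N) * indicator B x *
      (\<integral>\<^sup>+\<rho>\<in>{0<..}. ?P x \<rho> \<partial>lborel) \<partial>lborel)"
    by (intro nn_integral_cong, rename_tac x, case_tac "x = 0") (simp_all add: B_def radial del: One_nat_def)
  also have "\<dots> = (\<integral>\<^sup>+x. (\<integral>\<^sup>+\<rho>. ennreal (real N) * indicator B x *
      (?P x \<rho> * indicator {0<..} \<rho>) \<partial>lborel) \<partial>lborel)"
    by (subst nn_integral_cmult) auto
  also have "\<dots> = (\<integral>\<^sup>+\<rho>. (\<integral>\<^sup>+x. ennreal (real N) * indicator B x *
      (?P x \<rho> * indicator {0<..} \<rho>) \<partial>lborel) \<partial>lborel)"
    by (subst lborel_pair.Fubini') auto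
  also have "\<dots> = (\<integral>\<^sup>+\<rho>. (\<integral>\<^sup>+x. ennreal (real N) * indicator B x *
      (?P x \<rho>) \<partial>lborel) * indicator {0<..} \<rho> \<partial>lborel)"
    by (intro nn_integral_cong) (auto simp: indicator_def)
  also have "\<dots> = (\<integral>\<^sup>+\<rho>. (\<integral>\<^sup>+y. ?a y *
      (?b y \<rho>) \<partial>lborel) * indicator {0<..} \<rho> \<partial>lborel)"
    by (intro nn_integral_cong, rename_tac \<rho>, case_tac "0 < \<rho>") (simp_all add: ray del: One_nat_def power_Suc)
  also have "\<dots> = (\<integral>\<^sup>+\<rho>. (\<integral>\<^sup>+y. ?a y *
      (?b y \<rho> * indicator {0<..} \<rho>) \<partial>lborel) \<partial>lborel)"
    by (intro nn_integral_cong) (auto simp: indicator_def)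
  also have "\<dots> = (\<integral>\<^sup>+y. (\<integral>\<^sup>+\<rho>. ?a y *
      (?b y \<rho> * indicator {0<..} \<rho>) \<partial>lborel) \<partial>lborel)"
    by (subst lborel_pair.Fubini') auto
  also have "\<dots> = (\<integral>\<^sup>+y. F y \<partial>lborel)"
  \<comment> \<open>The integral over \<rho> \<ge> |y| equals |y|^(-N) and cancels the weight in
    \<open>?a\<close>; the origin, where this fails, is a null set.\<close>
  proof (intro nn_integral_cong_AE)
    have "(\<integral>\<^sup>+\<rho>. ?a y *
      (?b y \<rho> * indicator {0<..} \<rho>) \<partial>lborel) = F y"
      if y: "y \<noteq> 0" for y :: "real ^ 'n"
    proof -
      have "(\<integral>\<^sup>+\<rho>. ?a y *
         (?b y \<rho> * indicator {0<..} \<rho>) \<partial>lborel) =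
         (\<integral>\<^sup>+\<rho>. ?a y *
         (ennreal (real N * (1 / \<rho>) ^ Suc N) * indicator {norm y..} \<rho>) \<partial>lborel)"
        using less_le_trans[of 0 "norm y"] y by (intro nn_integral_cong) (auto simp: indicator_def)
      also have "\<dots> = ?a y * ennreal ((1 / norm y) ^ N)"
        using y N by (subst nn_integral_cmult) (auto simp: nn_integral_power_tail simp del: power_Suc)
      also have "\<dots> = (ennreal (norm y ^ N) * ennreal ((1 / norm y) ^ N)) * F y"
        by (simp add: mult_ac)
      also have "\<dots> = F y"
        using y by (simp add: ennreal_mult'[symmetric] power_one_over)
      finally show ?thesis .
    qed
    from AE_lborel_singleton[of "0 :: real ^ 'n"] this
    show "AE y in lborel. (\<integral>\<^sup>+\<rho>. ?a y *
      (?b y \<rho> * indicator {0<..} \<rho>) \<partial>lborel) = F y"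
      by (rule eventually_mono)
  qed
  finally show ?thesis by (simp add: N_def)
qed

section \<open>Spherical means of the Poisson and Riesz kernels\<close>

text \<open>The distance from \<open>p\<close> to the sphere of radius \<open>c\<close> about the origin, in the unit direction \<open>u\<close>.\<close>

definition exit_time :: "'a::real_inner \<Rightarrow> real \<Rightarrow> 'a \<Rightarrow> real" where
  "exit_time p c u = sqrt (c\<^sup>2 - (norm p)\<^sup>2 + (p \<bullet> u)\<^sup>2) - p \<bullet> u"

lemma abs_inner_less_sqrt:
  assumes "norm p < c"
  shows "\<bar>p \<bullet> u\<bar> < sqrt (c\<^sup>2 - (norm p)\<^sup>2 + (p \<bullet> u)\<^sup>2)"
proof -
  have "(norm p)\<^sup>2 < c\<^sup>2" using assms by (intro power_strict_mono) auto
  then show ?thesis by (intro real_less_rsqrt) auto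
qed

lemma exit_time_pos: "norm p < c \<Longrightarrow> 0 < exit_time p c u"
  using abs_inner_less_sqrt[of p c u] by (simp add: exit_time_def)

text \<open>The power of the point p: the two exit times are the segments that the sphere cuts off
  on a line through p, and their product is a difference of squares in which the direction drops
  out.\<close>

lemma exit_time_mult:
  assumes "norm p < c"
  shows "exit_time p c u * exit_time p c (- u) = c\<^sup>2 - (norm p)\<^sup>2"
proof -
  have "(norm p)\<^sup>2 < c\<^sup>2" using assms by (intro power_strict_mono) auto
  then have "(sqrt (c\<^sup>2 - (norm p)\<^sup>2 + (p \<bullet> u)\<^sup>2))\<^sup>2 = c\<^sup>2 - (norm p)\<^sup>2 + (p \<bullet> u)\<^sup>2"
    by (simp add: add_nonneg_nonneg)
  then show ?thesis by (simp add: exit_time_def algebra_simps power2_eq_square)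
qed

text \<open>Completing the square gives |p + r u|^2 - c^2 = (r + k)^2 - S^2 with k the inner product
  of p and u. Since |k| < S and 0 < r, the sign of the right-hand side is that of r - (S -
  k).\<close>

lemma norm_ray_iff:
  assumes "norm p < c" "norm u = 1" "0 < r"
  shows "norm (p + r *\<^sub>R u) \<le> c \<longleftrightarrow> r \<le> exit_time p c u" (is ?le)
    and "c \<le> norm (p + r *\<^sub>R u) \<longleftrightarrow> exit_time p c u \<le> r" (is ?ge)
proof -
  define k S where "k = p \<bullet> u" and "S = sqrt (c\<^sup>2 - (norm p)\<^sup>2 + k\<^sup>2)"
  have S: "\<bar>k\<bar> < S" using abs_inner_less_sqrt[OF assms(1), of u] by (simp add: k_def S_def)
  have c: "0 \<le> c" using assms(1) norm_ge_zero[of p] by linarith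
  have "(norm p)\<^sup>2 < c\<^sup>2" using assms by (intro power_strict_mono) auto
  then have S2: "S\<^sup>2 = c\<^sup>2 - (norm p)\<^sup>2 + k\<^sup>2" by (simp add: S_def add_nonneg_nonneg)
  have "(norm (p + r *\<^sub>R u))\<^sup>2 = (norm p)\<^sup>2 + 2 * r * k + r\<^sup>2 * (norm u)\<^sup>2"
    by (simp only: power2_norm_eq_inner k_def) (simp add: algebra_simps inner_commute power2_eq_square)
  then have eq: "(norm (p + r *\<^sub>R u))\<^sup>2 - c\<^sup>2 = (r + k)\<^sup>2 - S\<^sup>2"
    using assms(2) S2 by (simp add: power2_eq_square algebra_simps)
  have "norm (p + r *\<^sub>R u) \<le> c \<longleftrightarrow> (norm (p + r *\<^sub>R u))\<^sup>2 \<le> c\<^sup>2"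
    using c abs_le_square_iff[of "norm (p + r *\<^sub>R u)" c] by simp
  also have "\<dots> \<longleftrightarrow> (r + k)\<^sup>2 \<le> S\<^sup>2" using eq by linarith
  also have "\<dots> \<longleftrightarrow> \<bar>r + k\<bar> \<le> \<bar>S\<bar>" by (simp add: abs_le_square_iff)
  also have "\<dots> \<longleftrightarrow> r \<le> S - k" using S \<open>0 < r\<close> by linarith
  finally show ?le by (simp add: exit_time_def S_def k_def)
  have "c \<le> norm (p + r *\<^sub>R u) \<longleftrightarrow> c\<^sup>2 \<le> (norm (p + r *\<^sub>R u))\<^sup>2"
    using c abs_le_square_iff[of c "norm (p + r *\<^sub>R u)"] by simp
  also have "\<dots> \<longleftrightarrow> S\<^sup>2 \<le> (r + k)\<^sup>2" using eq by linarith
  also have "\<dots> \<longleftrightarrow> \<bar>S\<bar> \<le> \<bar>r + k\<bar>" by (simp add: abs_le_square_iff)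
  also have "\<dots> \<longleftrightarrow> S - k \<le> r" using S \<open>0 < r\<close> by linarith
  finally show ?ge by (simp add: exit_time_def S_def k_def)
qed

lemma exit_time_measurable [measurable]: "exit_time p c \<in> borel_measurable borel"
  for p :: "'a::euclidean_space"
  unfolding exit_time_def[abs_def] by measurable

lemma exit_time_mono: "a \<le> b \<Longrightarrow> 0 \<le> a \<Longrightarrow> exit_time p a u \<le> exit_time p b u"
  by (simp add: exit_time_def power_mono)

text \<open>In polar coordinates about p the factor r^(N-1) meets |y - p|^(-N) and leaves 1 / r, so
  the direction u contributes the logarithm of a quotient of exit times. A single contribution
  depends on u, but those of u and -u add up to a constant; this pairing produces the factor
  1/2.\<close>

lemma poisson_annulus:
  fixes p :: "real ^ 'n"
  assumes a: "norm p < a" and ab: "a \<le> b"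
  shows "(\<integral>\<^sup>+y. ennreal (norm (y - p) powr - real CARD('n)) * indicator {a..b} (norm y) \<partial>lborel) =
         ennreal (sphere_area CARD('n) / 2 * ln ((b\<^sup>2 - (norm p)\<^sup>2) / (a\<^sup>2 - (norm p)\<^sup>2)))"
proof -
  define N where "N = CARD('n)"
  let ?F = "\<lambda>u r. ennreal (norm (r *\<^sub>R u) powr - real N) * indicator {a..b} (norm (p + r *\<^sub>R u))"
  have N: "0 < N" by (simp add: N_def)
  have a0: "0 < a" using a norm_ge_zero[of p] by linarith
  have b: "norm p < b" using a ab by simp
  define L where "L u = ln (exit_time p b u) - ln (exit_time p a u)" for u
  have [measurable]: "L \<in> borel_measurable borel" unfolding L_def[abs_def] by measurable
  have L_nonneg: "0 \<le> L u" for u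
    using exit_time_mono[OF ab, of p u] a0 exit_time_pos[OF a, of u] by (simp add: L_def)
  have dir: "(\<integral>\<^sup>+r\<in>{0<..}. ennreal (r ^ (N - 1)) *
      ?F u r \<partial>lborel) = ennreal (L u)"
    if u: "norm u = 1" for u
  proof -
    have "(\<integral>\<^sup>+r\<in>{0<..}. ennreal (r ^ (N - 1)) *
      ?F u r \<partial>lborel) =
      (\<integral>\<^sup>+r. ennreal (1 / r) * indicator {exit_time p a u..exit_time p b u} r \<partial>lborel)"
    proof (intro nn_integral_cong)
      fix r :: real
      show "ennreal (r ^ (N - 1)) * ?F u r * indicator {0<..} r =
        ennreal (1 / r) * indicator {exit_time p a u..exit_time p b u} r"
      proof (cases "0 < r")
        case True
        have "indicator {a..b} (norm (p + r *\<^sub>R u)) = (indicator {exit_time p a u..exit_time p b u} r :: ennreal)"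
          using norm_ray_iff[OF a u True] norm_ray_iff[OF b u True] by (auto simp: indicator_def)
        moreover have "r ^ (N - 1) * norm (r *\<^sub>R u) powr - real N = 1 / r"
        proof -
          have "r ^ (N - 1) = r powr (real N - 1)"
            using True N by (simp add: powr_realpow[symmetric] of_nat_diff)
          then have "r ^ (N - 1) * norm (r *\<^sub>R u) powr - real N = r powr (- 1)"
            using True u by (simp flip: powr_add)
          then show ?thesis using True by (simp add: powr_minus field_simps)
        qed
        ultimately show ?thesis
          using True by (simp add: ennreal_mult'[symmetric] mult.assoc[symmetric] del: norm_scaleR)
      next
        case False
        then have "r \<notin> {exit_time p a u..exit_time p b u}"
          using exit_time_pos[OF a, of u] by auto
        then show ?thesis using False by simp
      qed
    qed
    also have "\<dots> = ennreal (L u)"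
      unfolding L_def
    proof (rule nn_integral_FTC_Icc)
      fix r assume "r \<in> {exit_time p a u..exit_time p b u}"
      then have "0 < r" using exit_time_pos[OF a, of u] by auto
      then show "(ln has_real_derivative 1 / r) (at r)" "0 \<le> 1 / r"
        by (auto intro!: derivative_eq_intros)
    qed (use exit_time_mono[OF ab] a0 in auto)
    finally show ?thesis .
  qed
  define K where "K = ln ((b\<^sup>2 - (norm p)\<^sup>2) / (a\<^sup>2 - (norm p)\<^sup>2))"
  have LL: "L u + L (- u) = K" for u
  proof -
    have "L u + L (- u) = ln (exit_time p b u * exit_time p b (- u)) - ln (exit_time p a u * exit_time p a (- u))"
      using exit_time_pos[OF a] exit_time_pos[OF b] by (simp add: L_def ln_mult_pos)
    also have "\<dots> = K"
    proof -
      have "0 < exit_time p b u * exit_time p b (- u)" "0 < exit_time p a u * exit_time p a (- u)"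
        using exit_time_pos[OF a] exit_time_pos[OF b] by simp_all
      then show ?thesis
        by (simp add: K_def exit_time_mult a b ln_div)
    qed
    finally show ?thesis .
  qed
  have "(\<integral>\<^sup>+y. ennreal (norm (y - p) powr - real N) * indicator {a..b} (norm y) \<partial>lborel) =
    (\<integral>\<^sup>+y. ennreal (norm y powr - real N) * indicator {a..b} (norm (p + y)) \<partial>lborel)"
    by (subst lborel_distr_plus[of p, symmetric], subst nn_integral_distr) auto
  also have "\<dots> = (\<integral>\<^sup>+u. (\<integral>\<^sup>+r\<in>{0<..}. ennreal (r ^ (N - 1)) *
      ?F u r \<partial>lborel) \<partial>surface_measure)"
    unfolding N_def by (subst nn_integral_polar) auto
  also have "\<dots> = (\<integral>\<^sup>+u. ennreal (L u) \<partial>surface_measure)"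
    by (intro nn_integral_cong_AE eventually_mono[OF AE_surface_measure dir])
  finally have I: "(\<integral>\<^sup>+y. ennreal (norm (y - p) powr - real N) * indicator {a..b} (norm y) \<partial>lborel) =
     (\<integral>\<^sup>+u. ennreal (L u) \<partial>surface_measure)" .
  \<comment> \<open>The surface measure is invariant under u -> -u, so doubling the integral pairs
    opposite directions.\<close>
  have "2 * (\<integral>\<^sup>+u. ennreal (L u) \<partial>surface_measure) =
     (\<integral>\<^sup>+u. ennreal (L u) \<partial>surface_measure) + (\<integral>\<^sup>+u. ennreal (L (- u)) \<partial>surface_measure)"
    using nn_integral_surface_measure_uminus[of "\<lambda>u. ennreal (L u)"] by (simp add: mult_2)
  also have "\<dots> = (\<integral>\<^sup>+u. ennreal (L u) + ennreal (L (- u)) \<partial>surface_measure)"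
    by (rule nn_integral_add[symmetric]) auto
  also have "\<dots> = (\<integral>\<^sup>+u. ennreal K \<partial>(surface_measure :: (real ^ 'n) measure))"
    by (simp add: LL L_nonneg flip: ennreal_plus)
  also have "\<dots> = ennreal (K * sphere_area N)"
  proof -
    have "0 \<le> K" using LL[of 0] L_nonneg[of 0] L_nonneg[of "- 0"] by linarith
    then show ?thesis
      by (simp add: emeasure_surface_measure_UNIV N_def ennreal_mult')
  qed
  also have "\<dots> = 2 * ennreal (sphere_area N / 2 * K)"
    by (simp add: ennreal_mult'[symmetric] mult_ac flip: ennreal_numeral)
  finally show ?thesis
    unfolding I N_def[symmetric] K_def[symmetric] by (simp add: ennreal_mult_cancel_left)
qed


text \<open>The derivative of the annulus integral in its outer radius is b^(N-1) times the
  spherical mean at radius b. For this the mean must be continuous in the radius, which dominated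
  convergence provides as long as the radius stays above |p|.\<close>

lemma poisson_sphere_mean:
  fixes p :: "real ^ 'n"
  assumes b: "norm p < b"
  shows "(\<integral>\<^sup>+u. ennreal (norm (b *\<^sub>R u - p) powr - real CARD('n)) \<partial>surface_measure) =
         ennreal (sphere_area CARD('n) * b powr (2 - real CARD('n)) / (b\<^sup>2 - (norm p)\<^sup>2))"
proof -
  define N where "N = CARD('n)"
  have N: "0 < N" by (simp add: N_def)
  interpret finite_measure "surface_measure :: (real ^ 'n) measure"
    by (rule finite_measure_surface_measure)
  interpret pair_sigma_finite "lborel :: real measure" "surface_measure :: (real ^ 'n) measure" ..
  define k where "k r u = norm (r *\<^sub>R u - p) powr - real N" for r :: real and u :: "real ^ 'n"
  have [measurable]: "(\<lambda>(r, u). k r u) \<in> borel_measurable (borel \<Otimes>\<^sub>M borel)"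
    unfolding k_def[abs_def] by measurable
  have k_bound: "AE u in surface_measure. norm (k r u) \<le> (c - norm p) powr - real N"
    if c: "norm p < c" "c \<le> r" for c r
    using AE_surface_measure
  proof eventually_elim
    case (elim u)
    have "r - norm p \<le> norm (r *\<^sub>R u - p)"
      using norm_triangle_ineq2[of "r *\<^sub>R u" p] c elim norm_ge_zero[of p] by (simp del: norm_ge_zero)
    then show ?case using c by (auto simp: k_def intro!: powr_mono2')
  qed
  define P where "P r = (LINT u|surface_measure. k r u)" for r
  have [measurable]: "P \<in> borel_measurable borel"
    unfolding P_def[abs_def] by measurable
  have P: "(\<integral>\<^sup>+u. ennreal (k r u) \<partial>surface_measure) = ennreal (P r)" if r: "norm p < r" for r
    unfolding P_def
    by (intro nn_integral_eq_integral integrable_const_bound[OF k_bound[OF r order_refl]])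
       (auto simp: k_def)
  have P_nonneg: "0 \<le> P r" for r
    unfolding P_def by (intro integral_nonneg_AE) (simp add: k_def)
  have P_cont: "isCont P r" if r: "norm p < r" for r
  proof (rule continuous_at_sequentiallyI)
    fix X :: "nat \<Rightarrow> real" assume X: "X \<longlonglongrightarrow> r"
    \<comment> \<open>A radius strictly between |p| and r: the sequence eventually stays above it,
      so one constant dominates all kernels.\<close>
    define c where "c = (norm p + r) / 2"
    have c: "norm p < c" "c < r" using r by (auto simp: c_def)
    obtain n0 where n0: "\<And>n. n0 \<le> n \<Longrightarrow> c < X n"
      using order_tendstoD(1)[OF X c(2)] by (auto simp: eventually_sequentially)
    have "(\<lambda>n. P (X (n + n0))) \<longlonglongrightarrow> P r"
      unfolding P_def
    proof (rule integral_dominated_convergence)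
      show "AE u in surface_measure. norm (k (X (n + n0)) u) \<le> (c - norm p) powr - real N" for n
        using n0[of "n + n0"] by (intro k_bound c) auto
      show "AE u in surface_measure. (\<lambda>n. k (X (n + n0)) u) \<longlonglongrightarrow> k r u"
        using AE_surface_measure
      proof eventually_elim
        case (elim u)
        have "r - norm p \<le> norm (r *\<^sub>R u - p)"
          using norm_triangle_ineq2[of "r *\<^sub>R u" p] r elim norm_ge_zero[of p] by (simp del: norm_ge_zero)
        then have "norm (r *\<^sub>R u - p) \<noteq> 0" using r by linarith
        then show ?case
          unfolding k_def using LIMSEQ_ignore_initial_segment[OF X, of n0]
          by (intro tendsto_powr tendsto_intros) auto
      qed
    qed auto
    then show "(\<lambda>n. P (X n)) \<longlonglongrightarrow> P r" by (rule LIMSEQ_offset)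
  qed
  define q where "q x = x\<^sup>2 - (norm p)\<^sup>2" for x :: real
  let ?w = "\<lambda>a x r. ennreal (r ^ (N - 1)) * indicator {a..x} r"
  let ?G = "\<lambda>a x. sphere_area N / 2 * (ln (q x) - ln (q a))"
  have q_pos: "0 < q x" if "norm p < x" for x
    using that by (simp add: q_def power_strict_mono)
  have I: "integral {a..x} (\<lambda>r. r ^ (N - 1) * P r) = ?G a x"
    if a: "norm p < a" and ax: "a \<le> x" for a x
  proof -
    have "0 < a" using a norm_ge_zero[of p] by linarith
    have "(\<integral>\<^sup>+y. ennreal (norm (y - p) powr - real N) * indicator {a..x} (norm y) \<partial>lborel) =
      (\<integral>\<^sup>+u. (\<integral>\<^sup>+r\<in>{0<..}. ennreal (r ^ (N - 1)) *
         (ennreal (norm (r *\<^sub>R u - p) powr - real N) * indicator {a..x} (norm (r *\<^sub>R u))) \<partial>lborel) \<partial>surface_measure)"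
      unfolding N_def by (subst nn_integral_polar) auto
    also have "\<dots> = (\<integral>\<^sup>+u. (\<integral>\<^sup>+r. ?w a x r * ennreal (k r u) \<partial>lborel) \<partial>surface_measure)"
      using \<open>0 < a\<close>
      by (intro nn_integral_cong_AE eventually_mono[OF AE_surface_measure] nn_integral_cong)
         (auto simp: k_def indicator_def)
    also have "\<dots> = (\<integral>\<^sup>+r. (\<integral>\<^sup>+u. ?w a x r * ennreal (k r u) \<partial>surface_measure) \<partial>lborel)"
      by (rule Fubini') (simp add: k_def)
    also have "\<dots> = (\<integral>\<^sup>+r\<in>{a..x}. ennreal (r ^ (N - 1) * P r) \<partial>lborel)"
    proof (intro nn_integral_cong)
      fix r :: real
      have "(\<integral>\<^sup>+u. ?w a x r * ennreal (k r u) \<partial>surface_measure) =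
        ?w a x r * (\<integral>\<^sup>+u. ennreal (k r u) \<partial>surface_measure)"
        by (rule nn_integral_cmult) (simp add: k_def)
      then show "(\<integral>\<^sup>+u. ?w a x r * ennreal (k r u) \<partial>surface_measure) =
        ennreal (r ^ (N - 1) * P r) * indicator {a..x} r"
        using a \<open>0 < a\<close> by (cases "r \<in> {a..x}") (auto simp: P ennreal_mult' P_nonneg)
    qed
    finally have "(\<integral>\<^sup>+r\<in>{a..x}. ennreal (r ^ (N - 1) * P r) \<partial>lborel) =
        ennreal (sphere_area N / 2 * ln (q x / q a))"
      using poisson_annulus[OF a ax] by (simp add: N_def q_def)
    also have "ln (q x / q a) = ln (q x) - ln (q a)"
      using q_pos[OF a] q_pos[of x] a ax by (simp add: ln_div)
    finally have nn: "(\<integral>\<^sup>+r\<in>{a..x}. ennreal (r ^ (N - 1) * P r) \<partial>lborel) =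
        ennreal (?G a x)" .
    have "q a \<le> q x" using ax \<open>0 < a\<close> by (simp add: q_def power_mono)
    then have "0 \<le> ?G a x"
      using q_pos[OF a] sphere_area_pos[OF N] by simp
    then show ?thesis
      using nn P_nonneg \<open>0 < a\<close> by (subst (asm) set_nn_integral_eq_iff) auto
  qed
  define a c where "a = (norm p + b) / 2" and "c = b + 1"
  have ac: "norm p < a" "a < b" "b < c" using b by (auto simp: a_def c_def)
  have "0 < b" using b norm_ge_zero[of p] by linarith
  have "((\<lambda>x. integral {a..x} (\<lambda>r. r ^ (N - 1) * P r)) has_real_derivative b ^ (N - 1) * P b) (at b within {a..c})"
    using ac by (intro integral_has_real_derivative)
      (auto intro!: continuous_intros continuous_at_imp_continuous_on P_cont)
  then have "((\<lambda>x. ?G a x) has_real_derivative b ^ (N - 1) * P b) (at b within {a..c})"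
    by (rule has_field_derivative_transform_within[where d = 1]) (use ac in \<open>auto simp: I simp del: One_nat_def\<close>)
  then have "((\<lambda>x. ?G a x) has_real_derivative b ^ (N - 1) * P b) (at b)"
    using ac by (simp add: at_within_Icc_at)
  moreover have "((\<lambda>x. ?G a x) has_real_derivative sphere_area N * (b / q b)) (at b)"
  proof -
    have "(q has_real_derivative 2 * b) (at b)"
      unfolding q_def by (auto intro!: derivative_eq_intros)
    then show ?thesis
      using q_pos[OF b] by (auto intro!: derivative_eq_intros)
  qed
  ultimately have P': "b ^ (N - 1) * P b = sphere_area N * (b / q b)"
    by (rule DERIV_unique)
  have "b ^ (N - 1) * b powr (1 - real N) = 1"
    using \<open>0 < b\<close> N by (simp add: powr_realpow[symmetric] of_nat_diff flip: powr_add)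
  then have "P b = (b ^ (N - 1) * P b) * b powr (1 - real N)"
    by (metis mult.commute mult.left_commute mult_1)
  also have "\<dots> = sphere_area N * (b * b powr (1 - real N)) / q b"
    unfolding P' by simp
  also have "b * b powr (1 - real N) = b powr (2 - real N)"
    using \<open>0 < b\<close> by (simp add: powr_mult_base)
  finally have "P b = sphere_area N * b powr (2 - real N) / q b" .
  then show ?thesis
    using P[OF b] by (simp add: N_def k_def q_def)
qed

text \<open>The points at radii \<rho> r / t and t have the same product of radii as those at \<rho>
  and r. In the same two directions both pairs thus have the same cross term in the squared
  distance, and the two squared distances differ by this function, whatever the angle.\<close>

definition riesz_subst :: "real \<Rightarrow> real \<Rightarrow> real \<Rightarrow> real" where
  "riesz_subst \<rho> r t = (\<rho> * r / t)\<^sup>2 + t\<^sup>2 - (\<rho>\<^sup>2 + r\<^sup>2)"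

lemma riesz_subst_eq: "t \<noteq> 0 \<Longrightarrow> riesz_subst \<rho> r t = (\<rho>\<^sup>2 - t\<^sup>2) * (r\<^sup>2 - t\<^sup>2) / t\<^sup>2"
  by (simp add: riesz_subst_def field_simps power2_eq_square)

lemma square_less_mult:
  fixes \<rho> r t :: real
  assumes "0 < t" "t < min \<rho> r"
  shows "t\<^sup>2 < \<rho> * r"
  using mult_strict_mono[of t \<rho> t r] assms by (simp add: power2_eq_square)

lemma riesz_subst_image:
  assumes "0 < \<rho>" "0 < r"
  shows "riesz_subst \<rho> r ` {0<..<min \<rho> r} = {0<..}"
proof (intro equalityI subsetI)
  fix y assume "y \<in> riesz_subst \<rho> r ` {0<..<min \<rho> r}"
  then obtain t where t: "0 < t" "t < \<rho>" "t < r" "y = riesz_subst \<rho> r t" by auto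
  have "t\<^sup>2 < \<rho>\<^sup>2" "t\<^sup>2 < r\<^sup>2" using t by (auto intro!: power_strict_mono)
  then show "y \<in> {0<..}" using t by (simp add: riesz_subst_eq)
next
  fix y :: real assume "y \<in> {0<..}"
  then have y: "0 < y" by simp
  define T where "T = y + \<rho>\<^sup>2 + r\<^sup>2"
  define A where "A = \<rho> * r"
  have A: "0 < A" using assms by (simp add: A_def)
  have "2 * A \<le> \<rho>\<^sup>2 + r\<^sup>2"
    using sum_squares_bound[of \<rho> r] by (simp add: A_def)
  then have T: "2 * A < T" using y by (simp add: T_def)
  then have "(2 * A)\<^sup>2 < T\<^sup>2" using A by (intro power_strict_mono) auto
  then have disc: "0 < T\<^sup>2 - (2 * A)\<^sup>2" by simp
  \<comment> \<open>The substitution takes the value y exactly when t^2 is a root of v^2 - T v +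
    A^2. The product of the roots is A^2, so the smaller root is the one below A.\<close>
  define v where "v = (T - sqrt (T\<^sup>2 - (2 * A)\<^sup>2)) / 2"
  have sq: "(sqrt (T\<^sup>2 - (2 * A)\<^sup>2))\<^sup>2 = T\<^sup>2 - (2 * A)\<^sup>2" using disc by simp
  have "sqrt (T\<^sup>2 - (2 * A)\<^sup>2) < T"
    using A T by (intro real_less_lsqrt) auto
  then have v: "0 < v" by (simp add: v_def)
  have quad: "v\<^sup>2 - T * v + A\<^sup>2 = 0"
    using sq by (simp add: v_def power2_eq_square field_simps)
  have root: "sqrt (T\<^sup>2 - (2 * A)\<^sup>2) = T - 2 * v" by (simp add: v_def field_simps)
  have "v < A"
  proof (rule power2_less_imp_less)
    have "0 < v * sqrt (T\<^sup>2 - (2 * A)\<^sup>2)" using v disc by simp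
    also have "\<dots> = A\<^sup>2 - v\<^sup>2" unfolding root using quad by (simp add: power2_eq_square algebra_simps)
    finally show "v\<^sup>2 < A\<^sup>2" by simp
  qed (use A in simp)
  have prod: "(\<rho>\<^sup>2 - v) * (r\<^sup>2 - v) = v * y"
    using quad by (simp add: T_def A_def power2_eq_square algebra_simps)
  then have pos: "0 < (\<rho>\<^sup>2 - v) * (r\<^sup>2 - v)" using v y by simp
  \<comment> \<open>The two factors have the same sign. If both were negative, then \<rho>^2 + r^2 <
    2 v < 2 A, against the inequality of the means.\<close>
  have "v < \<rho>\<^sup>2 \<and> v < r\<^sup>2"
  proof (rule ccontr)
    assume "\<not> (v < \<rho>\<^sup>2 \<and> v < r\<^sup>2)"
    with pos have "\<rho>\<^sup>2 < v" "r\<^sup>2 < v" by (auto simp: zero_less_mult_iff)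
    then have "\<rho>\<^sup>2 + r\<^sup>2 < 2 * A" using \<open>v < A\<close> by simp
    with \<open>2 * A \<le> \<rho>\<^sup>2 + r\<^sup>2\<close> show False by simp
  qed
  then have "sqrt v < \<rho>" "sqrt v < r"
    using assms by (auto intro!: real_less_lsqrt)
  moreover have "riesz_subst \<rho> r (sqrt v) = y"
    using v prod by (simp add: riesz_subst_eq)
  ultimately show "y \<in> riesz_subst \<rho> r ` {0<..<min \<rho> r}"
    using v by (intro image_eqI[of _ _ "sqrt v"]) auto
qed

text \<open>The function is invariant under t -> \<rho> r / t, so preimages come in pairs; only one
  member of a pair satisfies t^2 < \<rho> r, as every t below both radii does.\<close>

lemma riesz_subst_inj:
  assumes "0 < \<rho>" "0 < r"
  shows "inj_on (riesz_subst \<rho> r) {0<..<min \<rho> r}"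
proof (rule inj_onI)
  fix t w assume tw: "t \<in> {0<..<min \<rho> r}" "w \<in> {0<..<min \<rho> r}" "riesz_subst \<rho> r t = riesz_subst \<rho> r w"
  then have pos: "0 < t" "0 < w" by auto
  have "t\<^sup>2 < \<rho> * r" "w\<^sup>2 < \<rho> * r" using tw square_less_mult by auto
  then have "t\<^sup>2 * w\<^sup>2 < (\<rho> * r) * (\<rho> * r)" using pos assms by (intro mult_strict_mono) auto
  moreover have "(t\<^sup>2 - w\<^sup>2) * (t\<^sup>2 * w\<^sup>2 - (\<rho> * r)\<^sup>2) = 0"
    using tw(3) pos by (simp add: riesz_subst_def field_simps power2_eq_square)
  ultimately have "t\<^sup>2 = w\<^sup>2" by (auto simp: power2_eq_square)
  then show "t = w" using pos by simp
qed

text \<open>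
  A beta integral writes \<open>|x - r u|\<^sup>-\<^sup>s\<close> as a multiple of \<open>\<integral> y\<^sup>-\<^sup>\<lambda> (y + |x - r u|\<^sup>2)\<^sup>-\<^sup>N\<^sup>/\<^sup>2 dy\<close>. For
  \<open>y = riesz_subst |x| r t\<close>, the sum in parentheses is the squared distance between the points at
  radii \<open>|x| r / t\<close> and \<open>t\<close> in the directions of \<open>u\<close> and \<open>x\<close>, so the mean over \<open>u\<close> is a Poisson mean.
\<close>

theorem sphere_riesz_mean:
  fixes x :: "real ^ 'n"
  assumes lam: "0 < lam" "lam < 1" and N: "2 \<le> CARD('n)"
    and s: "s = real CARD('n) - 2 + 2 * lam"
    and r: "0 < r" "0 < norm x" "r \<noteq> norm x"
  shows "ennreal (Beta (1 - lam) (s / 2)) *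
           (\<integral>\<^sup>+u. ennreal (norm (x - r *\<^sub>R u) powr - s) \<partial>surface_measure) =
         ennreal (2 * sphere_area CARD('n) * (norm x * r) powr (2 - real CARD('n))) *
           (\<integral>\<^sup>+t\<in>{0<..<min (norm x) r}. ennreal (t powr (s - 1) * (((norm x)\<^sup>2 - t\<^sup>2) * (r\<^sup>2 - t\<^sup>2)) powr - lam) \<partial>lborel)"
proof -
  define N where "N = real CARD('n)"
  define \<rho> where "\<rho> = norm x"
  define A where "A = \<rho> * r"
  define m where "m = min \<rho> r"
  have pos: "0 < \<rho>" "0 < A" using r by (auto simp: A_def \<rho>_def)
  have s_pos: "0 < s" using s lam N by simp
  interpret finite_measure "surface_measure :: (real ^ 'n) measure"
    by (rule finite_measure_surface_measure)
  interpret pair_sigma_finite "lborel :: real measure" "surface_measure :: (real ^ 'n) measure" ..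
  define g where "g = riesz_subst \<rho> r"
  define g' where "g' t = 2 * t - 2 * A\<^sup>2 / t ^ 3" for t
  let ?w = "\<lambda>t. t powr (s - 1) * ((\<rho>\<^sup>2 - t\<^sup>2) * (r\<^sup>2 - t\<^sup>2)) powr - lam"
  let ?g = "\<lambda>t. ennreal (\<bar>g' t\<bar> * g t powr - lam) * indicator {0<..<m} t"
  let ?C = "2 * sphere_area CARD('n) * A powr (2 - N)"
  let ?B = "ennreal (Beta (1 - lam) (s / 2))"
  have [measurable]: "g \<in> borel_measurable borel" "g' \<in> borel_measurable borel"
    unfolding g_def g'_def[abs_def] riesz_subst_def[abs_def] by measurable
  define k where "k t u = norm ((A / t) *\<^sub>R u - (t / \<rho>) *\<^sub>R x) powr - N" for t :: real and u
  have [measurable]: "(\<lambda>(t, u). k t u) \<in> borel_measurable (borel \<Otimes>\<^sub>M borel)"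
    unfolding k_def[abs_def] by measurable
  have per_u: "?B * ennreal (norm (x - r *\<^sub>R u) powr - s) =
    (\<integral>\<^sup>+t. ?g t * ennreal (k t u) \<partial>lborel)"
    if u: "norm u = 1" for u :: "real ^ 'n"
  proof -
    define D where "D = (norm (x - r *\<^sub>R u))\<^sup>2"
    have "x - r *\<^sub>R u \<noteq> 0" using r u by auto
    then have D: "0 < D" by (simp add: D_def)
    have Ds: "norm (x - r *\<^sub>R u) powr - s = D powr (- (s / 2))"
      using \<open>x - r *\<^sub>R u \<noteq> 0\<close> by (simp add: D_def power2_powr)
    have exps: "- (1 - lam) - s / 2 = - (N / 2)" using s by (simp add: N_def field_simps)
    have "?B * ennreal (norm (x - r *\<^sub>R u) powr - s) =
      ennreal (D powr (- (s / 2)) * Beta (1 - lam) (s / 2))"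
      unfolding Ds by (simp add: ennreal_mult' mult.commute)
    also have "\<dots> = (\<integral>\<^sup>+y\<in>{0<..}. ennreal (y powr (- lam) * (y + D) powr (- (N / 2))) \<partial>lborel)"
      using beta_half_line[OF D, of "1 - lam" "s / 2"] lam s_pos unfolding exps by simp
    also have "\<dots> = (\<integral>\<^sup>+t\<in>{0<..<m}. ennreal (\<bar>g' t\<bar> * (g t powr (- lam) * (g t + D) powr (- (N / 2)))) \<partial>lborel)"
    proof -
      have im: "g ` {0<..<m} = {0<..}"
        using riesz_subst_image[of \<rho> r] pos r by (simp add: g_def m_def)
      show ?thesis
        unfolding im[symmetric]
      proof (rule nn_integral_change_of_variables)
        show "g ` {0<..<m} \<in> sets borel" by (simp add: im)
        show "inj_on g {0<..<m}"
          using riesz_subst_inj[of \<rho> r] pos r by (simp add: g_def m_def)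
        show "(g has_real_derivative g' t) (at t)" if "t \<in> {0<..<m}" for t
          using that unfolding g_def g'_def riesz_subst_def A_def
          by (auto intro!: derivative_eq_intros simp: field_simps power2_eq_square power3_eq_cube)
      qed auto
    qed
    also have "\<dots> = (\<integral>\<^sup>+t. ?g t * ennreal (k t u) \<partial>lborel)"
    proof (intro nn_integral_cong)
      fix t :: real
      have "(g t + D) powr (- (N / 2)) = k t u" if t: "0 < t" "t < m"
      proof -
        have ux: "(norm (a *\<^sub>R u - b *\<^sub>R x))\<^sup>2 = a\<^sup>2 + b\<^sup>2 * \<rho>\<^sup>2 - 2 * a * b * (x \<bullet> u)" for a b
          using u unfolding power2_norm_eq_inner \<rho>_def
          by (simp add: norm_eq_1 inner_diff_left inner_diff_right inner_commute power2_eq_square algebra_simps)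
        have "D = \<rho>\<^sup>2 + r\<^sup>2 - 2 * r * (x \<bullet> u)"
          using ux[of r 1] by (simp add: D_def norm_minus_commute)
        moreover have "(norm ((A / t) *\<^sub>R u - (t / \<rho>) *\<^sub>R x))\<^sup>2 = (A / t)\<^sup>2 + t\<^sup>2 - 2 * r * (x \<bullet> u)"
          unfolding ux using t pos by (simp add: A_def power_divide)
        ultimately have eq: "g t + D = (norm ((A / t) *\<^sub>R u - (t / \<rho>) *\<^sub>R x))\<^sup>2"
          by (simp add: g_def riesz_subst_def A_def)
        have "t < A / t"
          using square_less_mult[of t \<rho> r] t by (simp add: m_def A_def field_simps power2_eq_square)
        moreover have "norm ((A / t) *\<^sub>R u) = A / t" "norm ((t / \<rho>) *\<^sub>R x) = t"
          using u t pos r by (auto simp: \<rho>_def)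
        ultimately have "(A / t) *\<^sub>R u \<noteq> (t / \<rho>) *\<^sub>R x" by force
        then show ?thesis unfolding eq k_def by (simp add: power2_powr)
      qed
      then show "ennreal (\<bar>g' t\<bar> * (g t powr (- lam) * (g t + D) powr (- (N / 2)))) * indicator {0<..<m} t =
          ?g t * ennreal (k t u)"
        by (cases "t \<in> {0<..<m}") (auto simp: ennreal_mult'[symmetric] k_def mult.assoc)
    qed
    finally show ?thesis .
  qed
  have "?B * (\<integral>\<^sup>+u. ennreal (norm (x - r *\<^sub>R u) powr - s) \<partial>surface_measure) =
    (\<integral>\<^sup>+u. ?B * ennreal (norm (x - r *\<^sub>R u) powr - s) \<partial>surface_measure)"
    by (rule nn_integral_cmult[symmetric]) simp
  also have "\<dots> = (\<integral>\<^sup>+u. (\<integral>\<^sup>+t. ?g t * ennreal (k t u) \<partial>lborel) \<partial>surface_measure)"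
    by (intro nn_integral_cong_AE eventually_mono[OF AE_surface_measure per_u])
  also have "\<dots> = (\<integral>\<^sup>+t. (\<integral>\<^sup>+u. ?g t * ennreal (k t u) \<partial>surface_measure) \<partial>lborel)"
    by (rule Fubini') simp
  also have "\<dots> = (\<integral>\<^sup>+t. ennreal (?C) *
      (ennreal (?w t) * indicator {0<..<m} t) \<partial>lborel)"
  proof (intro nn_integral_cong)
    fix t :: real
    have "(\<integral>\<^sup>+u. ?g t * ennreal (k t u) \<partial>surface_measure) =
      ?g t * (\<integral>\<^sup>+u. ennreal (k t u) \<partial>surface_measure)"
      by (rule nn_integral_cmult) simp
    moreover have "ennreal (\<bar>g' t\<bar> * g t powr - lam) * (\<integral>\<^sup>+u. ennreal (k t u) \<partial>surface_measure) =
       ennreal (?C) *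
        ennreal (?w t)" if t: "0 < t" "t < m"
    proof -
      have tA: "t\<^sup>2 < A" using square_less_mult[of t \<rho> r] t by (simp add: m_def A_def)
      have p: "norm ((t / \<rho>) *\<^sub>R x) = t" using t pos r by (auto simp: \<rho>_def)
      \<comment> \<open>The point (t / \<rho>) x has norm t and so lies inside the sphere of radius
        A / t, as the Poisson mean requires.\<close>
      have lt: "t < A / t" using tA t by (simp add: field_simps power2_eq_square)
      have mean: "(\<integral>\<^sup>+u. ennreal (k t u) \<partial>surface_measure) =
        ennreal (sphere_area CARD('n) * (A / t) powr (2 - N) / ((A / t)\<^sup>2 - t\<^sup>2))"
        using poisson_sphere_mean[of "(t / \<rho>) *\<^sub>R x" "A / t"] lt unfolding p k_def N_def by simp
      have "t ^ 4 < A\<^sup>2"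
        using power_strict_mono[OF tA, of 2] by (simp flip: power_mult)
      then have q: "0 < A\<^sup>2 - t ^ 4" by simp
      have "g' t = - (2 * (A\<^sup>2 - t ^ 4) / t ^ 3)"
        using t by (simp add: g'_def field_simps eval_nat_numeral)
      then have e1: "\<bar>g' t\<bar> = 2 * (A\<^sup>2 - t ^ 4) / t ^ 3" using q t by simp
      have "t\<^sup>2 < \<rho>\<^sup>2" "t\<^sup>2 < r\<^sup>2" using t by (auto intro!: power_strict_mono simp: m_def)
      then have e2: "g t powr - lam = ((\<rho>\<^sup>2 - t\<^sup>2) * (r\<^sup>2 - t\<^sup>2)) powr - lam * t powr (2 * lam)"
        using t by (simp add: g_def riesz_subst_eq powr_divide powr_minus power2_powr field_simps)
      have e3: "(A / t) powr (2 - N) = A powr (2 - N) * t powr (N - 2)"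
        using pos t by (simp add: powr_divide powr_diff field_simps)
      have e4: "(A / t)\<^sup>2 - t\<^sup>2 = (A\<^sup>2 - t ^ 4) / t\<^sup>2"
        using t by (simp add: field_simps eval_nat_numeral)
      have e5: "t powr (s - 1) = t powr (2 * lam) * t powr (N - 2) / t"
      proof -
        have "s - 1 = (2 * lam + (N - 2)) - 1" by (simp add: s N_def)
        then have "t powr (s - 1) = t powr (2 * lam + (N - 2)) / t powr 1"
          by (simp only: powr_diff)
        then show ?thesis using t by (simp add: powr_add)
      qed
      \<comment> \<open>The factor A^2 - t^4 of the Jacobian cancels against the denominator (A /
        t)^2 - t^2 of the Poisson mean; apart from powers of A and t only the product with exponent
        -\<lambda> remains.\<close>
      have "\<bar>g' t\<bar> * g t powr - lam * (sphere_area CARD('n) * (A / t) powr (2 - N) / ((A / t)\<^sup>2 - t\<^sup>2)) =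
        ?C * (?w t)"
        unfolding e1 e2 e3 e4 e5 using q t by (simp add: field_simps eval_nat_numeral)
      moreover have "0 \<le> ?C"
        using sphere_area_pos[of "CARD('n)"] by simp
      ultimately show ?thesis
        unfolding mean by (simp add: ennreal_mult'[symmetric])
    qed
    ultimately show "(\<integral>\<^sup>+u. ?g t * ennreal (k t u) \<partial>surface_measure) =
      ennreal (?C) *
      (ennreal (?w t) * indicator {0<..<m} t)"
      by (cases "t \<in> {0<..<m}") auto
  qed
  also have "\<dots> = ennreal (?C) *
     (\<integral>\<^sup>+t\<in>{0<..<m}. ennreal (?w t) \<partial>lborel)"
    by (rule nn_integral_cmult) simp
  finally show ?thesis by (simp only: A_def m_def N_def \<rho>_def)
qed

section \<open>Potentials of radial densities\<close>

lemma nn_integral_Ioo_eq_Icc: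
  fixes a b :: real
  shows "(\<integral>\<^sup>+x\<in>{a<..<b}. f x \<partial>lborel) = (\<integral>\<^sup>+x\<in>{a..b}. f x \<partial>lborel)"
proof (rule nn_integral_cong_AE)
  show "AE x in lborel. f x * indicator {a<..<b} x = f x * indicator {a..b} x"
    using AE_lborel_singleton[of a] AE_lborel_singleton[of b]
    by eventually_elim (auto simp: indicator_def)
qed

lemma nn_integral_triangle:
  fixes f :: "real \<Rightarrow> real \<Rightarrow> ennreal"
  assumes [measurable]: "(\<lambda>(r, t). f r t) \<in> borel_measurable (borel \<Otimes>\<^sub>M borel)"
  shows "(\<integral>\<^sup>+r\<in>{a<..<b}. (\<integral>\<^sup>+t\<in>{r<..<b}. f r t \<partial>lborel) \<partial>lborel) =
         (\<integral>\<^sup>+t\<in>{a<..<b}. (\<integral>\<^sup>+r\<in>{a<..<t}. f r t \<partial>lborel) \<partial>lborel)"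
proof -
  let ?g = "\<lambda>r t. f r t * (if a < r \<and> r < t \<and> t < b then 1 else 0)"
  have "(\<integral>\<^sup>+r\<in>{a<..<b}. (\<integral>\<^sup>+t\<in>{r<..<b}. f r t \<partial>lborel) \<partial>lborel) =
        (\<integral>\<^sup>+r. (\<integral>\<^sup>+t. f r t * indicator {r<..<b} t * indicator {a<..<b} r \<partial>lborel) \<partial>lborel)"
    by (intro nn_integral_cong nn_integral_multc[symmetric]) auto
  also have "\<dots> = (\<integral>\<^sup>+r. (\<integral>\<^sup>+t. ?g r t \<partial>lborel) \<partial>lborel)"
    by (intro nn_integral_cong) (auto simp: indicator_def)
  also have "\<dots> = (\<integral>\<^sup>+t. (\<integral>\<^sup>+r. ?g r t \<partial>lborel) \<partial>lborel)"
    by (rule lborel_pair.Fubini') auto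
  also have "\<dots> = (\<integral>\<^sup>+t. (\<integral>\<^sup>+r. f r t * indicator {a<..<t} r * indicator {a<..<b} t \<partial>lborel) \<partial>lborel)"
    by (intro nn_integral_cong) (auto simp: indicator_def)
  also have "\<dots> = (\<integral>\<^sup>+t\<in>{a<..<b}. (\<integral>\<^sup>+r\<in>{a<..<t}. f r t \<partial>lborel) \<partial>lborel)"
    by (intro nn_integral_cong nn_integral_multc) auto
  finally show ?thesis .
qed

text \<open>Valued in \<open>ennreal\<close> because convergence is not clear in advance: at r = 0
  the integral diverges when \<alpha> + 2 \<lambda> \<le> 2. For 0 < r < R finiteness comes out of
  \<open>radial_profile_series\<close>.\<close>

definition radial_profile :: "real \<Rightarrow> real \<Rightarrow> real \<Rightarrow> real \<Rightarrow> ennreal" where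
  "radial_profile \<alpha> lam R r =
     (\<integral>\<^sup>+\<tau>\<in>{r<..<R}. ennreal (\<tau> powr (\<alpha> - 1) * (\<tau>\<^sup>2 - r\<^sup>2) powr (lam - 1)) \<partial>lborel)"

lemma radial_profile_measurable [measurable]: "radial_profile \<alpha> lam R \<in> borel_measurable borel"
proof -
  have "radial_profile \<alpha> lam R = (\<lambda>r. \<integral>\<^sup>+\<tau>. ennreal (\<tau> powr (\<alpha> - 1) * (\<tau>\<^sup>2 - r\<^sup>2) powr (lam - 1)) *
     (if r < \<tau> \<and> \<tau> < R then 1 else 0) \<partial>lborel)"
    unfolding radial_profile_def by (intro ext nn_integral_cong) (auto simp: indicator_def)
  then show ?thesis by simp
qed

lemma nn_integral_powr:
  fixes t R \<alpha> :: real
  assumes "0 < t" "t \<le> R" "0 < \<alpha>"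
  shows "(\<integral>\<^sup>+\<tau>\<in>{t<..<R}. ennreal (\<tau> powr (\<alpha> - 1)) \<partial>lborel) = ennreal ((R powr \<alpha> - t powr \<alpha>) / \<alpha>)"
proof -
  have "(\<integral>\<^sup>+\<tau>. ennreal (\<tau> powr (\<alpha> - 1)) * indicator {t..R} \<tau> \<partial>lborel) =
      ennreal (R powr \<alpha> / \<alpha> - t powr \<alpha> / \<alpha>)"
  proof (rule nn_integral_FTC_Icc)
    fix \<tau> assume "\<tau> \<in> {t..R}"
    then show "((\<lambda>\<tau>. \<tau> powr \<alpha> / \<alpha>) has_real_derivative \<tau> powr (\<alpha> - 1)) (at \<tau>)"
      using assms by (auto intro!: derivative_eq_intros)
  qed (use assms in auto)
  then show ?thesis unfolding nn_integral_Ioo_eq_Icc by (simp add: diff_divide_distrib)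
qed

lemma nn_integral_powr_from_0:
  fixes R e :: real
  assumes "0 < R" "0 < e"
  shows "(\<integral>\<^sup>+\<tau>\<in>{0<..<R}. ennreal (\<tau> powr (e - 1)) \<partial>lborel) = ennreal (R powr e / e)"
  using has_integral_powr_from_0[of "e - 1" R] assms
  unfolding nn_integral_Ioo_eq_Icc by (intro nn_integral_has_integral_lebesgue') auto

text \<open>Abel inversion: after the exchange of integrations, the inner integral over t < r <
  \<tau> is a Beta integral whose exponents sum to 1, hence a constant, and only the integral of
  \<tau>^(\<alpha>-1) over t < \<tau> < R is left. The weight \<tau>^(\<alpha>-1) of the profile is
  the one that makes this a multiple of R^\<alpha> - t^\<alpha>.\<close>

lemma radial_profile_abel:
  fixes t R \<alpha> lam :: real
  assumes lam: "0 < lam" "lam < 1" and "0 < \<alpha>" and t: "0 < t" "t < R"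
  shows "(\<integral>\<^sup>+r\<in>{t<..<R}. ennreal (r * (r\<^sup>2 - t\<^sup>2) powr - lam) * radial_profile \<alpha> lam R r \<partial>lborel) =
         ennreal (Beta (1 - lam) lam / (2 * \<alpha>) * (R powr \<alpha> - t powr \<alpha>))"
proof -
  let ?k = "\<lambda>r. ennreal (r * (r\<^sup>2 - t\<^sup>2) powr - lam)"
  let ?l = "\<lambda>r \<tau>. ennreal (\<tau> powr (\<alpha> - 1) * (\<tau>\<^sup>2 - r\<^sup>2) powr (lam - 1))"
  have B: "0 \<le> Beta (1 - lam) lam" using lam by (simp add: Beta_def Gamma_real_pos less_imp_le)
  have "(\<integral>\<^sup>+r\<in>{t<..<R}. ?k r * radial_profile \<alpha> lam R r \<partial>lborel) =
    (\<integral>\<^sup>+r\<in>{t<..<R}. (\<integral>\<^sup>+\<tau>\<in>{r<..<R}. ?k r *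
       ?l r \<tau> \<partial>lborel) \<partial>lborel)"
    unfolding radial_profile_def
    by (intro set_nn_integral_cong refl, subst nn_integral_cmult[symmetric]) (auto simp: mult.assoc)
  also have "\<dots> = (\<integral>\<^sup>+\<tau>\<in>{t<..<R}. (\<integral>\<^sup>+r\<in>{t<..<\<tau>}. ?k r *
       ?l r \<tau> \<partial>lborel) \<partial>lborel)"
    by (rule nn_integral_triangle) auto
  also have "\<dots> = (\<integral>\<^sup>+\<tau>\<in>{t<..<R}. ennreal (Beta (1 - lam) lam / 2) * ennreal (\<tau> powr (\<alpha> - 1)) \<partial>lborel)"
  proof (intro set_nn_integral_cong refl)
    fix \<tau> assume "\<tau> \<in> space lborel \<inter> {t<..<R}"
    then have \<tau>: "t < \<tau>" by simp
    then have "t\<^sup>2 < \<tau>\<^sup>2" using t by (intro power_strict_mono) auto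
    have "(\<integral>\<^sup>+r\<in>{t<..<\<tau>}. ?k r *
       ?l r \<tau> \<partial>lborel) =
      (\<integral>\<^sup>+r. ennreal (\<tau> powr (\<alpha> - 1)) * (ennreal (r * (r\<^sup>2 - t\<^sup>2) powr ((1 - lam) - 1) *
         (\<tau>\<^sup>2 - r\<^sup>2) powr (lam - 1)) * indicator {t<..<\<tau>} r) \<partial>lborel)"
    proof (intro nn_integral_cong)
      fix r
      have "?k r * ?l r \<tau> =
         ennreal (\<tau> powr (\<alpha> - 1)) * ennreal (r * (r\<^sup>2 - t\<^sup>2) powr ((1 - lam) - 1) * (\<tau>\<^sup>2 - r\<^sup>2) powr (lam - 1))"
        if "t < r" using that t by (simp add: ennreal_mult'[symmetric] mult_ac)
      then show "?k r * ?l r \<tau> *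
           indicator {t<..<\<tau>} r =
         ennreal (\<tau> powr (\<alpha> - 1)) * (ennreal (r * (r\<^sup>2 - t\<^sup>2) powr ((1 - lam) - 1) *
         (\<tau>\<^sup>2 - r\<^sup>2) powr (lam - 1)) * indicator {t<..<\<tau>} r)"
        by (cases "r \<in> {t<..<\<tau>}") auto
    qed
    also have "\<dots> = ennreal (\<tau> powr (\<alpha> - 1)) *
        ennreal ((\<tau>\<^sup>2 - t\<^sup>2) powr ((1 - lam) + lam - 1) * Beta (1 - lam) lam / 2)"
      using t \<tau> lam by (subst nn_integral_cmult, simp, subst beta_annulus) auto
    also have "(\<tau>\<^sup>2 - t\<^sup>2) powr ((1 - lam) + lam - 1) = 1"
      using \<open>t\<^sup>2 < \<tau>\<^sup>2\<close> by simp
    finally show "(\<integral>\<^sup>+r\<in>{t<..<\<tau>}. ?k r *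
       ?l r \<tau> \<partial>lborel) =
       ennreal (Beta (1 - lam) lam / 2) * ennreal (\<tau> powr (\<alpha> - 1))"
      by (simp add: mult.commute)
  qed
  also have "\<dots> = ennreal (Beta (1 - lam) lam / 2) * ennreal ((R powr \<alpha> - t powr \<alpha>) / \<alpha>)"
    using t \<open>0 < \<alpha>\<close> unfolding mult.assoc by (subst nn_integral_cmult, simp, subst nn_integral_powr) auto
  also have "\<dots> = ennreal (Beta (1 - lam) lam / (2 * \<alpha>) * (R powr \<alpha> - t powr \<alpha>))"
    using B by (simp add: ennreal_mult'[symmetric])
  finally show ?thesis .
qed

text \<open>Here n plays the role of the dimension of the disk. The disk of radius \<tau>
  contributes a Beta integral homogeneous of degree n + 2 \<lambda> - 2 in \<tau>, and a pure power
  of \<tau> remains to be integrated.\<close>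

lemma radial_profile_mass:
  fixes R \<alpha> lam n :: real
  assumes lam: "0 < lam" and n: "0 < n" and "0 < \<alpha>" "0 < R" and e: "0 < \<alpha> + n + 2 * lam - 2"
  shows "(\<integral>\<^sup>+r\<in>{0<..<R}. ennreal (r powr (n - 1)) * radial_profile \<alpha> lam R r \<partial>lborel) =
         ennreal (Beta (n / 2) lam / 2 * (R powr (\<alpha> + n + 2 * lam - 2) / (\<alpha> + n + 2 * lam - 2)))"
proof -
  let ?k = "\<lambda>r. ennreal (r powr (n - 1))"
  let ?l = "\<lambda>r \<tau>. ennreal (\<tau> powr (\<alpha> - 1) * (\<tau>\<^sup>2 - r\<^sup>2) powr (lam - 1))"
  have B: "0 \<le> Beta (n / 2) lam" using lam n by (simp add: Beta_def Gamma_real_pos less_imp_le)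
  have "(\<integral>\<^sup>+r\<in>{0<..<R}. ?k r * radial_profile \<alpha> lam R r \<partial>lborel) =
    (\<integral>\<^sup>+r\<in>{0<..<R}. (\<integral>\<^sup>+\<tau>\<in>{r<..<R}. ?k r *
       ?l r \<tau> \<partial>lborel) \<partial>lborel)"
    unfolding radial_profile_def
    by (intro set_nn_integral_cong refl, subst nn_integral_cmult[symmetric]) (auto simp: mult.assoc)
  also have "\<dots> = (\<integral>\<^sup>+\<tau>\<in>{0<..<R}. (\<integral>\<^sup>+r\<in>{0<..<\<tau>}. ?k r *
       ?l r \<tau> \<partial>lborel) \<partial>lborel)"
    by (rule nn_integral_triangle) auto
  also have "\<dots> = (\<integral>\<^sup>+\<tau>\<in>{0<..<R}. ennreal (Beta (n / 2) lam / 2) * ennreal (\<tau> powr (\<alpha> + n + 2 * lam - 2 - 1)) \<partial>lborel)"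
  proof (intro set_nn_integral_cong refl)
    fix \<tau> assume "\<tau> \<in> space lborel \<inter> {0<..<R}"
    then have \<tau>: "0 < \<tau>" by simp
    have "(\<integral>\<^sup>+r\<in>{0<..<\<tau>}. ?k r *
       ?l r \<tau> \<partial>lborel) =
      (\<integral>\<^sup>+r. ennreal (\<tau> powr (\<alpha> - 1)) * (ennreal (r powr (n - 1) *
         (\<tau>\<^sup>2 - r\<^sup>2) powr (lam - 1)) * indicator {0<..<\<tau>} r) \<partial>lborel)"
      by (intro nn_integral_cong) (simp add: ennreal_mult' mult_ac)
    also have "\<dots> = ennreal (\<tau> powr (\<alpha> - 1)) * ennreal (\<tau> powr (n + 2 * lam - 2) * Beta (n / 2) lam / 2)"
      using \<tau> n lam by (subst nn_integral_cmult, simp, subst beta_ball) auto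
    also have "\<dots> = ennreal ((\<tau> powr (\<alpha> - 1) * \<tau> powr (n + 2 * lam - 2)) * (Beta (n / 2) lam / 2))"
      by (simp add: ennreal_mult'[symmetric] mult.assoc)
    also have "\<tau> powr (\<alpha> - 1) * \<tau> powr (n + 2 * lam - 2) = \<tau> powr (\<alpha> + n + 2 * lam - 2 - 1)"
      by (simp add: powr_add[symmetric] algebra_simps)
    also have "ennreal (\<tau> powr (\<alpha> + n + 2 * lam - 2 - 1) * (Beta (n / 2) lam / 2)) =
        ennreal (Beta (n / 2) lam / 2) * ennreal (\<tau> powr (\<alpha> + n + 2 * lam - 2 - 1))"
      using B by (subst mult.commute, intro ennreal_mult') simp
    finally show "(\<integral>\<^sup>+r\<in>{0<..<\<tau>}. ?k r *
       ?l r \<tau> \<partial>lborel) =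
       ennreal (Beta (n / 2) lam / 2) * ennreal (\<tau> powr (\<alpha> + n + 2 * lam - 2 - 1))" .
  qed
  also have "\<dots> = ennreal (Beta (n / 2) lam / 2) *
      (\<integral>\<^sup>+\<tau>\<in>{0<..<R}. ennreal (\<tau> powr (\<alpha> + n + 2 * lam - 2 - 1)) \<partial>lborel)"
    unfolding mult.assoc by (rule nn_integral_cmult) simp
  also have "(\<integral>\<^sup>+\<tau>\<in>{0<..<R}. ennreal (\<tau> powr (\<alpha> + n + 2 * lam - 2 - 1)) \<partial>lborel) =
      ennreal (R powr (\<alpha> + n + 2 * lam - 2) / (\<alpha> + n + 2 * lam - 2))"
    using e \<open>0 < R\<close> by (intro nn_integral_powr_from_0) auto
  finally show ?thesis
    using B by (simp add: ennreal_mult'[symmetric])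
qed

text \<open>The spherical mean turns the potential into a double integral over 0 < t < r < R in
  which r occurs only through r (r^2 - t^2)^(-\<lambda>) times the profile, the integrand of
  \<open>radial_profile_abel\<close>. The condition t < |x| of the mean survives in the bound
  \<open>min (norm x) R\<close>.\<close>

theorem radial_potential:
  fixes x :: "real ^ 'n"
  assumes lam: "0 < lam" "lam < 1" and N: "2 \<le> CARD('n)"
    and s: "s = real CARD('n) - 2 + 2 * lam"
    and \<alpha>: "0 < \<alpha>" and R: "0 < R" and x: "0 < norm x"
  shows "ennreal (Beta (1 - lam) (s / 2)) *
      (\<integral>\<^sup>+r\<in>{0<..<R}. radial_profile \<alpha> lam R r * ennreal (r ^ (CARD('n) - 1)) *
         (\<integral>\<^sup>+u. ennreal (norm (x - r *\<^sub>R u) powr - s) \<partial>surface_measure) \<partial>lborel) =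
    ennreal (sphere_area CARD('n) * Beta (1 - lam) lam / \<alpha> * norm x powr (2 - real CARD('n))) *
      (\<integral>\<^sup>+t\<in>{0<..<min (norm x) R}.
         ennreal (t powr (s - 1) * ((norm x)\<^sup>2 - t\<^sup>2) powr - lam * (R powr \<alpha> - t powr \<alpha>)) \<partial>lborel)"
proof -
  let ?S = "\<lambda>r. \<integral>\<^sup>+u. ennreal (norm (x - r *\<^sub>R u) powr - s) \<partial>surface_measure"
  let ?B = "ennreal (Beta (1 - lam) (s / 2))"
  define N where "N = real CARD('n)"
  define \<rho> where "\<rho> = norm x"
  let ?w = "\<lambda>r t. t powr (s - 1) * ((\<rho>\<^sup>2 - t\<^sup>2) * (r\<^sup>2 - t\<^sup>2)) powr - lam"
  define H where "H = radial_profile \<alpha> lam R"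
  have [measurable]: "H \<in> borel_measurable borel" by (simp add: H_def)
  have area: "0 < sphere_area CARD('n)" by (simp add: sphere_area_pos)
  have B: "0 < Beta (1 - lam) lam" using lam by (simp add: Beta_def Gamma_real_pos)
  interpret finite_measure "surface_measure :: (real ^ 'n) measure"
    by (rule finite_measure_surface_measure)
  have [measurable]: "(\<lambda>r. ?S r) \<in> borel_measurable borel"
    by simp
  define w where "w t = t powr (s - 1) * (\<rho>\<^sup>2 - t\<^sup>2) powr - lam" for t
  have [measurable]: "w \<in> borel_measurable borel" by (simp add: w_def[abs_def])
  have w0: "0 \<le> w t" for t by (simp add: w_def)
  define c where "c = 2 * sphere_area CARD('n) * \<rho> powr (2 - N)"
  have c0: "0 \<le> c" using area by (simp add: c_def)
  define F where "F t r = indicator {..<\<rho>} t * (ennreal (c * w t) * (ennreal (r * (r\<^sup>2 - t\<^sup>2) powr - lam) * H r))" for t r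
  have "?B *
      (\<integral>\<^sup>+r\<in>{0<..<R}. H r * ennreal (r ^ (CARD('n) - 1)) *
         ?S r \<partial>lborel) =
     (\<integral>\<^sup>+r. ?B * (H r * ennreal (r ^ (CARD('n) - 1)) *
         ?S r * indicator {0<..<R} r) \<partial>lborel)"
    by (rule nn_integral_cmult[symmetric]) simp
  also have "\<dots> = (\<integral>\<^sup>+r\<in>{0<..<R}. (\<integral>\<^sup>+t\<in>{0<..<r}. F t r \<partial>lborel) \<partial>lborel)"
  proof (intro nn_integral_cong_AE eventually_mono[OF AE_lborel_singleton[of \<rho>]])
    fix r assume "r \<noteq> \<rho>"
    have "?B * (H r * ennreal (r ^ (CARD('n) - 1)) *
         ?S r) = (\<integral>\<^sup>+t\<in>{0<..<r}. F t r \<partial>lborel)"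
      if r: "0 < r" "r < R"
    proof -
      define c1 where "c1 = 2 * sphere_area CARD('n) * (\<rho> * r) powr (2 - N)"
      have c10: "0 \<le> c1" using area by (simp add: c1_def)
      \<comment> \<open>The factor r^(N-1) of the volume and r^(2-N) of the mean leave exactly the
        weight r of the Abel integral.\<close>
      have "r ^ (CARD('n) - 1) * c1 = c * r"
      proof -
        have "r ^ (CARD('n) - 1) = r powr (N - 1)"
          using r N by (simp add: powr_realpow[symmetric] of_nat_diff N_def)
        then have "r ^ (CARD('n) - 1) * c1 = c * (r powr (N - 1) * r powr (2 - N))"
          using r x by (simp add: c1_def c_def powr_mult \<rho>_def)
        also have "r powr (N - 1) * r powr (2 - N) = r"
          using r by (simp flip: powr_add)
        finally show ?thesis .
      qed
      then have cc: "ennreal (r ^ (CARD('n) - 1)) * ennreal c1 = ennreal c * ennreal r"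
        using r c0 by (simp flip: ennreal_mult')
      have "?B * (H r * ennreal (r ^ (CARD('n) - 1)) *
         ?S r) =
         H r * ennreal (r ^ (CARD('n) - 1)) * (?B *
          ?S r)"
        by (simp only: mult_ac)
      also have "\<dots> = H r * (ennreal (r ^ (CARD('n) - 1)) * ennreal c1) *
         (\<integral>\<^sup>+t\<in>{0<..<min \<rho> r}. ennreal (?w r t) \<partial>lborel)"
        using sphere_riesz_mean[OF lam N s, of r x] r x \<open>r \<noteq> \<rho>\<close>
        by (simp add: \<rho>_def c1_def N_def mult_ac)
      also have "\<dots> = (\<integral>\<^sup>+t. H r * (ennreal c * ennreal r) *
         (ennreal (?w r t) * indicator {0<..<min \<rho> r} t) \<partial>lborel)"
        unfolding cc by (rule nn_integral_cmult[symmetric]) simp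
      also have "\<dots> = (\<integral>\<^sup>+t\<in>{0<..<r}. F t r \<partial>lborel)"
      proof (intro nn_integral_cong)
        fix t :: real
        have "H r * (ennreal c * ennreal r) * ennreal (?w r t) = F t r"
          if t: "0 < t" "t < \<rho>" "t < r"
        proof -
          have "t\<^sup>2 < \<rho>\<^sup>2" "t\<^sup>2 < r\<^sup>2" using t by (auto intro!: power_strict_mono)
          then have "?w r t = w t * (r\<^sup>2 - t\<^sup>2) powr - lam"
            by (simp add: powr_mult w_def)
          then show ?thesis
            using t r c0 w0 by (simp add: F_def ennreal_mult' mult_ac)
        qed
        then show "H r * (ennreal c * ennreal r) *
         (ennreal (?w r t) * indicator {0<..<min \<rho> r} t) =
         F t r * indicator {0<..<r} t"
          by (cases "0 < t"; cases "t < r"; cases "t < \<rho>") (auto simp: F_def indicator_def)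
      qed
      finally show ?thesis .
    qed
    then show "?B * (H r * ennreal (r ^ (CARD('n) - 1)) *
         ?S r * indicator {0<..<R} r) =
         (\<integral>\<^sup>+t\<in>{0<..<r}. F t r \<partial>lborel) * indicator {0<..<R} r"
      by (cases "r \<in> {0<..<R}") auto
  qed
  also have "\<dots> = (\<integral>\<^sup>+t\<in>{0<..<R}. (\<integral>\<^sup>+r\<in>{t<..<R}. F t r \<partial>lborel) \<partial>lborel)"
    by (rule nn_integral_triangle[symmetric]) (simp add: F_def)
  also have "\<dots> = (\<integral>\<^sup>+t. ennreal (sphere_area CARD('n) * Beta (1 - lam) lam / \<alpha> * \<rho> powr (2 - N)) *
      (ennreal (w t * (R powr \<alpha> - t powr \<alpha>)) * indicator {0<..<min \<rho> R} t) \<partial>lborel)"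
  proof (intro nn_integral_cong)
    fix t :: real
    have "(\<integral>\<^sup>+r\<in>{t<..<R}. F t r \<partial>lborel) = indicator {..<\<rho>} t *
       (ennreal (sphere_area CARD('n) * Beta (1 - lam) lam / \<alpha> * \<rho> powr (2 - N)) * ennreal (w t * (R powr \<alpha> - t powr \<alpha>)))"
      if t: "0 < t" "t < R"
    proof -
      have "(\<integral>\<^sup>+r\<in>{t<..<R}. F t r \<partial>lborel) = indicator {..<\<rho>} t * (ennreal (c * w t) *
          (\<integral>\<^sup>+r\<in>{t<..<R}. ennreal (r * (r\<^sup>2 - t\<^sup>2) powr - lam) * H r \<partial>lborel))"
        unfolding F_def mult.assoc by (subst nn_integral_cmult, simp, subst nn_integral_cmult) auto
      also have "(\<integral>\<^sup>+r\<in>{t<..<R}. ennreal (r * (r\<^sup>2 - t\<^sup>2) powr - lam) * H r \<partial>lborel) =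
          ennreal (Beta (1 - lam) lam / (2 * \<alpha>) * (R powr \<alpha> - t powr \<alpha>))"
        unfolding H_def using lam \<alpha> t by (rule radial_profile_abel)
      also have "ennreal (c * w t) * ennreal (Beta (1 - lam) lam / (2 * \<alpha>) * (R powr \<alpha> - t powr \<alpha>)) =
         ennreal (sphere_area CARD('n) * Beta (1 - lam) lam / \<alpha> * \<rho> powr (2 - N)) * ennreal (w t * (R powr \<alpha> - t powr \<alpha>))"
      proof -
        have "0 \<le> sphere_area CARD('n) * Beta (1 - lam) lam / \<alpha> * \<rho> powr (2 - N)"
          using area B \<alpha> by simp
        moreover have "c * w t * (Beta (1 - lam) lam / (2 * \<alpha>) * (R powr \<alpha> - t powr \<alpha>)) =
            sphere_area CARD('n) * Beta (1 - lam) lam / \<alpha> * \<rho> powr (2 - N) * (w t * (R powr \<alpha> - t powr \<alpha>))"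
          by (simp add: c_def)
        ultimately show ?thesis
          using c0 w0[of t] by (simp only: ennreal_mult'[symmetric] mult_nonneg_nonneg)
      qed
      finally show ?thesis .
    qed
    then show "(\<integral>\<^sup>+r\<in>{t<..<R}. F t r \<partial>lborel) * indicator {0<..<R} t =
      ennreal (sphere_area CARD('n) * Beta (1 - lam) lam / \<alpha> * \<rho> powr (2 - N)) *
      (ennreal (w t * (R powr \<alpha> - t powr \<alpha>)) * indicator {0<..<min \<rho> R} t)"
      by (cases "0 < t"; cases "t < R"; cases "t < \<rho>") (auto simp: indicator_def)
  qed
  also have "\<dots> = ennreal (sphere_area CARD('n) * Beta (1 - lam) lam / \<alpha> * \<rho> powr (2 - N)) *
      (\<integral>\<^sup>+t\<in>{0<..<min \<rho> R}. ennreal (w t * (R powr \<alpha> - t powr \<alpha>)) \<partial>lborel)"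
    by (rule nn_integral_cmult) simp
  finally show ?thesis by (simp only: H_def \<rho>_def N_def w_def)
qed

section \<open>Uniqueness by positive definiteness\<close>

definition mutual_energy :: "real \<Rightarrow> 'a::metric_space measure \<Rightarrow> 'a measure \<Rightarrow> ennreal" where
  "mutual_energy s \<mu> \<nu> = (\<integral>\<^sup>+x. \<integral>\<^sup>+y. riesz_kernel s x y \<partial>\<nu> \<partial>\<mu>)"

lemma riesz_energy_eq: "riesz_energy s \<mu> = mutual_energy s \<mu> \<mu>"
  by (simp add: riesz_energy_def mutual_energy_def)

section \<open>The Riesz kernel as a superposition of Gaussians\<close>

lemma nn_integral_gaussian_real: "(\<integral>\<^sup>+x. ennreal (exp (- (x :: real)\<^sup>2)) \<partial>lborel) = ennreal (sqrt pi)"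
proof -
  have eq: "exp (- x\<^sup>2) = sqrt pi * normal_density 0 (1 / sqrt 2) x" for x :: real
    by (simp add: normal_density_def power_divide)
  have "(\<integral>\<^sup>+x. ennreal (sqrt pi * normal_density 0 (1 / sqrt 2) x) \<partial>lborel) =
      ennreal (LINT x|lborel. sqrt pi * normal_density 0 (1 / sqrt 2) x)"
    by (intro nn_integral_eq_integral integrable_mult_right integrable_normal_density) auto
  also have "(LINT x|lborel. sqrt pi * normal_density 0 (1 / sqrt 2) x) = sqrt pi"
    by simp
  finally show ?thesis unfolding eq .
qed

lemma nn_integral_gaussian:
  "(\<integral>\<^sup>+z. ennreal (exp (- (norm z)\<^sup>2)) \<partial>(lborel :: 'a::euclidean_space measure)) = ennreal (sqrt pi ^ DIM('a))"
proof -
  have "ennreal (exp (- (norm z)\<^sup>2)) = (\<Prod>b\<in>Basis. ennreal (exp (- (z \<bullet> b)\<^sup>2)))" for z :: 'a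
  proof -
    have "(norm z)\<^sup>2 = (\<Sum>b\<in>Basis. (z \<bullet> b)\<^sup>2)"
      unfolding power2_norm_eq_inner by (subst euclidean_inner) (simp add: power2_eq_square)
    then show ?thesis by (simp add: exp_sum sum_negf[symmetric] prod_ennreal)
  qed
  then have "(\<integral>\<^sup>+z. ennreal (exp (- (norm z)\<^sup>2)) \<partial>(lborel :: 'a measure)) =
      (\<integral>\<^sup>+z. (\<Prod>b\<in>Basis. ennreal (exp (- (z \<bullet> b)\<^sup>2))) \<partial>(lborel :: 'a measure))"
    by simp
  also have "\<dots> = (\<Prod>b\<in>(Basis :: 'a set). (\<integral>\<^sup>+x. ennreal (exp (- (x :: real)\<^sup>2)) \<partial>lborel))"
    by (rule nn_integral_lborel_prod) auto
  finally show ?thesis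
    by (simp add: nn_integral_gaussian_real ennreal_power)
qed

text \<open>About the midpoint m of x and y, the parallelogram law splits the sum of the two squared
  distances into |x - y|^2 / 2 and twice the squared distance of z from m. So the exponent 2 t in
  each factor yields t |x - y|^2, and the scale c = 1 / (2 sqrt t) normalizes the remaining
  Gaussian.\<close>

lemma gaussian_product:
  fixes x y :: "'a::euclidean_space"
  assumes t: "0 < t"
  shows "(\<integral>\<^sup>+z. ennreal (exp (- 2 * t * (norm (x - z))\<^sup>2) * exp (- 2 * t * (norm (y - z))\<^sup>2)) \<partial>lborel) =
         ennreal ((sqrt pi / (2 * sqrt t)) ^ DIM('a) * exp (- t * (norm (x - y))\<^sup>2))"
proof -
  define c where "c = 1 / (2 * sqrt t)"
  have c: "0 < c" "4 * t * c\<^sup>2 = 1" using t by (auto simp: c_def power_divide power_mult_distrib)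
  define m h where "m = (1 / 2) *\<^sub>R (x + y)" and "h = (1 / 2) *\<^sub>R (x - y)"
  have xy: "x - m = h" "y - m = - h"
    by (auto simp: m_def h_def algebra_simps scaleR_left_distrib[symmetric])
  have "exp (- 2 * t * (norm (x - (m + c *\<^sub>R w)))\<^sup>2) * exp (- 2 * t * (norm (y - (m + c *\<^sub>R w)))\<^sup>2) =
      exp (- t * (norm (x - y))\<^sup>2) * exp (- (norm w)\<^sup>2)" for w
  proof -
    have "x - (m + c *\<^sub>R w) = h - c *\<^sub>R w" "y - (m + c *\<^sub>R w) = - (h + c *\<^sub>R w)"
      using xy by (auto simp: algebra_simps)
    then have "(norm (x - (m + c *\<^sub>R w)))\<^sup>2 + (norm (y - (m + c *\<^sub>R w)))\<^sup>2 = 2 * (norm h)\<^sup>2 + 2 * (c\<^sup>2 * (norm w)\<^sup>2)"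
      by (simp only: norm_minus_cancel power2_norm_eq_inner)
         (simp add: inner_diff_left inner_diff_right inner_add_left inner_add_right inner_commute power2_eq_square algebra_simps)
    moreover have "(norm (x - y))\<^sup>2 = 4 * (norm h)\<^sup>2"
      by (simp add: h_def power_divide)
    ultimately have "- 2 * t * (norm (x - (m + c *\<^sub>R w)))\<^sup>2 + - 2 * t * (norm (y - (m + c *\<^sub>R w)))\<^sup>2 =
      - t * (norm (x - y))\<^sup>2 - (4 * t * c\<^sup>2) * (norm w)\<^sup>2"
      unfolding distrib_left[symmetric] by (simp add: algebra_simps)
    then show ?thesis
      unfolding exp_add[symmetric] c(2) by (simp add: exp_add[symmetric])
  qed
  then have "(\<integral>\<^sup>+z. ennreal (exp (- 2 * t * (norm (x - z))\<^sup>2) * exp (- 2 * t * (norm (y - z))\<^sup>2)) \<partial>lborel) =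
    ennreal (c ^ DIM('a)) * (\<integral>\<^sup>+w. ennreal (exp (- t * (norm (x - y))\<^sup>2)) * ennreal (exp (- (norm (w :: 'a))\<^sup>2)) \<partial>lborel)"
    using c by (subst nn_integral_lborel_scaleR[of _ c m]) (auto simp: ennreal_mult')
  also have "\<dots> = ennreal (c ^ DIM('a) * exp (- t * (norm (x - y))\<^sup>2) * sqrt pi ^ DIM('a))"
    using c by (subst nn_integral_cmult) (auto simp: nn_integral_gaussian ennreal_mult' mult.assoc)
  also have "c ^ DIM('a) * exp (- t * (norm (x - y))\<^sup>2) * sqrt pi ^ DIM('a) =
      (sqrt pi / (2 * sqrt t)) ^ DIM('a) * exp (- t * (norm (x - y))\<^sup>2)"
    by (simp add: c_def power_divide power_mult_distrib)
  finally show ?thesis .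
qed

lemma nn_integral_powr_eq_top:
  assumes a: "(0::real) < a"
  shows "(\<integral>\<^sup>+t\<in>{0<..}. ennreal (t powr (a - 1)) \<partial>lborel) = \<infinity>"
proof (cases "\<integral>\<^sup>+t\<in>{0<..}. ennreal (t powr (a - 1)) \<partial>lborel")
  case (real y)
  define R where "R = (a * (y + 1)) powr (1 / a)"
  have R: "0 < R" "R powr a = a * (y + 1)"
    using a real by (auto simp: R_def powr_powr)
  have "ennreal (R powr a / a) = (\<integral>\<^sup>+t\<in>{0<..<R}. ennreal (t powr (a - 1)) \<partial>lborel)"
    using nn_integral_powr_from_0[OF R(1) a] by simp
  also have "\<dots> \<le> (\<integral>\<^sup>+t\<in>{0<..}. ennreal (t powr (a - 1)) \<partial>lborel)"
    by (intro nn_integral_mono) (auto simp: indicator_def)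
  finally have "ennreal (y + 1) \<le> ennreal y" using R a real by simp
  then show ?thesis using real by (simp add: ennreal_le_iff)
qed simp

text \<open>Off the diagonal this is Euler's integral after the scaling of t by |x - y|^2. On the
  diagonal the Gaussians are 1 and the integral of t^(s/2-1) diverges at infinity, in accordance
  with the value \<infinity> of the kernel; hence there is no exceptional set, and atoms of a
  measure are accounted for.\<close>

lemma riesz_kernel_gamma:
  assumes s: "0 < s"
  shows "ennreal (Gamma (s / 2)) * riesz_kernel s x y =
    (\<integral>\<^sup>+t\<in>{0<..}. ennreal (t powr (s / 2 - 1) * exp (- t * (dist x y)\<^sup>2)) \<partial>lborel)"
proof (cases "x = y")
  case True
  have "0 < Gamma (s / 2)" using s by (intro Gamma_real_pos) simp
  then have "Gamma (s / 2) \<noteq> 0" "\<not> Gamma (s / 2) \<le> 0" by linarith+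
  then show ?thesis
    using True nn_integral_powr_eq_top[of "s / 2"] s
    by (simp add: riesz_kernel_def ennreal_mult_top)
next
  case False
  define D where "D = (dist x y)\<^sup>2"
  have D: "0 < D" using False by (simp add: D_def)
  define f where "f t = t powr (s / 2 - 1) / exp t" for t :: real
  let ?C = "ennreal (D powr (1 - s / 2))"
  let ?f = "\<lambda>t. ennreal (f (D * t)) * indicator {0..} (D * t)"
  have "(\<integral>\<^sup>+t. ennreal (t powr (s / 2 - 1) * exp (- t * D)) * indicator {0<..} t \<partial>lborel) =
    (\<integral>\<^sup>+t. ?C * (?f t) \<partial>lborel)"
  proof (intro nn_integral_cong_AE eventually_mono[OF AE_lborel_singleton[of 0]])
    fix t :: real assume "t \<noteq> 0"
    have eq: "t powr (s / 2 - 1) * exp (- t * D) = D powr (1 - s / 2) * f (D * t)" if "0 < t"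
    proof -
      have "D powr (1 - s / 2) * D powr (s / 2 - 1) = D powr ((1 - s / 2) + (s / 2 - 1))"
        by (rule powr_add[symmetric])
      also have "(1 - s / 2) + (s / 2 - 1) = 0" by simp
      finally have "D powr (1 - s / 2) * D powr (s / 2 - 1) = 1" using D by simp
      moreover have "(D * t) powr (s / 2 - 1) = D powr (s / 2 - 1) * t powr (s / 2 - 1)"
        using D that by (intro powr_mult)
      moreover have "exp (- t * D) = 1 / exp (D * t)"
        by (simp add: exp_minus inverse_eq_divide mult.commute)
      ultimately show ?thesis
        unfolding f_def by (simp only: times_divide_eq_right mult.assoc[symmetric] mult_1 mult_1_right)
    qed
    show "ennreal (t powr (s / 2 - 1) * exp (- t * D)) * indicator {0<..} t =
        ?C * (?f t)"
    proof (cases "0 < t")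
      case True
      then show ?thesis unfolding eq[OF True] using D by (simp add: ennreal_mult')
    next
      case False
      then have "\<not> 0 \<le> D * t" using D \<open>t \<noteq> 0\<close> by (simp add: zero_le_mult_iff)
      then show ?thesis using False by simp
    qed
  qed
  also have "\<dots> = ?C * (\<integral>\<^sup>+t. ?f t \<partial>lborel)"
    by (rule nn_integral_cmult) (simp add: f_def)
  also have "(\<integral>\<^sup>+t. ?f t \<partial>lborel) =
      ennreal (1 / D) * (\<integral>\<^sup>+t. ennreal (f t) * indicator {0..} t \<partial>lborel)"
  proof -
    have "(\<integral>\<^sup>+t. ennreal (f t) * indicator {0..} t \<partial>lborel) =
        ennreal D * (\<integral>\<^sup>+t. ?f t \<partial>lborel)"
      using D by (subst nn_integral_real_affine[where c = D and t = 0]) (auto simp: f_def)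
    then show ?thesis
      using D by (simp add: mult.assoc[symmetric] ennreal_mult'[symmetric])
  qed
  also have "(\<integral>\<^sup>+t. ennreal (f t) * indicator {0..} t \<partial>lborel) = ennreal (Gamma (s / 2))"
    using Gamma_integral_real[of "s / 2"] s unfolding f_def
    by (intro nn_integral_has_integral_lebesgue') auto
  also have "?C * (ennreal (1 / D) * ennreal (Gamma (s / 2))) =
      ennreal (Gamma (s / 2)) * ennreal (D powr (- (s / 2)))"
  proof -
    have "D powr (1 - s / 2) * (1 / D) = D powr (- (s / 2))"
      using D powr_diff[of D "1 - s / 2" 1] by simp
    moreover have "0 < Gamma (s / 2)" using s by (intro Gamma_real_pos) simp
    ultimately show ?thesis
      using D by (simp add: mult.assoc[symmetric] ennreal_mult'[symmetric] mult.commute)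
        (metis times_divide_eq_right)
  qed
  also have "D powr (- (s / 2)) = dist x y powr - s"
    using False by (simp add: D_def power2_powr)
  finally show ?thesis
    using False by (simp add: riesz_kernel_def D_def)
qed

text \<open>For p = (t, z): a Gaussian centred at z, with the square root of the weight that
  combines the Gamma integral and the normalization in \<open>gaussian_product\<close>. A product of
  two factors contains the full weight, and its integral over p returns the Riesz kernel.\<close>

definition heat_factor :: "real \<Rightarrow> real \<times> 'a::euclidean_space \<Rightarrow> 'a \<Rightarrow> real" where
  "heat_factor s p x = (if 0 < fst p then
     sqrt (fst p powr (s / 2 - 1) / (Gamma (s / 2) * (sqrt pi / (2 * sqrt (fst p))) ^ DIM('a))) *
     exp (- 2 * fst p * (norm (x - snd p))\<^sup>2) else 0)"

lemma heat_factor_measurable [measurable]: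
  "(\<lambda>(p, x). heat_factor s p x) \<in> borel_measurable (borel \<Otimes>\<^sub>M borel)"
proof -
  have [measurable]: "(\<lambda>q :: (real \<times> 'a) \<times> 'a. fst (fst q)) \<in> borel_measurable borel"
    "(\<lambda>q :: (real \<times> 'a) \<times> 'a. norm (snd q - snd (fst q))) \<in> borel_measurable borel"
    by (intro borel_measurable_continuous_onI continuous_intros)+
  show ?thesis
    unfolding heat_factor_def[abs_def] case_prod_beta borel_prod by measurable
qed

lemma heat_factor_measurable_lborel [measurable]:
  "(\<lambda>p. heat_factor s p x) \<in> borel_measurable (lborel \<Otimes>\<^sub>M lborel)"
  unfolding lborel_prod by measurable

lemma riesz_kernel_heat:
  fixes x y :: "'a::euclidean_space"
  assumes s: "0 < s"
  shows "riesz_kernel s x y =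
    (\<integral>\<^sup>+p. ennreal (heat_factor s p x) * ennreal (heat_factor s p y) \<partial>(lborel \<Otimes>\<^sub>M lborel))"
proof -
  let ?e = "\<lambda>t z. exp (- 2 * t * (norm (x - z))\<^sup>2) * exp (- 2 * t * (norm (y - z))\<^sup>2)"
  let ?H = "\<lambda>t z. ennreal (heat_factor s (t, z) x) * ennreal (heat_factor s (t, z) y)"
  let ?k = "\<lambda>t. ennreal (t powr (s / 2 - 1) * exp (- t * (dist x y)\<^sup>2))"
  define G where "G = Gamma (s / 2)"
  have G: "0 < G" using s by (simp add: G_def Gamma_real_pos)
  have "(\<integral>\<^sup>+p. ennreal (heat_factor s p x) * ennreal (heat_factor s p y) \<partial>(lborel \<Otimes>\<^sub>M lborel)) =
    (\<integral>\<^sup>+t. (\<integral>\<^sup>+z. ?H t z \<partial>lborel) \<partial>lborel)"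
    by (rule lborel.nn_integral_fst[symmetric]) simp
  also have "\<dots> = (\<integral>\<^sup>+t. ennreal (1 / G) * (?k t * indicator {0<..} t) \<partial>lborel)"
  proof (intro nn_integral_cong)
    fix t :: real
    show "(\<integral>\<^sup>+z. ?H t z \<partial>lborel) =
      ennreal (1 / G) * (?k t * indicator {0<..} t)"
    proof (cases "0 < t")
      case True
      define K where "K = (sqrt pi / (2 * sqrt t)) ^ DIM('a)"
      have K: "0 < K" using True by (simp add: K_def)
      define w where "w = t powr (s / 2 - 1) / (G * K)"
      have w: "0 \<le> w" using K G by (simp add: w_def)
      have "(\<integral>\<^sup>+z. ?H t z \<partial>lborel) =
        (\<integral>\<^sup>+z. ennreal w * ennreal (?e t z) \<partial>lborel)"
      proof (intro nn_integral_cong)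
        fix z
        have "heat_factor s (t, z) x * heat_factor s (t, z) y =
           (sqrt w * sqrt w) * (?e t z)"
          using True by (simp add: heat_factor_def w_def G_def K_def del: real_sqrt_mult_self)
        also have "sqrt w * sqrt w = w" using w by simp
        finally show "?H t z =
           ennreal w * ennreal (?e t z)"
          using w True K G
          by (subst (1 2) ennreal_mult'[symmetric]) (auto simp: heat_factor_def G_def[symmetric] K_def[symmetric])
      qed
      also have "\<dots> = ennreal w * ennreal (K * exp (- t * (norm (x - y))\<^sup>2))"
        using gaussian_product[OF True, of x y] by (subst nn_integral_cmult) (auto simp: K_def)
      also have "\<dots> = ennreal (1 / G) * ?k t"
        using w K G by (simp add: ennreal_mult'[symmetric] w_def dist_norm)
      finally show ?thesis using True by simp
    qed (simp add: heat_factor_def)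
  qed
  also have "\<dots> = ennreal (1 / G) * (ennreal G * riesz_kernel s x y)"
    unfolding G_def riesz_kernel_gamma[OF s] by (rule nn_integral_cmult) simp
  also have "\<dots> = riesz_kernel s x y"
    using G by (simp add: mult.assoc[symmetric] ennreal_mult'[symmetric])
  finally show ?thesis by simp
qed

definition heat_potential :: "real \<Rightarrow> 'a::euclidean_space measure \<Rightarrow> real \<times> 'a \<Rightarrow> ennreal" where
  "heat_potential s \<mu> p = (\<integral>\<^sup>+x. ennreal (heat_factor s p x) \<partial>\<mu>)"

lemma heat_potential_measurable [measurable]:
  assumes "finite_measure \<mu>" and [measurable_cong]: "sets \<mu> = sets borel"
  shows "heat_potential s \<mu> \<in> borel_measurable borel"
proof -
  interpret finite_measure \<mu> by fact
  show ?thesis unfolding heat_potential_def[abs_def] by measurable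
qed

lemma heat_factor_bounded: "\<bar>heat_factor s p x\<bar> \<le> \<bar>heat_factor s p (snd p)\<bar>"
proof (cases "0 < fst p")
  case True
  have "\<bar>a * exp (- 2 * fst p * (norm (x - snd p))\<^sup>2)\<bar> \<le> \<bar>a\<bar>" for a
    using True by (simp add: abs_mult mult_left_le)
  then show ?thesis using True by (simp add: heat_factor_def)
qed (simp add: heat_factor_def)

text \<open>Finiteness at every p permits the passage to real numbers in \<open>energy_gap\<close>,
  where a difference is squared, even if the energies themselves are infinite.\<close>

lemma heat_potential_finite:
  assumes "finite_measure \<mu>" and [measurable_cong]: "sets \<mu> = sets borel"
  shows "heat_potential s \<mu> p \<noteq> \<infinity>"
proof -
  interpret finite_measure \<mu> by fact
  have "heat_potential s \<mu> p \<le> (\<integral>\<^sup>+x. ennreal \<bar>heat_factor s p (snd p)\<bar> \<partial>\<mu>)"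
    unfolding heat_potential_def
    by (intro nn_integral_mono ennreal_leI order.trans[OF abs_ge_self heat_factor_bounded])
  also have "\<dots> < \<infinity>" by (simp add: emeasure_eq_measure ennreal_mult_less_top)
  finally show ?thesis by simp
qed

text \<open>Positive definiteness becomes visible here: for equal measures the integrand is a
  square.\<close>

lemma mutual_energy_heat:
  fixes \<mu> \<nu> :: "'a::euclidean_space measure"
  assumes s: "0 < s"
    and "finite_measure \<mu>" and [measurable_cong]: "sets \<mu> = sets borel"
    and "finite_measure \<nu>" and [measurable_cong]: "sets \<nu> = sets borel"
  shows "mutual_energy s \<mu> \<nu> = (\<integral>\<^sup>+p. heat_potential s \<mu> p * heat_potential s \<nu> p \<partial>(lborel \<Otimes>\<^sub>M lborel))"
proof -
  interpret M: finite_measure \<mu> by fact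
  interpret N: finite_measure \<nu> by fact
  define P where "P = (lborel \<Otimes>\<^sub>M lborel :: (real \<times> 'a) measure)"
  interpret PP: sigma_finite_measure P unfolding P_def lborel_prod by (rule sigma_finite_lborel)
  have [measurable_cong]: "sets P = sets borel" by (simp add: P_def lborel_prod)
  interpret NP: pair_sigma_finite \<nu> P ..
  interpret MP: pair_sigma_finite \<mu> P ..
  let ?h = "\<lambda>p x. ennreal (heat_factor s p x)"
  have "mutual_energy s \<mu> \<nu> = (\<integral>\<^sup>+x. \<integral>\<^sup>+y. \<integral>\<^sup>+p. ?h p x * ?h p y \<partial>P \<partial>\<nu> \<partial>\<mu>)"
    unfolding mutual_energy_def P_def by (intro nn_integral_cong riesz_kernel_heat[OF s])
  also have "\<dots> = (\<integral>\<^sup>+x. \<integral>\<^sup>+p. \<integral>\<^sup>+y. ?h p x * ?h p y \<partial>\<nu> \<partial>P \<partial>\<mu>)"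
    by (intro nn_integral_cong NP.Fubini'[symmetric]) simp
  also have "\<dots> = (\<integral>\<^sup>+x. \<integral>\<^sup>+p. ?h p x * heat_potential s \<nu> p \<partial>P \<partial>\<mu>)"
    unfolding heat_potential_def by (intro nn_integral_cong nn_integral_cmult) simp
  also have "\<dots> = (\<integral>\<^sup>+p. \<integral>\<^sup>+x. ?h p x * heat_potential s \<nu> p \<partial>\<mu> \<partial>P)"
    using assms by (intro MP.Fubini'[symmetric]) simp
  also have "\<dots> = (\<integral>\<^sup>+p. heat_potential s \<mu> p * heat_potential s \<nu> p \<partial>P)"
    by (subst (2) heat_potential_def, intro nn_integral_cong nn_integral_multc) simp
  finally show ?thesis by (simp add: P_def)
qed

text \<open>Pointwise a^2 + b^2 = 2 a b + (a - b)^2, integrated over p. The additive form remains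
  meaningful when energies are infinite.\<close>

lemma energy_gap:
  fixes \<mu> \<nu> :: "'a::euclidean_space measure"
  assumes s: "0 < s"
    and "finite_measure \<mu>" "sets \<mu> = sets borel"
    and "finite_measure \<nu>" "sets \<nu> = sets borel"
  shows "mutual_energy s \<mu> \<mu> + mutual_energy s \<nu> \<nu> = 2 * mutual_energy s \<mu> \<nu> +
    (\<integral>\<^sup>+p. ennreal ((enn2real (heat_potential s \<mu> p) - enn2real (heat_potential s \<nu> p))\<^sup>2) \<partial>(lborel \<Otimes>\<^sub>M lborel))"
proof -
  let ?d = "\<lambda>p. ennreal ((enn2real (heat_potential s \<mu> p) - enn2real (heat_potential s \<nu> p))\<^sup>2)"
  let ?U = "\<lambda>p. heat_potential s \<mu> p"
  let ?V = "\<lambda>p. heat_potential s \<nu> p"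
  have [measurable]: "heat_potential s \<mu> \<in> borel_measurable borel" "heat_potential s \<nu> \<in> borel_measurable borel"
    using assms by simp_all
  have "?U p * ?U p + ?V p * ?V p =
     2 * (?U p * ?V p) +
     ?d p" for p
  proof -
    obtain a where a: "0 \<le> a" "?U p = ennreal a"
      using heat_potential_finite[OF assms(2,3), of s p] by (cases "?U p") auto
    obtain b where b: "0 \<le> b" "?V p = ennreal b"
      using heat_potential_finite[OF assms(4,5), of s p] by (cases "?V p") auto
    have "a * a + b * b = 2 * (a * b) + (a - b)\<^sup>2" by (simp add: power2_eq_square algebra_simps)
    then have "ennreal (a * a + b * b) = ennreal (2 * (a * b) + (a - b)\<^sup>2)" by simp
    then show ?thesis using a b by (simp add: ennreal_mult' ennreal_plus)
  qed
  then have "(\<integral>\<^sup>+p. ?U p * ?U p + ?V p * ?V p \<partial>(lborel \<Otimes>\<^sub>M lborel)) =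
    (\<integral>\<^sup>+p. 2 * (?U p * ?V p) +
     ?d p \<partial>(lborel \<Otimes>\<^sub>M lborel))"
    by simp
  then show ?thesis
    using assms by (simp add: mutual_energy_heat nn_integral_add nn_integral_cmult lborel_prod)
qed

section \<open>Recovering a measure from its Gaussian averages\<close>

definition gauss_average :: "real \<Rightarrow> 'a::euclidean_space measure \<Rightarrow> ('a \<Rightarrow> real) \<Rightarrow> ennreal" where
  "gauss_average c \<mu> f =
     (\<integral>\<^sup>+x. \<integral>\<^sup>+w. ennreal (f (x + c *\<^sub>R w) * exp (- (norm w)\<^sup>2)) \<partial>lborel \<partial>\<mu>)"

text \<open>Moves the smoothing from the measure to f: the left-hand side sees the measure only
  through its Gaussian integrals with parameter t, while the right-hand side averages f at width 1 /
  sqrt (2 t), which shrinks as t grows.\<close>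

lemma gauss_average_eq:
  fixes \<mu> :: "'a::euclidean_space measure"
  assumes "finite_measure \<mu>" and [measurable_cong]: "sets \<mu> = sets borel"
    and [measurable]: "f \<in> borel_measurable borel" and f: "\<And>x. 0 \<le> f x" and t: "0 < t"
  shows "(\<integral>\<^sup>+z. ennreal (f z) * (\<integral>\<^sup>+x. ennreal (exp (- 2 * t * (norm (x - z))\<^sup>2)) \<partial>\<mu>) \<partial>lborel) =
     ennreal ((1 / sqrt (2 * t)) ^ DIM('a)) * gauss_average (1 / sqrt (2 * t)) \<mu> f"
proof -
  let ?e = "\<lambda>x z. ennreal (exp (- 2 * t * (norm (x - z))\<^sup>2))"
  interpret finite_measure \<mu> by fact
  interpret pair_sigma_finite \<mu> "lborel :: 'a measure" ..
  define c where "c = 1 / sqrt (2 * t)"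
  have c: "0 < c" "2 * t * c\<^sup>2 = 1" using t by (auto simp: c_def power_divide)
  have "(\<integral>\<^sup>+z. ennreal (f z) * (\<integral>\<^sup>+x. ?e x z \<partial>\<mu>) \<partial>lborel) =
    (\<integral>\<^sup>+z. (\<integral>\<^sup>+x. ennreal (f z) * ?e x z \<partial>\<mu>) \<partial>lborel)"
    by (intro nn_integral_cong nn_integral_cmult[symmetric]) simp
  also have "\<dots> = (\<integral>\<^sup>+x. (\<integral>\<^sup>+z. ennreal (f z) * ?e x z \<partial>lborel) \<partial>\<mu>)"
    by (intro Fubini') simp
  also have "\<dots> = (\<integral>\<^sup>+x. ennreal (c ^ DIM('a)) *
      (\<integral>\<^sup>+w. ennreal (f (x + c *\<^sub>R w) * exp (- (norm w)\<^sup>2)) \<partial>lborel) \<partial>\<mu>)"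
  proof (intro nn_integral_cong)
    fix x :: 'a
    have "exp (- 2 * t * (norm (x - (x + c *\<^sub>R w)))\<^sup>2) = exp (- (norm w)\<^sup>2)" for w
    proof -
      have "2 * t * (norm (x - (x + c *\<^sub>R w)))\<^sup>2 = (2 * t * c\<^sup>2) * (norm w)\<^sup>2"
        by (simp add: power_mult_distrib)
      then have e: "- 2 * t * (norm (x - (x + c *\<^sub>R w)))\<^sup>2 = - (norm w)\<^sup>2" using c(2) by simp
      show ?thesis unfolding e ..
    qed
    then show "(\<integral>\<^sup>+z. ennreal (f z) * ?e x z \<partial>lborel) =
      ennreal (c ^ DIM('a)) * (\<integral>\<^sup>+w. ennreal (f (x + c *\<^sub>R w) * exp (- (norm w)\<^sup>2)) \<partial>lborel)"
      using c f by (subst nn_integral_lborel_scaleR[of _ c x]) (simp_all add: ennreal_mult' del: minus_mult_left)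
  qed
  also have "\<dots> = ennreal (c ^ DIM('a)) * gauss_average c \<mu> f"
    unfolding gauss_average_def by (rule nn_integral_cmult) simp
  finally show ?thesis by (simp add: c_def)
qed

text \<open>Dominated convergence twice: in w with the Gaussian itself as majorant, then in x with
  its total integral K, a constant and so integrable for a finite measure.\<close>

lemma gauss_average_tendsto:
  fixes \<mu> :: "'a::euclidean_space measure"
  assumes "finite_measure \<mu>" and [measurable_cong]: "sets \<mu> = sets borel"
    and f: "continuous_on UNIV f" "\<And>x. 0 \<le> f x" "\<And>x. f x \<le> 1" and C: "C \<longlonglongrightarrow> 0"
  shows "(\<lambda>n. gauss_average (C n) \<mu> f) \<longlonglongrightarrow> ennreal (sqrt pi ^ DIM('a)) * (\<integral>\<^sup>+x. ennreal (f x) \<partial>\<mu>)"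
proof -
  interpret finite_measure \<mu> by fact
  let ?k = "\<lambda>n x w. ennreal (f (x + C n *\<^sub>R w) * exp (- (norm w)\<^sup>2))"
  have [measurable]: "f \<in> borel_measurable borel" by (rule borel_measurable_continuous_onI[OF f(1)])
  define K where "K = ennreal (sqrt pi ^ DIM('a))"
  have K: "(\<integral>\<^sup>+w. ennreal (exp (- (norm w)\<^sup>2)) \<partial>(lborel :: 'a measure)) = K"
    by (simp add: K_def nn_integral_gaussian)
  have bound: "f x * exp (- (norm w)\<^sup>2) \<le> exp (- (norm w)\<^sup>2)" for x w :: 'a
    using f by (simp add: mult_left_le_one_le)
  have "(\<lambda>n. gauss_average (C n) \<mu> f) \<longlonglongrightarrow> (\<integral>\<^sup>+x. ennreal (f x) * K \<partial>\<mu>)"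
    unfolding gauss_average_def
  proof (rule nn_integral_dominated_convergence[where w = "\<lambda>_. K"])
    show "(\<integral>\<^sup>+x. K \<partial>\<mu>) < \<infinity>"
      by (simp add: K_def emeasure_eq_measure ennreal_mult_less_top)
    show "AE x in \<mu>. (\<integral>\<^sup>+w. ?k n x w \<partial>lborel) \<le> K" for n
      unfolding K[symmetric] by (intro AE_I2 nn_integral_mono ennreal_leI bound)
    show "AE x in \<mu>. (\<lambda>n. \<integral>\<^sup>+w. ?k n x w \<partial>lborel) \<longlonglongrightarrow> ennreal (f x) * K"
    proof (rule AE_I2)
      fix x :: 'a
      have "(\<lambda>n. \<integral>\<^sup>+w. ?k n x w \<partial>lborel) \<longlonglongrightarrow>
          (\<integral>\<^sup>+w. ennreal (f x * exp (- (norm (w :: 'a))\<^sup>2)) \<partial>lborel)"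
      proof (rule nn_integral_dominated_convergence[where w = "\<lambda>w. ennreal (exp (- (norm w)\<^sup>2))"])
        show "AE w in lborel. (\<lambda>n. ?k n x w) \<longlonglongrightarrow>
           ennreal (f x * exp (- (norm w)\<^sup>2))"
        proof (rule AE_I2)
          fix w :: 'a
          have "(\<lambda>n. x + C n *\<^sub>R w) \<longlonglongrightarrow> x + 0 *\<^sub>R w" by (intro tendsto_intros C)
          then have "(\<lambda>n. f (x + C n *\<^sub>R w)) \<longlonglongrightarrow> f x"
            using f(1) by (intro continuous_on_tendsto_compose[OF f(1)]) auto
          then show "(\<lambda>n. ?k n x w) \<longlonglongrightarrow> ennreal (f x * exp (- (norm w)\<^sup>2))"
            by (intro tendsto_ennrealI tendsto_mult tendsto_const)
        qed
        show "(\<integral>\<^sup>+w. ennreal (exp (- (norm (w :: 'a))\<^sup>2)) \<partial>lborel) < \<infinity>" unfolding K by (simp add: K_def)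
      qed (use f in \<open>auto intro!: ennreal_leI bound\<close>)
      also have "(\<integral>\<^sup>+w. ennreal (f x * exp (- (norm (w :: 'a))\<^sup>2)) \<partial>lborel) = ennreal (f x) * K"
        using f by (simp add: ennreal_mult' nn_integral_cmult K)
      finally show "(\<lambda>n. \<integral>\<^sup>+w. ?k n x w \<partial>lborel) \<longlonglongrightarrow> ennreal (f x) * K" .
    qed
  qed auto
  also have "(\<integral>\<^sup>+x. ennreal (f x) * K \<partial>\<mu>) = K * (\<integral>\<^sup>+x. ennreal (f x) \<partial>\<mu>)"
    by (subst nn_integral_multc) (auto simp: mult.commute)
  finally show ?thesis by (simp add: K_def)
qed

text \<open>Open boxes generate the Borel sets and are stable under intersection, and the indicator
  of a box U is the pointwise limit of the continuous functions min 1 (k dist (x, -U)).\<close>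

lemma measure_eqI_continuous:
  fixes \<mu> \<nu> :: "'a::euclidean_space measure"
  assumes "finite_measure \<mu>" and sets_mu [measurable_cong]: "sets \<mu> = sets borel"
    and "finite_measure \<nu>" and sets_nu [measurable_cong]: "sets \<nu> = sets borel"
    and eq: "\<And>f. continuous_on UNIV f \<Longrightarrow> (\<And>x. 0 \<le> f x) \<Longrightarrow> (\<And>x. f x \<le> 1) \<Longrightarrow>
      (\<integral>\<^sup>+x. ennreal (f x) \<partial>\<mu>) = (\<integral>\<^sup>+x. ennreal (f x) \<partial>\<nu>)"
  shows "\<mu> = \<nu>"
proof (rule measure_eqI_generator_eq)
  interpret M: finite_measure \<mu> by fact
  interpret N: finite_measure \<nu> by fact
  let ?E = "range (\<lambda>(a, b). box a b :: 'a set)"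
  show "Int_stable ?E" by (auto simp: Int_stable_def box_Int_box)
  show "?E \<subseteq> Pow UNIV" "sets \<mu> = sigma_sets UNIV ?E" "sets \<nu> = sigma_sets UNIV ?E"
    by (simp_all add: borel_eq_box sets_mu sets_nu)
  let ?A = "\<lambda>n::nat. box (- (real n *\<^sub>R One)) (real n *\<^sub>R One) :: 'a set"
  show "range ?A \<subseteq> ?E" "(\<Union>i. ?A i) = UNIV"
    unfolding UN_box_eq_UNIV by auto
  show "emeasure \<mu> (?A i) \<noteq> \<infinity>" for i by simp
  fix U assume "U \<in> ?E"
  then obtain a b where U: "U = box a b" by auto
  have "open U" "bounded U" by (auto simp: U)
  \<comment> \<open>The complement must be nonempty because \<open>infdist\<close> from the empty
    set is 0 by convention.\<close>
  have ne: "- U \<noteq> {}"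
    using \<open>bounded U\<close> not_bounded_UNIV[where 'a = 'a] by (metis Compl_UNIV_eq double_compl)
  have cl: "closed (- U)" using \<open>open U\<close> by (rule closed_Compl)
  define f where "f k x = min 1 (real k * infdist x (- U))" for k :: nat and x
  have f: "continuous_on UNIV (f k)" "0 \<le> f k x" "f k x \<le> 1" for k x
    unfolding f_def by (auto intro!: continuous_intros simp: infdist_nonneg)
  have [measurable]: "f k \<in> borel_measurable borel" for k
    by (rule borel_measurable_continuous_onI[OF f(1)])
  have [measurable]: "U \<in> sets borel" using \<open>open U\<close> by simp
  have lim: "(\<lambda>k. ennreal (f k x)) \<longlonglongrightarrow> indicator U x" for x
  proof (cases "x \<in> U")
    case True
    have "infdist x (- U) \<noteq> 0" using True in_closed_iff_infdist_zero[OF cl ne, of x] by simp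
    then have pos: "0 < infdist x (- U)" using infdist_nonneg[of x "- U"] by linarith
    obtain n :: nat where n: "1 / infdist x (- U) \<le> real n" using real_arch_simple by blast
    have "f k x = 1" if "n \<le> k" for k
    proof -
      have "1 / infdist x (- U) \<le> real k" using n that by simp
      then show ?thesis using pos by (simp add: f_def field_simps)
    qed
    then have "eventually (\<lambda>k. ennreal (f k x) = 1) sequentially"
      unfolding eventually_sequentially by (intro exI[of _ n]) simp
    then show ?thesis using True by (simp add: tendsto_eventually)
  next
    case False
    then have "f k x = 0" for k by (simp add: f_def)
    then show ?thesis using False by simp
  qed
  have "(\<lambda>k. \<integral>\<^sup>+x. ennreal (f k x) \<partial>\<mu>) \<longlonglongrightarrow> (\<integral>\<^sup>+x. indicator U x \<partial>\<mu>)"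
    using f lim by (intro nn_integral_dominated_convergence[where w = "\<lambda>_. 1"])
      (auto simp: M.emeasure_eq_measure intro!: ennreal_le_1[THEN iffD2])
  moreover have "(\<lambda>k. \<integral>\<^sup>+x. ennreal (f k x) \<partial>\<mu>) \<longlonglongrightarrow> (\<integral>\<^sup>+x. indicator U x \<partial>\<nu>)"
    unfolding eq[OF f(1) f(2) f(3)]
    using f lim by (intro nn_integral_dominated_convergence[where w = "\<lambda>_. 1"])
      (auto simp: N.emeasure_eq_measure intro!: ennreal_le_1[THEN iffD2])
  ultimately have "(\<integral>\<^sup>+x. indicator U x \<partial>\<mu>) = (\<integral>\<^sup>+x. indicator U x \<partial>\<nu>)"
    by (rule LIMSEQ_unique)
  then show "emeasure \<mu> U = emeasure \<nu> U" by simp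
qed

text \<open>For fixed t > 0 the heat potential is a positive multiple of a Gaussian convolution of
  the measure. Equality almost everywhere in (t, z) gives, for almost every t, equality for almost
  every z, which suffices to compare Gaussian averages of continuous functions.\<close>

lemma heat_potential_injective:
  fixes \<mu> \<nu> :: "'a::euclidean_space measure"
  assumes s: "0 < s"
    and fin: "finite_measure \<mu>" and sets_mu [measurable_cong]: "sets \<mu> = sets borel"
    and fin': "finite_measure \<nu>" and sets_nu [measurable_cong]: "sets \<nu> = sets borel"
    and AE_eq: "AE p in lborel \<Otimes>\<^sub>M lborel. heat_potential s \<mu> p = heat_potential s \<nu> p"
  shows "\<mu> = \<nu>"
proof -
  define G where "G \<kappa> t z = (\<integral>\<^sup>+x. ennreal (exp (- 2 * t * (norm (x - z))\<^sup>2)) \<partial>\<kappa>)" for \<kappa> :: "'a measure" and t z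
  have AE_G: "AE t in lborel. 0 < t \<longrightarrow> (AE z in lborel. G \<mu> t z = G \<nu> t z)"
    using lborel_pair.AE_pair[OF AE_eq]
  proof eventually_elim
    case (elim t)
    show ?case
    proof
      assume t: "0 < t"
      define K where "K = (sqrt pi / (2 * sqrt t)) ^ DIM('a)"
      define c where "c = sqrt (t powr (s / 2 - 1) / (Gamma (s / 2) * K))"
      have c: "0 < c" using t s by (simp add: c_def K_def Gamma_real_pos)
      have G: "heat_potential s \<kappa> (t, z) = ennreal c * G \<kappa> t z" if "sets \<kappa> = sets borel" for \<kappa> z
        using t c that measurable_cong_sets[OF that refl, of "borel :: ennreal measure"]
        unfolding heat_potential_def G_def
        by (subst nn_integral_cmult[symmetric]) (simp_all add: heat_factor_def ennreal_mult' K_def[symmetric] c_def[symmetric])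
      show "AE z in lborel. G \<mu> t z = G \<nu> t z"
        using elim
      proof eventually_elim
        case (elim z)
        then show ?case using c by (simp add: G[OF sets_mu] G[OF sets_nu] ennreal_mult_cancel_left)
      qed
    qed
  qed
  \<comment> \<open>The good parameters have full measure, so every unit interval contains one. This
    gives a sequence tending to infinity, along which the width of the Gaussians tends to 0.\<close>
  have "\<exists>t>real n. AE z in lborel. G \<mu> t z = G \<nu> t z" for n :: nat
  proof (rule ccontr)
    assume "\<not> ?thesis"
    then have "AE t in lborel. t \<notin> {real n<..<real n + 1}"
      using AE_G by (auto elim!: eventually_mono)
    then have "emeasure lborel {real n<..<real n + 1} = 0"
      by (subst (asm) AE_iff_measurable[of "{real n<..<real n + 1}"]) auto
    then show False by simp
  qed
  then obtain T where T: "\<And>n. real n < T n" "\<And>n. AE z in lborel. G \<mu> (T n) z = G \<nu> (T n) z"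
    by metis
  define C where "C n = 1 / sqrt (2 * T n)" for n
  have T0: "0 < T n" for n using T(1)[of n] by (rule le_less_trans[OF of_nat_0_le_iff])
  have "filterlim T at_top sequentially"
    using T(1) by (intro filterlim_at_top_mono[OF filterlim_real_sequentially]) (intro always_eventually allI less_imp_le)
  then have "filterlim (\<lambda>n. sqrt (2 * T n)) at_top sequentially"
    by (intro filterlim_compose[OF sqrt_at_top] filterlim_tendsto_pos_mult_at_top[OF tendsto_const]) auto
  then have C: "C \<longlonglongrightarrow> 0"
    unfolding C_def by (intro tendsto_divide_0[OF tendsto_const] filterlim_at_top_imp_at_infinity)
  show ?thesis
  proof (rule measure_eqI_continuous[OF fin sets_mu fin' sets_nu])
    fix f :: "'a \<Rightarrow> real" assume f: "continuous_on UNIV f" "\<And>x. 0 \<le> f x" "\<And>x. f x \<le> 1"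
    have [measurable]: "f \<in> borel_measurable borel" by (rule borel_measurable_continuous_onI[OF f(1)])
    have "gauss_average (C n) \<mu> f = gauss_average (C n) \<nu> f" for n
    proof -
      have "(\<integral>\<^sup>+z. ennreal (f z) * G \<mu> (T n) z \<partial>lborel) = (\<integral>\<^sup>+z. ennreal (f z) * G \<nu> (T n) z \<partial>lborel)"
        by (intro nn_integral_cong_AE eventually_mono[OF T(2)[of n]]) simp
      moreover have "C n \<noteq> 0" "0 < C n ^ DIM('a)" using T0[of n] by (simp_all add: C_def)
      ultimately show ?thesis
        unfolding G_def gauss_average_eq[OF fin sets_mu \<open>f \<in> borel_measurable borel\<close> f(2) T0]
          gauss_average_eq[OF fin' sets_nu \<open>f \<in> borel_measurable borel\<close> f(2) T0] C_def[symmetric]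
        by (simp add: ennreal_mult_cancel_left)
    qed
    then have "(\<lambda>n. gauss_average (C n) \<mu> f) \<longlonglongrightarrow> ennreal (sqrt pi ^ DIM('a)) * (\<integral>\<^sup>+x. ennreal (f x) \<partial>\<nu>)"
      using gauss_average_tendsto[OF fin' sets_nu f C] by simp
    with gauss_average_tendsto[OF fin sets_mu f C]
    have "ennreal (sqrt pi ^ DIM('a)) * (\<integral>\<^sup>+x. ennreal (f x) \<partial>\<mu>) =
        ennreal (sqrt pi ^ DIM('a)) * (\<integral>\<^sup>+x. ennreal (f x) \<partial>\<nu>)"
      by (rule LIMSEQ_unique)
    then show "(\<integral>\<^sup>+x. ennreal (f x) \<partial>\<mu>) = (\<integral>\<^sup>+x. ennreal (f x) \<partial>\<nu>)"
      by (simp add: ennreal_mult_cancel_left)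
  qed
qed

text \<open>The assumption \<open>le\<close> forces the integral of squares in
  \<open>energy_gap\<close> to be 0; the mutual energy can be cancelled because it is
  finite.\<close>

theorem mutual_energy_uniqueness:
  fixes \<mu> \<nu> :: "'a::euclidean_space measure"
  assumes s: "0 < s"
    and \<mu>: "finite_measure \<mu>" "sets \<mu> = sets borel"
    and \<nu>: "finite_measure \<nu>" "sets \<nu> = sets borel"
    and le: "mutual_energy s \<mu> \<mu> + mutual_energy s \<nu> \<nu> \<le> 2 * mutual_energy s \<mu> \<nu>"
    and fin: "mutual_energy s \<mu> \<nu> \<noteq> \<infinity>"
  shows "\<mu> = \<nu>"
proof -
  let ?a = "\<lambda>p. enn2real (heat_potential s \<mu> p)" and ?b = "\<lambda>p. enn2real (heat_potential s \<nu> p)"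
  let ?P = "lborel \<Otimes>\<^sub>M lborel :: (real \<times> 'a) measure"
  have [measurable]: "heat_potential s \<mu> \<in> borel_measurable borel" "heat_potential s \<nu> \<in> borel_measurable borel"
    using assms by simp_all
  have "2 * mutual_energy s \<mu> \<nu> + (\<integral>\<^sup>+p. ennreal ((?a p - ?b p)\<^sup>2) \<partial>?P) \<le> 2 * mutual_energy s \<mu> \<nu> + 0"
    using le unfolding energy_gap[OF s \<mu> \<nu>] by simp
  then have "(\<integral>\<^sup>+p. ennreal ((?a p - ?b p)\<^sup>2) \<partial>?P) \<le> 0"
    using fin by (subst (asm) ennreal_add_left_cancel_le) (auto simp: ennreal_mult_eq_top_iff)
  then have "AE p in ?P. ennreal ((?a p - ?b p)\<^sup>2) = 0"
    by (subst nn_integral_0_iff_AE[symmetric]) (auto simp: lborel_prod)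
  then have "AE p in ?P. heat_potential s \<mu> p = heat_potential s \<nu> p"
  proof eventually_elim
    case (elim p)
    then have "?a p = ?b p" by (simp add: ennreal_eq_0_iff)
    then show ?case
      using heat_potential_finite[OF \<mu>, of s p] heat_potential_finite[OF \<nu>, of s p]
      by (metis ennreal_enn2real_if infinity_ennreal_def)
  qed
  then show ?thesis by (rule heat_potential_injective[OF s \<mu> \<nu>])
qed

section \<open>The hypergeometric density\<close>

lemma summable_gauss_2F1:
  fixes a b c z :: real
  assumes c: "0 < c" and z: "\<bar>z\<bar> < 1"
  shows "summable (\<lambda>n. pochhammer a n * pochhammer b n / pochhammer c n * (z ^ n / fact n))"
proof -
  define u where "u n = pochhammer a n * pochhammer b n / pochhammer c n * (z ^ n / fact n)" for n
  define q where "q n = (a + real n) / (c + real n) * ((b + real n) / (1 + real n)) * z" for n :: nat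
  have lim1: "(\<lambda>n. (x + real n) / (y + real n)) \<longlonglongrightarrow> 1" if "0 < y" for x y :: real
  proof -
    have top: "filterlim (\<lambda>n. y + real n) at_top sequentially"
      by (intro filterlim_tendsto_add_at_top[OF tendsto_const] filterlim_real_sequentially)
    have "(\<lambda>n. 1 + (x - y) / (y + real n)) \<longlonglongrightarrow> 1 + 0"
      by (intro tendsto_intros tendsto_divide_0[OF tendsto_const] filterlim_at_top_imp_at_infinity top)
    moreover have "1 + (x - y) / (y + real n) = (x + real n) / (y + real n)" for n
      using that by (simp add: field_simps)
    ultimately show ?thesis by simp
  qed
  have "(\<lambda>n. \<bar>q n\<bar>) \<longlonglongrightarrow> \<bar>1 * 1 * z\<bar>"
    unfolding q_def using c by (intro tendsto_intros lim1) auto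
  moreover obtain r where r: "\<bar>z\<bar> < r" "r < 1" using dense[OF z] by blast
  ultimately have "eventually (\<lambda>n. \<bar>q n\<bar> < r) sequentially"
    by (intro order_tendstoD(2)) auto
  then obtain n0 where n0: "\<And>n. n0 \<le> n \<Longrightarrow> \<bar>q n\<bar> < r" by (auto simp: eventually_sequentially)
  have "summable u"
  proof (rule summable_ratio_test[OF r(2)])
    fix n assume "n0 \<le> n"
    have "pochhammer c n \<noteq> 0" "c + real n \<noteq> 0" using c pochhammer_pos[OF c, of n] by auto
    then have "u (Suc n) = q n * u n"
      by (simp add: u_def q_def pochhammer_Suc field_simps)
    then show "norm (u (Suc n)) \<le> r * norm (u n)"
      using n0[OF \<open>n0 \<le> n\<close>] by (simp add: abs_mult mult_right_mono)
  qed
  then show ?thesis by (simp add: u_def[abs_def])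
qed

lemma summable_pochhammer_power:
  fixes a c z :: real
  assumes "0 < c" "\<bar>z\<bar> < 1"
  shows "summable (\<lambda>n. pochhammer a n / pochhammer c n * z ^ n)"
  using summable_gauss_2F1[OF assms, of a 1] by (simp add: pochhammer_fact[symmetric])

text \<open>The coefficients of the two hypergeometric series of the density combine to those of
  a single one, because \<open>1 + n / \<lambda> = (\<lambda> + 1)\<^sub>n / (\<lambda>)\<^sub>n\<close>.\<close>

lemma gauss_2F1_combination:
  fixes \<alpha> lam z :: real
  assumes lam: "0 < lam" and z: "\<bar>z\<bar> < 1"
  shows "1 - gauss_2F1 (- \<alpha> / 2) 1 (lam + 1) z +
      \<alpha> / (2 * lam * (lam + 1)) * z * gauss_2F1 (1 - \<alpha> / 2) 2 (lam + 2) z =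
    \<alpha> / 2 * z * (\<Sum>n. pochhammer (1 - \<alpha> / 2) n / pochhammer lam (Suc n) * z ^ n)"
proof -
  define A where "A n = pochhammer (- \<alpha> / 2) n * pochhammer 1 n / pochhammer (lam + 1) n * (z ^ n / fact n)" for n
  define B where "B n = pochhammer (1 - \<alpha> / 2) n * pochhammer 2 n / pochhammer (lam + 2) n * (z ^ n / fact n)" for n
  have "A sums gauss_2F1 (- \<alpha> / 2) 1 (lam + 1) z"
    unfolding A_def gauss_2F1_def using lam z by (intro summable_sums summable_gauss_2F1) auto
  then have A: "(\<lambda>n. A (Suc n)) sums (gauss_2F1 (- \<alpha> / 2) 1 (lam + 1) z - 1)"
    by (subst sums_Suc_iff) (simp add: A_def)
  have B: "B sums gauss_2F1 (1 - \<alpha> / 2) 2 (lam + 2) z"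
    unfolding B_def gauss_2F1_def using lam z by (intro summable_sums summable_gauss_2F1) auto
  have "(\<lambda>n. - A (Suc n) + \<alpha> / (2 * lam * (lam + 1)) * z * B n) sums
    (- (gauss_2F1 (- \<alpha> / 2) 1 (lam + 1) z - 1) +
      \<alpha> / (2 * lam * (lam + 1)) * z * gauss_2F1 (1 - \<alpha> / 2) 2 (lam + 2) z)"
    by (intro sums_add sums_minus sums_mult A B)
  moreover have "- A (Suc n) + \<alpha> / (2 * lam * (lam + 1)) * z * B n =
      \<alpha> / 2 * z * (pochhammer (1 - \<alpha> / 2) n / pochhammer lam (Suc n) * z ^ n)" for n
  proof -
    define P where "P = pochhammer (1 - \<alpha> / 2) n"
    define L where "L = pochhammer (lam + 1) n"
    have L: "0 < L" using lam by (simp add: L_def pochhammer_pos)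
    have e1: "pochhammer (- \<alpha> / 2) (Suc n) = - (\<alpha> / 2) * P"
      by (simp add: pochhammer_rec P_def)
    have e2: "pochhammer (lam + 1) (Suc n) = L * (lam + 1 + real n)"
      by (simp add: pochhammer_Suc L_def)
    have e3: "pochhammer lam (Suc n) = lam * L"
      by (simp add: pochhammer_rec L_def)
    have "(lam + 1) * pochhammer (lam + 2) n = L * (lam + 1 + real n)"
      using e2 by (simp add: pochhammer_rec add.assoc)
    then have e4: "pochhammer (lam + 2) n = L * (lam + 1 + real n) / (lam + 1)"
      using lam by (simp add: field_simps)
    have "pochhammer (1 :: real) (Suc n) = pochhammer 2 n"
      by (simp add: pochhammer_rec)
    then have e5: "pochhammer (2 :: real) n = fact n * (1 + real n)"
      by (simp add: pochhammer_fact[symmetric] algebra_simps)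
    have e6: "pochhammer (1 :: real) (Suc n) = fact (Suc n)"
      by (simp only: pochhammer_fact)
    have A: "A (Suc n) = - (\<alpha> / 2) * P * z * z ^ n / (L * (lam + 1 + real n))"
      unfolding A_def e1 e2 e6 by (simp del: fact_Suc)
    have B: "B n = P * (1 + real n) * (lam + 1) * z ^ n / (L * (lam + 1 + real n))"
      unfolding B_def e4 e5 P_def[symmetric] by simp
    have "lam + 1 + real n \<noteq> 0" "lam + 1 \<noteq> 0" using lam by auto
    then show ?thesis
      unfolding A B e3 P_def[symmetric] using lam L by (simp add: divide_simps) (simp add: algebra_simps)
  qed
  ultimately have "(\<lambda>n. \<alpha> / 2 * z * (pochhammer (1 - \<alpha> / 2) n / pochhammer lam (Suc n) * z ^ n)) sums
    (1 - gauss_2F1 (- \<alpha> / 2) 1 (lam + 1) z +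
      \<alpha> / (2 * lam * (lam + 1)) * z * gauss_2F1 (1 - \<alpha> / 2) 2 (lam + 2) z)"
    by simp
  moreover have "summable (\<lambda>n. pochhammer (1 - \<alpha> / 2) n / pochhammer lam (Suc n) * z ^ n)"
  proof -
    have "summable (\<lambda>n. 1 / lam * (pochhammer (1 - \<alpha> / 2) n / pochhammer (lam + 1) n * z ^ n))"
      using lam z by (intro summable_mult summable_pochhammer_power) auto
    then show ?thesis by (simp add: pochhammer_rec)
  qed
  then have "(\<lambda>n. \<alpha> / 2 * z * (pochhammer (1 - \<alpha> / 2) n / pochhammer lam (Suc n) * z ^ n)) sums
    (\<alpha> / 2 * z * (\<Sum>n. pochhammer (1 - \<alpha> / 2) n / pochhammer lam (Suc n) * z ^ n))"
    by (intro sums_mult summable_sums)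
  ultimately show ?thesis by (rule sums_unique2)
qed

section \<open>Series expansion of the mixture\<close>

lemma has_bochner_integral_beta_power:
  fixes z lam :: real
  assumes z: "0 < z" and lam: "0 < lam"
  shows "has_bochner_integral lborel (\<lambda>w. w ^ n * (z - w) powr (lam - 1) * indicator {0<..<z} w)
           (z powr lam * z ^ n * (fact n / pochhammer lam (Suc n)))"
proof (rule has_bochner_integral_nn_integral)
  have P: "0 < pochhammer lam (Suc n)" using lam by (rule pochhammer_pos)
  show "0 \<le> z powr lam * z ^ n * (fact n / pochhammer lam (Suc n))" using z P by simp
  have Beta: "Beta (real n + 1) lam = fact n / pochhammer lam (Suc n)"
  proof -
    have "pochhammer lam (Suc n) = Gamma (lam + real (Suc n)) / Gamma lam"
      using lam by (intro pochhammer_Gamma) (auto elim!: nonpos_Ints_cases)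
    moreover have "0 < Gamma lam" "0 < Gamma (lam + real (Suc n))"
      using lam by (auto intro!: Gamma_real_pos)
    ultimately show ?thesis
      using Gamma_fact[of n, where 'a = real] by (simp add: Beta_def add_ac)
  qed
  define g where "g v = z * v" for v :: real
  define f where "f w = w powr real n * (z - w) powr (lam - 1)" for w
  have im: "g ` {0<..<1} = {0<..<z}"
  proof (intro equalityI subsetI)
    fix w assume "w \<in> {0<..<z}"
    then have "w / z \<in> {0<..<1}" "w = g (w / z)" using z by (auto simp: g_def)
    then show "w \<in> g ` {0<..<1}" by blast
  qed (use z in \<open>auto simp: g_def\<close>)
  have "(\<integral>\<^sup>+w. ennreal (w ^ n * (z - w) powr (lam - 1) * indicator {0<..<z} w) \<partial>lborel) =
    (\<integral>\<^sup>+w\<in>{0<..<z}. ennreal (f w) \<partial>lborel)"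
    by (intro nn_integral_cong) (auto simp: f_def indicator_def powr_realpow)
  also have "\<dots> = (\<integral>\<^sup>+v\<in>{0<..<1}. ennreal (\<bar>z\<bar> * f (g v)) \<partial>lborel)"
    unfolding im[symmetric]
  proof (rule nn_integral_change_of_variables)
    show "g ` {0<..<1} \<in> sets borel" by (simp add: im)
    show "(g has_real_derivative z) (at x)" for x
      unfolding g_def by (auto intro!: derivative_eq_intros)
    show "inj_on g {0<..<1}" using z by (auto simp: inj_on_def g_def)
  qed (auto simp: f_def g_def[abs_def])
  also have "\<dots> = (\<integral>\<^sup>+v\<in>{0<..<1}. ennreal (z powr lam * z ^ n * (v powr (real n + 1 - 1) * (1 - v) powr (lam - 1))) \<partial>lborel)"
  proof (intro set_nn_integral_cong refl arg_cong[where f = ennreal])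
    fix v assume "v \<in> space lborel \<inter> {0 <..< (1::real)}"
    then have v: "0 < v" "v < 1" by auto
    have "z - z * v = z * (1 - v)" by (simp add: algebra_simps)
    then have "f (g v) = z ^ n * v powr real n * (z powr (lam - 1) * (1 - v) powr (lam - 1))"
      using v z by (simp add: f_def g_def powr_mult powr_realpow)
    moreover have "z * z powr (lam - 1) = z powr lam" using z by (simp add: powr_mult_base)
    ultimately show "\<bar>z\<bar> * f (g v) = z powr lam * z ^ n * (v powr (real n + 1 - 1) * (1 - v) powr (lam - 1))"
      using z by (simp add: mult_ac)
  qed
  also have "\<dots> = ennreal (z powr lam * z ^ n * Beta (real n + 1) lam)"
    unfolding nn_integral_Ioo_eq_Icc
    using has_integral_mult_right[OF has_integral_Beta_real[of "real n + 1" lam], of "z powr lam * z ^ n"] lam z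
    by (intro nn_integral_has_integral_lebesgue') auto
  finally show "(\<integral>\<^sup>+w. ennreal (w ^ n * (z - w) powr (lam - 1) * indicator {0<..<z} w) \<partial>lborel) =
     ennreal (z powr lam * z ^ n * (fact n / pochhammer lam (Suc n)))"
    unfolding Beta .
qed (use z in \<open>auto simp: indicator_def\<close>)


text \<open>The binomial series of (1 - w)^(-a), with coefficients (a)_n / n!, is integrated term by
  term; n! cancels against the Beta value n! / (\<lambda>)_(n+1). For a < 0 coefficients can be
  negative, so absolute convergence takes the place of monotone convergence. The sign of T is read
  off the integral, not the series.\<close>

lemma integral_binomial_beta:
  fixes a z lam :: real
  assumes z: "0 < z" "z < 1" and lam: "0 < lam"
  defines "T \<equiv> (\<Sum>n. pochhammer a n / pochhammer lam (Suc n) * z ^ n)"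
  shows "0 \<le> T"
    and "(\<integral>\<^sup>+w\<in>{0<..<z}. ennreal ((1 - w) powr (- a) * (z - w) powr (lam - 1)) \<partial>lborel) =
         ennreal (z powr lam * T)"
proof -
  define c where "c n = pochhammer a n / fact n" for n
  define e where "e n = pochhammer a n / pochhammer lam (Suc n)" for n
  define b where "b n w = w ^ n * (z - w) powr (lam - 1) * indicator {0<..<z} w" for n and w :: real
  define f where "f w = (1 - w) powr (- a) * (z - w) powr (lam - 1) * indicator {0<..<z} w" for w
  let ?I = "\<lambda>n. LINT w|lborel. norm (c n * b n w)"
  have b: "has_bochner_integral lborel (b n) (z powr lam * z ^ n * (fact n / pochhammer lam (Suc n)))" for n
    unfolding b_def using z lam by (intro has_bochner_integral_beta_power) auto
  have b0: "0 \<le> b n w" for n w using z by (cases "w \<in> {0<..<z}") (auto simp: b_def)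
  have summable_c: "summable (\<lambda>n. norm (c n * w ^ n))" if w: "\<bar>w\<bar> < 1" for w
  proof -
    \<comment> \<open>Convergence at one point x of larger modulus gives absolute convergence at
      w.\<close>
    obtain x where x: "\<bar>w\<bar> < x" "x < 1" using dense[OF w] by blast
    then have "summable (\<lambda>n. pochhammer a n / pochhammer 1 n * x ^ n)"
      by (intro summable_pochhammer_power) auto
    then have "summable (\<lambda>n. c n * x ^ n)"
      by (simp only: c_def pochhammer_fact)
    then show ?thesis by (rule powser_insidea) (use x in simp)
  qed
  have summable_e: "summable (\<lambda>n. norm (e n * z ^ n))"
  proof -
    obtain x where x: "\<bar>z\<bar> < x" "x < 1" using dense[of "\<bar>z\<bar>" 1] z by auto
    then have "summable (\<lambda>n. 1 / lam * (pochhammer a n / pochhammer (lam + 1) n * x ^ n))"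
      using lam by (intro summable_mult summable_pochhammer_power) auto
    then have "summable (\<lambda>n. e n * x ^ n)"
      by (simp add: e_def pochhammer_rec)
    then show ?thesis by (rule powser_insidea) (use x in simp)
  qed
  have sum_eq: "(\<Sum>n. c n * b n w) = f w" for w
  proof (cases "w \<in> {0<..<z}")
    case True
    then have "(\<lambda>n. (- a gchoose n) * (- w) ^ n) sums (1 + (- w)) powr (- a)"
      using z by (intro gen_binomial_real) auto
    also have "(\<lambda>n. (- a gchoose n) * (- w) ^ n) = (\<lambda>n. c n * w ^ n)"
    proof
      fix n
      have "(- w) ^ n = (- 1) ^ n * w ^ n" using power_mult_distrib[of "- 1" w n] by simp
      then show "(- a gchoose n) * (- w) ^ n = c n * w ^ n"
        by (simp add: c_def gbinomial_pochhammer)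
    qed
    finally have "(\<lambda>n. c n * w ^ n * (z - w) powr (lam - 1)) sums ((1 - w) powr (- a) * (z - w) powr (lam - 1))"
      by (intro sums_mult2) simp
    then show ?thesis using True by (simp add: sums_iff b_def f_def mult.assoc)
  qed (simp add: b_def f_def)
  have prems: "integrable lborel (\<lambda>w. c n * b n w)"
    "AE w in lborel. summable (\<lambda>n. norm (c n * b n w))"
    "summable (\<lambda>n. ?I n)" for n
  proof -
    show "integrable lborel (\<lambda>w. c n * b n w)"
      using b[of n] by (intro integrable_mult_right) (auto simp: has_bochner_integral_iff)
    show "AE w in lborel. summable (\<lambda>n. norm (c n * b n w))"
    proof (rule AE_I2)
      fix w :: real
      show "summable (\<lambda>n. norm (c n * b n w))"
      proof (cases "w \<in> {0<..<z}")
        case True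
        then have "summable (\<lambda>n. norm (c n * w ^ n) * (z - w) powr (lam - 1))"
          using z by (intro summable_mult2 summable_c) auto
        then show ?thesis using True by (simp add: b_def abs_mult mult.assoc)
      qed (simp add: b_def)
    qed
    have "?I n = z powr lam * norm (e n * z ^ n)" for n
    proof -
      have "?I n = \<bar>c n\<bar> * (LINT w|lborel. b n w)"
        using b0 by (simp add: abs_mult)
      also have "\<dots> = z powr lam * norm (e n * z ^ n)"
        using b[of n] z pochhammer_pos[OF lam, of "Suc n"]
        by (simp add: has_bochner_integral_iff abs_mult c_def e_def)
      finally show ?thesis .
    qed
    then show "summable (\<lambda>n. ?I n)"
      using summable_e by (simp add: summable_mult)
  qed
  have S: "(\<lambda>n. LINT w|lborel. c n * b n w) sums (LINT w|lborel. f w)"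
    using sums_integral[OF prems] by (simp add: sum_eq)
  have terms: "(LINT w|lborel. c n * b n w) = z powr lam * (e n * z ^ n)" for n
    using b[of n] by (simp add: has_bochner_integral_iff c_def e_def)
  have "(\<lambda>n. z powr lam * (e n * z ^ n)) sums (z powr lam * T)"
    unfolding T_def e_def[symmetric]
    by (rule sums_mult[OF summable_sums[OF summable_norm_cancel[OF summable_e]]])
  then have I: "(LINT w|lborel. f w) = z powr lam * T"
    using S unfolding terms by (rule sums_unique2[rotated])
  have f0: "0 \<le> f w" for w by (simp add: f_def)
  have "0 \<le> z powr lam * T" unfolding I[symmetric] using f0 by simp
  then show "0 \<le> T" using z by (simp add: zero_le_mult_iff)
  have "integrable lborel f" using integrable_suminf[OF prems] by (simp add: sum_eq)
  then have "(\<integral>\<^sup>+w. ennreal (f w) \<partial>lborel) = ennreal (z powr lam * T)"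
    unfolding I[symmetric] using f0 by (intro nn_integral_eq_integral) auto
  moreover have "(\<integral>\<^sup>+w. ennreal (f w) \<partial>lborel) =
      (\<integral>\<^sup>+w\<in>{0<..<z}. ennreal ((1 - w) powr (- a) * (z - w) powr (lam - 1)) \<partial>lborel)"
    by (intro nn_integral_cong) (auto simp: f_def indicator_def)
  ultimately show "(\<integral>\<^sup>+w\<in>{0<..<z}. ennreal ((1 - w) powr (- a) * (z - w) powr (lam - 1)) \<partial>lborel) =
      ennreal (z powr lam * T)" by simp
qed

text \<open>The substitution w = 1 - (\<tau> / R)^2 maps r < \<tau> < R onto 0 < w < z, with
  \<tau>^2 - r^2 = R^2 (z - w) and (\<tau> / R)^(\<alpha>-2) = (1 - w)^(\<alpha>/2-1). This is the
  origin of the parameter 1 - \<alpha> / 2 in the series.\<close>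

lemma radial_profile_series:
  fixes \<alpha> lam R r :: real
  assumes lam: "0 < lam" and r: "0 < r" "r < R"
  defines "z \<equiv> 1 - (r / R)\<^sup>2"
  defines "T \<equiv> (\<Sum>n. pochhammer (1 - \<alpha> / 2) n / pochhammer lam (Suc n) * z ^ n)"
  shows "0 \<le> T"
    and "radial_profile \<alpha> lam R r = ennreal (R powr (\<alpha> + 2 * lam - 2) / 2 * (z powr lam * T))"
proof -
  let ?k = "\<lambda>\<tau>. \<tau> powr (\<alpha> - 1) * (\<tau>\<^sup>2 - r\<^sup>2) powr (lam - 1)"
  let ?C = "2 * R powr (2 - \<alpha> - 2 * lam)"
  let ?A = "R powr (\<alpha> + 2 * lam - 2) / 2"
  have "(r / R)\<^sup>2 < 1\<^sup>2" using r by (intro power_strict_mono) auto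
  then have z: "0 < z" "z < 1" using r by (auto simp: z_def)
  show T: "0 \<le> T" unfolding T_def by (rule integral_binomial_beta[OF z lam])
  define g where "g \<tau> = 1 - (\<tau> / R)\<^sup>2" for \<tau> :: real
  define g' where "g' \<tau> = - (2 * \<tau> / R\<^sup>2)" for \<tau> :: real
  define f where "f w = (1 - w) powr (- (1 - \<alpha> / 2)) * (z - w) powr (lam - 1)" for w
  have im: "g ` {r<..<R} = {0<..<z}"
  proof (intro equalityI subsetI)
    fix w assume "w \<in> g ` {r<..<R}"
    then obtain \<tau> where \<tau>: "r < \<tau>" "\<tau> < R" "w = g \<tau>" by auto
    have "(r / R)\<^sup>2 < (\<tau> / R)\<^sup>2" "(\<tau> / R)\<^sup>2 < 1\<^sup>2"
      using \<tau> r by (intro power_strict_mono; simp add: divide_strict_right_mono)+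
    then show "w \<in> {0<..<z}" using \<tau> by (simp add: g_def z_def)
  next
    fix w assume w: "w \<in> {0<..<z}"
    define \<tau> where "\<tau> = R * sqrt (1 - w)"
    have "r / R < sqrt (1 - w)" using w r by (intro real_less_rsqrt) (auto simp: z_def)
    moreover have "sqrt (1 - w) < 1" using w by simp
    ultimately have "\<tau> \<in> {r<..<R}" using r by (simp add: \<tau>_def divide_less_eq mult.commute)
    moreover have "w = g \<tau>" using w z r by (simp add: g_def \<tau>_def)
    ultimately show "w \<in> g ` {r<..<R}" by blast
  qed
  have "ennreal (z powr lam * T) = (\<integral>\<^sup>+w\<in>{0<..<z}. ennreal (f w) \<partial>lborel)"
    unfolding f_def T_def by (rule integral_binomial_beta(2)[OF z lam, symmetric])
  also have "\<dots> = (\<integral>\<^sup>+\<tau>\<in>{r<..<R}. ennreal (\<bar>g' \<tau>\<bar> * f (g \<tau>)) \<partial>lborel)"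
    unfolding im[symmetric]
  proof (rule nn_integral_change_of_variables)
    show "g ` {r<..<R} \<in> sets borel" by (simp add: im)
    show "(g has_real_derivative g' x) (at x)" for x
      unfolding g_def g'_def using r by (auto intro!: derivative_eq_intros simp: power2_eq_square)
    show "inj_on g {r<..<R}"
      using r by (auto simp: inj_on_def g_def power_divide)
  qed (auto simp: f_def g_def[abs_def] g'_def[abs_def])
  also have "\<dots> = (\<integral>\<^sup>+\<tau>. ennreal (?C) *
      (ennreal (?k \<tau>) * indicator {r<..<R} \<tau>) \<partial>lborel)"
  proof (intro nn_integral_cong)
    fix \<tau> :: real
    have "\<bar>g' \<tau>\<bar> * f (g \<tau>) = ?C * (?k \<tau>)"
      if \<tau>: "r < \<tau>" "\<tau> < R"
    proof -
      have "r\<^sup>2 < \<tau>\<^sup>2" using \<tau> r by (intro power_strict_mono) auto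
      have "z - g \<tau> = (\<tau>\<^sup>2 - r\<^sup>2) / R\<^sup>2" by (simp add: z_def g_def power_divide diff_divide_distrib)
      then have 1: "(z - g \<tau>) powr (lam - 1) = (\<tau>\<^sup>2 - r\<^sup>2) powr (lam - 1) * R powr (2 - 2 * lam)"
        using \<open>r\<^sup>2 < \<tau>\<^sup>2\<close> r powr_minus_divide[of R "2 * (lam - 1)"] \<tau>
        by (simp add: powr_divide power2_powr algebra_simps)
      have "(1 - g \<tau>) powr (- (1 - \<alpha> / 2)) = (\<tau> / R) powr (2 * (- (1 - \<alpha> / 2)))"
        using \<tau> r by (simp add: g_def power2_powr del: power_divide)
      also have "2 * (- (1 - \<alpha> / 2)) = \<alpha> - 2" by simp
      also have "(\<tau> / R) powr (\<alpha> - 2) = \<tau> powr (\<alpha> - 2) * R powr (2 - \<alpha>)"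
        using \<tau> r powr_minus_divide[of R "\<alpha> - 2"] by (simp add: powr_divide)
      finally have 2: "(1 - g \<tau>) powr (- (1 - \<alpha> / 2)) = \<tau> powr (\<alpha> - 2) * R powr (2 - \<alpha>)" .
      have 3: "\<bar>g' \<tau>\<bar> = 2 * \<tau> * R powr (- 2)"
        using \<tau> r by (simp add: g'_def powr_minus_divide powr_numeral)
      have "\<bar>g' \<tau>\<bar> * f (g \<tau>) = 2 * (R powr (- 2) * R powr (2 - \<alpha>) * R powr (2 - 2 * lam)) *
          ((\<tau> * \<tau> powr (\<alpha> - 2)) * (\<tau>\<^sup>2 - r\<^sup>2) powr (lam - 1))"
        unfolding f_def 1 2 3 by (simp only: mult_ac)
      also have "R powr (- 2) * R powr (2 - \<alpha>) * R powr (2 - 2 * lam) = R powr (2 - \<alpha> - 2 * lam)"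
        unfolding powr_add[symmetric] by (simp add: algebra_simps)
      also have "\<tau> * \<tau> powr (\<alpha> - 2) = \<tau> powr (\<alpha> - 1)"
        using \<tau> r by (simp add: powr_mult_base)
      finally show ?thesis .
    qed
    then show "ennreal (\<bar>g' \<tau>\<bar> * f (g \<tau>)) * indicator {r<..<R} \<tau> = ennreal (?C) *
      (ennreal (?k \<tau>) * indicator {r<..<R} \<tau>)"
      by (cases "\<tau> \<in> {r<..<R}") (simp_all add: ennreal_mult')
  qed
  also have "\<dots> = ennreal (?C) * radial_profile \<alpha> lam R r"
    unfolding radial_profile_def by (rule nn_integral_cmult) simp
  finally have "ennreal (?A) * ennreal (z powr lam * T) =
      ennreal (?A) * (ennreal (?C) * radial_profile \<alpha> lam R r)"
    by simp
  also have "\<dots> = ennreal (R powr (\<alpha> + 2 * lam - 2) * R powr (2 - \<alpha> - 2 * lam)) * radial_profile \<alpha> lam R r"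
    by (simp add: mult.assoc[symmetric] ennreal_mult'[symmetric])
  also have "R powr (\<alpha> + 2 * lam - 2) * R powr (2 - \<alpha> - 2 * lam) = 1"
    unfolding powr_add[symmetric] using r by simp
  finally have "radial_profile \<alpha> lam R r = ennreal (?A) * ennreal (z powr lam * T)"
    by simp
  also have "\<dots> = ennreal (?A * (z powr lam * T))"
    by (rule ennreal_mult'[symmetric]) simp
  finally show "radial_profile \<alpha> lam R r = ennreal (?A * (z powr lam * T))" .
qed

text \<open>The coefficient of the mixture: \<alpha> times the Gamma quotient in front of
  \<open>F_Q\<close>. By \<open>field_const\<close> it is the value for which the potential balances
  the field.\<close>

definition density_const :: "real \<Rightarrow> real \<Rightarrow> real \<Rightarrow> real \<Rightarrow> real" where
  "density_const d lam q \<alpha> =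
     \<alpha> * q * sin (lam * pi) * Gamma ((d + \<alpha> - 1) / 2) * Gamma ((d + 2 * lam - 3) / 2) /
     (pi powr ((d + 1) / 2) * Gamma ((d + \<alpha> + 2 * lam - 3) / 2))"

section \<open>The constants of the monomial field\<close>

locale monomial_field =
  fixes d lam q \<alpha> :: real
  assumes d: "3 \<le> d" and lam: "0 < lam" "lam < 1" and q: "0 < q" and \<alpha>: "0 < \<alpha>"
begin

abbreviation "R \<equiv> R_star d lam q \<alpha>"
abbreviation "c\<^sub>0 \<equiv> density_const d lam q \<alpha>"

definition s :: real where "s = d - 3 + 2 * lam"

lemma s_pos: "0 < s" using d lam by (simp add: s_def)

lemma sin_pos: "0 < sin (lam * pi)"
  using lam by (intro sin_gt_zero) auto

lemma Gamma_pos: "0 < Gamma ((d + \<alpha> - 1) / 2)" "0 < Gamma (s / 2)" "0 < Gamma ((s + \<alpha>) / 2)"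
    "0 < Gamma lam" "0 < Gamma (1 - lam)" "0 < Gamma ((d - 1) / 2)"
  using d lam \<alpha> s_pos by (auto intro!: Gamma_real_pos)

lemma density_const_eq:
  "c\<^sub>0 = \<alpha> * q * sin (lam * pi) * Gamma ((d + \<alpha> - 1) / 2) * Gamma (s / 2) /
     (pi powr ((d - 1) / 2) * pi * Gamma ((s + \<alpha>) / 2))"
proof -
  have "(d + 1) / 2 = (d - 1) / 2 + 1" by (simp add: field_simps)
  then have "pi powr ((d + 1) / 2) = pi powr ((d - 1) / 2) * pi powr 1"
    by (simp only: powr_add)
  moreover have "d + 2 * lam - 3 = s" "d + \<alpha> + 2 * lam - 3 = s + \<alpha>" by (auto simp: s_def)
  ultimately show ?thesis by (simp only: density_const_def powr_one_gt_zero_iff) simp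
qed

lemma density_const_pos: "0 < c\<^sub>0"
  unfolding density_const_eq using Gamma_pos sin_pos q \<alpha> by simp

lemma Gamma_shift: "Gamma ((d + \<alpha> + 2 * lam - 1) / 2) = (s + \<alpha>) / 2 * Gamma ((s + \<alpha>) / 2)"
    "Gamma ((d + 2 * lam - 1) / 2) = s / 2 * Gamma (s / 2)"
proof -
  have eqs: "(d + \<alpha> + 2 * lam - 1) / 2 = (s + \<alpha>) / 2 + 1" "(d + 2 * lam - 1) / 2 = s / 2 + 1"
    by (auto simp: s_def field_simps)
  have "(s + \<alpha>) / 2 \<notin> \<int>\<^sub>\<le>\<^sub>0" using s_pos \<alpha> by (auto elim!: nonpos_Ints_cases)
  then show "Gamma ((d + \<alpha> + 2 * lam - 1) / 2) = (s + \<alpha>) / 2 * Gamma ((s + \<alpha>) / 2)"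
    unfolding eqs by (rule Gamma_plus1)
  have "s / 2 \<notin> \<int>\<^sub>\<le>\<^sub>0" using s_pos by (auto elim!: nonpos_Ints_cases)
  then show "Gamma ((d + 2 * lam - 1) / 2) = s / 2 * Gamma (s / 2)"
    unfolding eqs by (rule Gamma_plus1)
qed

lemma R_power:
  "R powr (s + \<alpha>) = s * pi * ((s + \<alpha>) / 2 * Gamma ((s + \<alpha>) / 2)) /
     (q * \<alpha> * sin (lam * pi) * Gamma lam * Gamma ((d + \<alpha> - 1) / 2))" (is "_ = ?x")
  and R_pos: "0 < R"
proof -
  have x: "0 < ?x" using Gamma_pos sin_pos q \<alpha> s_pos by simp
  have "d + 2 * lam - 3 = s" "d + \<alpha> + 2 * lam - 3 = s + \<alpha>" by (auto simp: s_def)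
  then have R: "R = ?x powr (1 / (s + \<alpha>))"
    by (simp only: R_star_def Gamma_shift)
  have root: "(X powr (1 / e)) powr e = X" if "0 < X" "0 < e" for X e :: real
    using that by (simp add: powr_powr)
  show "R powr (s + \<alpha>) = ?x"
    unfolding R by (rule root[OF x]) (use s_pos \<alpha> in simp)
  show "0 < R" unfolding R powr_gt_zero by (rule less_imp_neq[OF x, symmetric])
qed

text \<open>The value of R^(s+\<alpha>) turns 1 / R^s into a multiple of R^\<alpha>, so the two
  summands of \<open>C_Q\<close> merge into the very prefactor of \<open>F_Q\<close>. The first term
  of the density thus becomes the summand 1 on the left of
  \<open>gauss_2F1_combination\<close>.\<close>

lemma C_Q_eq: "C_Q d lam q \<alpha> = c\<^sub>0 / \<alpha> * R powr \<alpha>"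
proof -
  define g1 g2 g3 gl sn where "g1 = Gamma ((d + \<alpha> - 1) / 2)" and "g2 = Gamma (s / 2)"
    and "g3 = Gamma ((s + \<alpha>) / 2)" and "gl = Gamma lam" and "sn = sin (lam * pi)"
  have pos: "0 < g1" "0 < g2" "0 < g3" "0 < gl" "0 < sn"
    using Gamma_pos sin_pos by (auto simp: g1_def g2_def g3_def gl_def sn_def)
  define p where "p = pi powr ((d - 1) / 2)"
  have p: "0 < p" by (simp add: p_def)
  have "R powr s * R powr \<alpha> = s * pi * ((s + \<alpha>) / 2 * g3) / (q * \<alpha> * sn * gl * g1)"
    using R_power by (simp add: powr_add g1_def g2_def g3_def gl_def sn_def)
  moreover have "1 / x = y * A / B" if "x * y = B / A" "0 < x" "0 < A" "0 < B" for x y A B :: real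
    using that by (simp add: field_simps)
  ultimately have Rs: "1 / R powr s = R powr \<alpha> * (q * \<alpha> * sn * gl * g1) / (s * pi * ((s + \<alpha>) / 2 * g3))"
    using pos q \<alpha> s_pos R_pos by simp
  have "d + 2 * lam - 3 = s" by (simp add: s_def)
  then have "C_Q d lam q \<alpha> = s / 2 * g2 / (p * gl) *
      (1 / R powr s + q * sn * g1 * gl / (pi * ((s + \<alpha>) / 2 * g3)) * R powr \<alpha>)"
    unfolding C_Q_def Let_def Gamma_shift by (simp add: g1_def g2_def g3_def gl_def sn_def p_def)
  also have "\<dots> = q * sn * g1 * g2 / (p * pi * g3) * R powr \<alpha>"
    unfolding Rs using pos p s_pos \<alpha> q by (simp add: divide_simps) (simp add: algebra_simps)
  finally show ?thesis
    using \<alpha> by (simp add: density_const_eq g1_def g2_def g3_def gl_def sn_def p_def)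
qed

lemma F_Q_eq:
  "F_Q d lam q \<alpha> r = c\<^sub>0 / \<alpha> * R powr \<alpha> * (R\<^sup>2 - r\<^sup>2) powr (lam - 1) *
      (- gauss_2F1 (- \<alpha> / 2) 1 (lam + 1) (1 - (r / R)\<^sup>2) +
       \<alpha> / (2 * lam * (lam + 1)) * (1 - (r / R)\<^sup>2) * gauss_2F1 (1 - \<alpha> / 2) 2 (lam + 2) (1 - (r / R)\<^sup>2))"
  using \<alpha> unfolding F_Q_def Let_def density_const_def by simp

text \<open>By \<open>C_Q_eq\<close> the combined bracket has no constant term in z, so the density
  is z^\<lambda> times a power series, the one found for the mixture. Nonnegativity is inherited
  from there. The radii 0 and R are left out; they form a null set.\<close>

lemma f_Q_eq_profile:
  assumes r: "0 < r" "r < R"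
  shows "0 \<le> f_Q d lam q \<alpha> r"
    and "ennreal (f_Q d lam q \<alpha> r) = ennreal c\<^sub>0 * radial_profile \<alpha> lam R r"
proof -
  define z where "z = 1 - (r / R)\<^sup>2"
  define T where "T = (\<Sum>n. pochhammer (1 - \<alpha> / 2) n / pochhammer lam (Suc n) * z ^ n)"
  have "(r / R)\<^sup>2 < 1\<^sup>2" using r by (intro power_strict_mono) auto
  then have z: "0 < z" "z < 1" using r by (auto simp: z_def)
  have T: "0 \<le> T" and prof: "radial_profile \<alpha> lam R r = ennreal (R powr (\<alpha> + 2 * lam - 2) / 2 * (z powr lam * T))"
    using radial_profile_series[OF lam(1) r] by (auto simp: T_def z_def)
  have "f_Q d lam q \<alpha> r = c\<^sub>0 / \<alpha> * R powr \<alpha> * (R\<^sup>2 - r\<^sup>2) powr (lam - 1) *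
     (1 - gauss_2F1 (- \<alpha> / 2) 1 (lam + 1) z +
      \<alpha> / (2 * lam * (lam + 1)) * z * gauss_2F1 (1 - \<alpha> / 2) 2 (lam + 2) z)"
    unfolding f_Q_def C_Q_eq F_Q_eq z_def[symmetric] by (simp add: algebra_simps)
  also have "\<dots> = c\<^sub>0 / \<alpha> * R powr \<alpha> * (R\<^sup>2 - r\<^sup>2) powr (lam - 1) * (\<alpha> / 2 * z * T)"
    unfolding T_def using lam z by (subst gauss_2F1_combination) auto
  also have "(R\<^sup>2 - r\<^sup>2) powr (lam - 1) = R powr (2 * lam - 2) * z powr (lam - 1)"
  proof -
    have eq: "R\<^sup>2 - r\<^sup>2 = R\<^sup>2 * z" using R_pos by (simp add: z_def power_divide algebra_simps)
    show ?thesis unfolding eq using R_pos z by (simp add: powr_mult power2_powr algebra_simps)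
  qed
  also have "c\<^sub>0 / \<alpha> * R powr \<alpha> * (R powr (2 * lam - 2) * z powr (lam - 1)) * (\<alpha> / 2 * z * T) =
      c\<^sub>0 * ((R powr \<alpha> * R powr (2 * lam - 2)) / 2 * ((z * z powr (lam - 1)) * T))"
    using \<alpha> by simp
  also have "R powr \<alpha> * R powr (2 * lam - 2) = R powr (\<alpha> + 2 * lam - 2)"
    unfolding powr_add[symmetric] by (simp add: algebra_simps)
  also have "z * z powr (lam - 1) = z powr lam" using z by (simp add: powr_mult_base)
  finally have f: "f_Q d lam q \<alpha> r = c\<^sub>0 * (R powr (\<alpha> + 2 * lam - 2) / 2 * (z powr lam * T))" .
  show "0 \<le> f_Q d lam q \<alpha> r" unfolding f using T density_const_pos by simp
  show "ennreal (f_Q d lam q \<alpha> r) = ennreal c\<^sub>0 * radial_profile \<alpha> lam R r"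
    unfolding f prof using density_const_pos by (intro ennreal_mult') simp
qed

lemma Beta_lam: "Beta (1 - lam) lam = pi / sin (lam * pi)"
proof -
  have "Gamma (complex_of_real lam) * Gamma (complex_of_real (1 - lam)) =
      complex_of_real pi / sin (complex_of_real (pi * lam))"
    using Gamma_reflection_complex[of "complex_of_real lam"] by simp
  then have "complex_of_real (Gamma lam * Gamma (1 - lam)) = complex_of_real (pi / sin (pi * lam))"
    by (simp only: Gamma_complex_of_real sin_of_real of_real_mult[symmetric] of_real_divide[symmetric])
  then have "Gamma lam * Gamma (1 - lam) = pi / sin (pi * lam)"
    by (simp only: of_real_eq_iff)
  then show ?thesis by (simp add: Beta_def mult.commute)
qed

lemma Beta_values:
  "Beta (1 - lam) (s / 2) = Gamma (1 - lam) * Gamma (s / 2) / Gamma ((d - 1) / 2)"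
  "Beta ((s + \<alpha>) / 2) (1 - lam) = Gamma ((s + \<alpha>) / 2) * Gamma (1 - lam) / Gamma ((d + \<alpha> - 1) / 2)"
proof -
  have "1 - lam + s / 2 = (d - 1) / 2" "(s + \<alpha>) / 2 + (1 - lam) = (d + \<alpha> - 1) / 2"
    by (auto simp: s_def field_simps)
  then show "Beta (1 - lam) (s / 2) = Gamma (1 - lam) * Gamma (s / 2) / Gamma ((d - 1) / 2)"
    "Beta ((s + \<alpha>) / 2) (1 - lam) = Gamma ((s + \<alpha>) / 2) * Gamma (1 - lam) / Gamma ((d + \<alpha> - 1) / 2)"
    by (simp_all only: Beta_def)
qed

lemma sphere_area_eq:
  assumes n: "0 < n" "d = real n + 1"
  shows "sphere_area n = 2 * pi powr ((d - 1) / 2) / Gamma ((d - 1) / 2)"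
proof -
  have "real n / 2 \<notin> \<int>\<^sub>\<le>\<^sub>0" using n by (auto elim!: nonpos_Ints_cases)
  then have "Gamma (real n / 2 + 1) = real n / 2 * Gamma (real n / 2)" by (rule Gamma_plus1)
  then have "sphere_area n = real n * (pi powr (real n / 2) / (real n / 2 * Gamma (real n / 2)))"
    by (simp only: sphere_area_def unit_ball_vol_def)
  moreover have "real n / 2 = (d - 1) / 2" using n by simp
  ultimately show ?thesis using n(1) by simp
qed

text \<open>The property that determines \<open>density_const\<close>: this combination is the
  coefficient of |x|^\<alpha> which \<open>equilibrium\<close> extracts from the potential, and it
  has to be the strength q of the field.\<close>

lemma field_const:
  assumes n: "0 < n" "d = real n + 1"
  shows "c\<^sub>0 * sphere_area n * Beta (1 - lam) lam * Beta ((s + \<alpha>) / 2) (1 - lam) / (2 * \<alpha> * Beta (1 - lam) (s / 2)) = q"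
  unfolding Beta_lam Beta_values sphere_area_eq[OF n] density_const_eq
  using Gamma_pos sin_pos \<alpha> by (simp add: divide_simps)

text \<open>The equation that determines \<open>R_star\<close>: the coefficient, the area of the
  unit sphere and the radial mass of the profile multiply to a total mass of 1.\<close>

lemma mass_const:
  assumes n: "0 < n" "d = real n + 1"
  shows "c\<^sub>0 * sphere_area n * (Beta (real n / 2) lam / 2 * (R powr (s + \<alpha>) / (s + \<alpha>))) = 1"
proof -
  have "real n / 2 + lam = (d + 2 * lam - 1) / 2" "real n / 2 = (d - 1) / 2" using n by auto
  then have Beta: "Beta (real n / 2) lam = Gamma ((d - 1) / 2) * Gamma lam / (s / 2 * Gamma (s / 2))"
    by (simp only: Beta_def Gamma_shift)
  have "\<alpha> * q * sn * g1 * g2 / (p * pi * g3) * (2 * p / gn) *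
      (gn * gl / (s / 2 * g2) / 2 * (s * pi * ((s + \<alpha>) / 2 * g3) / (q * \<alpha> * sn * gl * g1) / (s + \<alpha>))) = 1"
    if "0 < g1" "0 < g2" "0 < g3" "0 < gl" "0 < gn" "0 < sn" "0 < p" for g1 g2 g3 gl gn sn p
    using that \<alpha> q s_pos by (simp add: divide_simps)
  from this[OF Gamma_pos(1-4) Gamma_pos(6) sin_pos, of "pi powr ((d - 1) / 2)"]
  show ?thesis
    unfolding Beta R_power sphere_area_eq[OF n] density_const_eq by (simp only: pi_gt_zero powr_gt_zero pi_neq_zero simp_thms)
qed

text \<open>The modified Robin constant, that is, the value of potential plus field on the support.
  It is what the potential becomes when R^\<alpha> - t^\<alpha> in its integrand is replaced by
  R^\<alpha>.\<close>

definition equilibrium_const :: "nat \<Rightarrow> real" where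
  "equilibrium_const n = c\<^sub>0 * sphere_area n * Beta (1 - lam) lam / (2 * \<alpha>) * R powr \<alpha>"

text \<open>On \<open>t < min |x| R\<close> the integrand of the potential plus \<open>t\<^sup>\<alpha>\<close> is constant; beyond \<open>R\<close> the term
  \<open>t\<^sup>\<alpha>\<close> exceeds \<open>R\<^sup>\<alpha>\<close>. Integrated, this gives the equilibrium conditions.\<close>

lemma equilibrium:
  fixes x :: "real ^ 'n"
  assumes n: "2 \<le> CARD('n)" "d = real CARD('n) + 1" and x: "0 < norm x"
  defines "U \<equiv> ennreal c\<^sub>0 *
      (\<integral>\<^sup>+r\<in>{0<..<R}. radial_profile \<alpha> lam R r * ennreal (r ^ (CARD('n) - 1)) *
         (\<integral>\<^sup>+u. ennreal (norm (x - r *\<^sub>R u) powr - s) \<partial>surface_measure) \<partial>lborel)"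
  shows "ennreal (equilibrium_const CARD('n)) \<le> U + ennreal (q * norm x powr \<alpha>)"
    and "norm x \<le> R \<Longrightarrow> U + ennreal (q * norm x powr \<alpha>) = ennreal (equilibrium_const CARD('n))"
proof -
  define \<rho> where "\<rho> = norm x"
  define N where "N = real CARD('n)"
  have n0: "0 < CARD('n)" by simp
  have sN: "s = N - 2 + 2 * lam" using n unfolding s_def N_def by linarith
  define w where "w t = t powr (s - 1) * (\<rho>\<^sup>2 - t\<^sup>2) powr - lam" for t
  have w0: "0 \<le> w t" for t by (simp add: w_def)
  let ?j = "\<lambda>t. ennreal (w t * (R powr \<alpha> - t powr \<alpha>))"
  let ?y = "\<lambda>t. ennreal (w t * t powr \<alpha>)"
  let ?x = "\<lambda>t. ennreal (w t * R powr \<alpha>)"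
  let ?E = "equilibrium_const CARD('n)"
  have [measurable]: "w \<in> borel_measurable borel" by (simp add: w_def[abs_def])
  define B2 where "B2 = Beta (1 - lam) (s / 2)"
  define Ba where "Ba = Beta ((s + \<alpha>) / 2) (1 - lam)"
  have B2: "0 < B2" and Ba: "0 < Ba" using Gamma_pos unfolding B2_def Ba_def Beta_values by simp_all
  define c where "c = sphere_area CARD('n) * Beta (1 - lam) lam / \<alpha> * \<rho> powr (2 - N)"
  have c0: "0 \<le> c" using sphere_area_pos[OF n0] \<alpha> sin_pos by (simp add: c_def Beta_lam)
  define J where "J = (\<integral>\<^sup>+t\<in>{0<..<min \<rho> R}. ?j t \<partial>lborel)"
  define k where "k = c\<^sub>0 / B2 * c"
  have k0: "0 \<le> k" using density_const_pos B2 c0 by (simp add: k_def)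
  have U: "U = ennreal k * J"
  proof -
    let ?I = "\<integral>\<^sup>+r\<in>{0<..<R}. radial_profile \<alpha> lam R r * ennreal (r ^ (CARD('n) - 1)) *
         (\<integral>\<^sup>+u. ennreal (norm (x - r *\<^sub>R u) powr - s) \<partial>surface_measure) \<partial>lborel"
    have "ennreal B2 * ?I = ennreal c * J"
      unfolding B2_def c_def J_def w_def \<rho>_def N_def
      using lam n(1) sN[unfolded N_def] \<alpha> R_pos x by (rule radial_potential)
    then have "ennreal (c\<^sub>0 / B2) * (ennreal B2 * ?I) = ennreal (c\<^sub>0 / B2) * (ennreal c * J)" by simp
    then show ?thesis
      unfolding U_def k_def using density_const_pos B2 c0
      by (simp add: mult.assoc[symmetric] ennreal_mult'[symmetric])
  qed
  define Y where "Y = (\<integral>\<^sup>+t\<in>{0<..<\<rho>}. ?y t \<partial>lborel)"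
  define X where "X = (\<integral>\<^sup>+t\<in>{0<..<\<rho>}. ?x t \<partial>lborel)"
  have \<rho>: "0 < \<rho>" using x by (simp add: \<rho>_def)
  have "Y = (\<integral>\<^sup>+t\<in>{0<..<\<rho>}. ennreal (t powr (s + \<alpha> - 1) * (\<rho>\<^sup>2 - t\<^sup>2) powr ((1 - lam) - 1)) \<partial>lborel)"
    unfolding Y_def
  proof (intro set_nn_integral_cong refl arg_cong[where f = ennreal])
    fix t
    have "t powr (s + \<alpha> - 1) = t powr (s - 1) * t powr \<alpha>" unfolding powr_add[symmetric] by (simp add: algebra_simps)
    then show "w t * t powr \<alpha> = t powr (s + \<alpha> - 1) * (\<rho>\<^sup>2 - t\<^sup>2) powr ((1 - lam) - 1)"
      by (simp add: w_def)
  qed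
  also have "\<dots> = ennreal (\<rho> powr (s + \<alpha> + 2 * (1 - lam) - 2) * Ba / 2)"
    unfolding Ba_def using \<rho> s_pos \<alpha> lam by (intro beta_ball) auto
  finally have Y: "Y = ennreal (\<rho> powr (N - 2 + \<alpha>) * Ba / 2)"
    by (simp add: sN algebra_simps)
  have "X = (\<integral>\<^sup>+t. ennreal (R powr \<alpha>) * (ennreal (t powr (s - 1) * (\<rho>\<^sup>2 - t\<^sup>2) powr ((1 - lam) - 1)) * indicator {0<..<\<rho>} t) \<partial>lborel)"
    unfolding X_def by (intro nn_integral_cong) (simp add: w_def ennreal_mult' mult_ac)
  also have "\<dots> = ennreal (R powr \<alpha>) * ennreal (\<rho> powr (s + 2 * (1 - lam) - 2) * Beta (s / 2) (1 - lam) / 2)"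
    using \<rho> s_pos lam by (subst nn_integral_cmult, simp, subst beta_ball) auto
  also have "\<dots> = ennreal (R powr \<alpha> * (\<rho> powr (s + 2 * (1 - lam) - 2) * Beta (s / 2) (1 - lam) / 2))"
    by (rule ennreal_mult'[symmetric]) simp
  also have "s + 2 * (1 - lam) - 2 = N - 2" by (simp add: sN)
  also have "Beta (s / 2) (1 - lam) = B2" unfolding B2_def by (rule Beta_commute)
  finally have X: "X = ennreal (R powr \<alpha> * (\<rho> powr (N - 2) * B2 / 2))" .
  \<comment> \<open>In \<rho>, Y is homogeneous of degree N - 2 + \<alpha> and X of degree N - 2;
    the factor \<rho>^(2-N) in \<open>k\<close> turns the former into the field and the latter into
    a constant.\<close>
  have kY: "ennreal k * Y = ennreal (q * \<rho> powr \<alpha>)"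
  proof -
    have "k * (\<rho> powr (N - 2 + \<alpha>) * Ba / 2) =
        (c\<^sub>0 * sphere_area CARD('n) * Beta (1 - lam) lam * Ba / (2 * \<alpha> * B2)) * (\<rho> powr (2 - N) * \<rho> powr (N - 2 + \<alpha>))"
      by (simp add: k_def c_def mult_ac)
    also have "\<dots> = q * \<rho> powr \<alpha>"
      unfolding Ba_def B2_def field_const[OF n0 n(2)] powr_add[symmetric] by simp
    finally show ?thesis unfolding Y using k0 by (simp flip: ennreal_mult')
  qed
  have kX: "ennreal k * X = ennreal (?E)"
  proof -
    have "k * (R powr \<alpha> * (\<rho> powr (N - 2) * B2 / 2)) =
        ?E * (\<rho> powr (2 - N) * \<rho> powr (N - 2))"
      using B2 by (simp add: k_def c_def equilibrium_const_def mult_ac)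
    also have "\<rho> powr (2 - N) * \<rho> powr (N - 2) = 1"
      unfolding powr_add[symmetric] using \<rho> by simp
    finally show ?thesis unfolding X using k0 by (simp flip: ennreal_mult')
  qed
  have JY: "J + Y = (\<integral>\<^sup>+t. ?j t * indicator {0<..<min \<rho> R} t +
      ?y t * indicator {0<..<\<rho>} t \<partial>lborel)"
    unfolding J_def Y_def by (rule nn_integral_add[symmetric]) auto
  have less: "?j t + ?y t = ?x t"
    if "0 < t" "t < R" for t
  proof -
    have "t powr \<alpha> \<le> R powr \<alpha>" using that \<alpha> by (intro powr_mono2) auto
    then have "?j t + ?y t =
        ennreal (w t * (R powr \<alpha> - t powr \<alpha>) + w t * t powr \<alpha>)"
      using w0[of t] by (intro ennreal_plus[symmetric]) auto
    also have "w t * (R powr \<alpha> - t powr \<alpha>) + w t * t powr \<alpha> = w t * R powr \<alpha>"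
      by (simp add: algebra_simps)
    finally show ?thesis .
  qed
  have "X \<le> J + Y"
    unfolding JY X_def
  proof (intro nn_integral_mono)
    fix t
    have "?x t \<le> ?y t" if "R \<le> t"
      using that \<alpha> w0[of t] R_pos by (intro ennreal_leI mult_left_mono powr_mono2) auto
    then show "?x t * indicator {0<..<\<rho>} t \<le>
       ?j t * indicator {0<..<min \<rho> R} t + ?y t * indicator {0<..<\<rho>} t"
      using less[of t] by (cases "t \<in> {0<..<\<rho>}"; cases "t < R") auto
  qed
  then have "ennreal k * X \<le> ennreal k * (J + Y)" by (rule mult_left_mono) simp
  then show "ennreal (?E) \<le> U + ennreal (q * norm x powr \<alpha>)"
    unfolding kX distrib_left kY U \<rho>_def[symmetric] .
  show "U + ennreal (q * norm x powr \<alpha>) = ennreal (?E)" if "norm x \<le> R"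
  proof -
    have "J + Y = X"
      unfolding JY X_def
    proof (intro nn_integral_cong)
      fix t
      show "?j t * indicator {0<..<min \<rho> R} t + ?y t * indicator {0<..<\<rho>} t =
        ?x t * indicator {0<..<\<rho>} t"
        using less[of t] that by (cases "t \<in> {0<..<\<rho>}") (auto simp: \<rho>_def)
    qed
    then show ?thesis
      unfolding kX[symmetric] kY[symmetric] U \<rho>_def[symmetric] by (simp flip: distrib_left)
  qed
qed

end

section \<open>The extremal measure\<close>

lemma gauss_2F1_measurable [measurable]: "gauss_2F1 a b c \<in> borel_measurable borel"
  unfolding gauss_2F1_def[abs_def] by measurable

lemma f_Q_measurable [measurable]: "f_Q d lam q \<alpha> \<in> borel_measurable borel"
  unfolding f_Q_def[abs_def] F_Q_def Let_def by measurable

lemma riesz_kernel_measurable [measurable]: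
  "(\<lambda>(x, y :: 'a::euclidean_space). riesz_kernel s x y) \<in> borel_measurable (borel \<Otimes>\<^sub>M borel)"
proof -
  have [measurable]: "Measurable.pred borel (\<lambda>p :: 'a \<times> 'a. fst p = snd p)"
    by (intro pred_def[THEN iffD2] borel_closed) (simp add: closed_Collect_eq continuous_intros)
  have [measurable]: "(\<lambda>p :: 'a \<times> 'a. dist (fst p) (snd p)) \<in> borel_measurable borel"
    by (intro borel_measurable_continuous_onI continuous_intros)
  show ?thesis
    unfolding riesz_kernel_def[abs_def] case_prod_beta borel_prod by measurable
qed

definition radial_measure :: "real \<Rightarrow> (real \<Rightarrow> real) \<Rightarrow> (real \<times> (real ^ 'n)) measure" where
  "radial_measure R f = distr
     (density lborel (\<lambda>r. ennreal (indicator {0..R} r * f r * r ^ (CARD('n) - 1))) \<Otimes>\<^sub>M surface_measure)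
     borel (\<lambda>(r, u). (0, r *\<^sub>R u))"

lemma measurable_ray [measurable]:
  "(\<lambda>(r, u). (0, r *\<^sub>R u)) \<in> borel \<Otimes>\<^sub>M borel \<rightarrow>\<^sub>M (borel :: (real \<times> (real ^ 'n)) measure)"
proof -
  have "(\<lambda>p :: real \<times> (real ^ 'n). (0 :: real, fst p *\<^sub>R snd p)) \<in> borel \<rightarrow>\<^sub>M borel"
    by (intro borel_measurable_continuous_onI continuous_intros)
  then show ?thesis by (simp add: borel_prod case_prod_beta)
qed

lemma nn_integral_radial_measure:
  fixes h :: "real \<times> (real ^ 'n) \<Rightarrow> ennreal"
  assumes [measurable]: "f \<in> borel_measurable borel" "h \<in> borel_measurable borel"
  shows "(\<integral>\<^sup>+y. h y \<partial>radial_measure R f) =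
    (\<integral>\<^sup>+r\<in>{0<..<R}. ennreal (f r * r ^ (CARD('n) - 1)) * (\<integral>\<^sup>+u. h (0, r *\<^sub>R u) \<partial>surface_measure) \<partial>lborel)"
proof -
  interpret finite_measure "surface_measure :: (real ^ 'n) measure"
    by (rule finite_measure_surface_measure)
  let ?g = "\<lambda>r. ennreal (indicator {0..R} r * f r * r ^ (CARD('n) - 1))"
  have [measurable]: "(\<lambda>(r, u). h (0, r *\<^sub>R u)) \<in> borel_measurable (borel \<Otimes>\<^sub>M borel)"
    using measurable_compose[OF measurable_ray assms(2)] by (simp add: case_prod_beta)
  have [measurable]: "(\<lambda>(r, u). (0, r *\<^sub>R u)) \<in> density lborel ?g \<Otimes>\<^sub>M surface_measure \<rightarrow>\<^sub>M
      (borel :: (real \<times> (real ^ 'n)) measure)"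
    using measurable_ray by (simp cong: measurable_cong_sets)
  have "(\<integral>\<^sup>+y. h y \<partial>radial_measure R f) =
    (\<integral>\<^sup>+p. h (case p of (r, u) \<Rightarrow> (0, r *\<^sub>R u)) \<partial>(density lborel ?g \<Otimes>\<^sub>M surface_measure))"
    unfolding radial_measure_def by (rule nn_integral_distr) auto
  also have "\<dots> = (\<integral>\<^sup>+r. (\<integral>\<^sup>+u. h (0, r *\<^sub>R u) \<partial>surface_measure) \<partial>density lborel ?g)"
    by (subst nn_integral_fst[symmetric]) (auto simp: case_prod_beta)
  also have "\<dots> = (\<integral>\<^sup>+r. ?g r * (\<integral>\<^sup>+u. h (0, r *\<^sub>R u) \<partial>surface_measure) \<partial>lborel)"
    by (rule nn_integral_density) auto
  also have "\<dots> = (\<integral>\<^sup>+r\<in>{0..R}. ennreal (f r * r ^ (CARD('n) - 1)) * (\<integral>\<^sup>+u. h (0, r *\<^sub>R u) \<partial>surface_measure) \<partial>lborel)"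
    by (intro nn_integral_cong) (auto simp: indicator_def)
  finally show ?thesis by (simp only: nn_integral_Ioo_eq_Icc)
qed

text \<open>Interior radii and unit directions suffice: the two end radii are null for the radial
  part, and all other vectors are null for the surface measure.\<close>

lemma AE_radial_measure:
  fixes P :: "real \<times> (real ^ 'n) \<Rightarrow> bool"
  assumes [measurable]: "f \<in> borel_measurable borel" "Measurable.pred borel P"
    and P: "\<And>r u. 0 < r \<Longrightarrow> r < R \<Longrightarrow> norm u = 1 \<Longrightarrow> P (0, r *\<^sub>R u)"
  shows "AE y in radial_measure R f. P y"
proof -
  have sets: "sets (radial_measure R f) = sets (borel :: (real \<times> (real ^ 'n)) measure)"
    by (simp add: radial_measure_def)
  have [measurable]: "Measurable.pred (radial_measure R f) P"
    unfolding measurable_cong_sets[OF sets refl] by (rule assms(2))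
  have "(\<integral>\<^sup>+y. indicator {y. \<not> P y} y \<partial>radial_measure R f) = 0"
  proof -
    have "(\<integral>\<^sup>+u. indicator {y. \<not> P y} (0, r *\<^sub>R u) \<partial>surface_measure) = (0 :: ennreal)" if "r \<in> {0<..<R}" for r
    proof -
      have "(\<integral>\<^sup>+u. indicator {y. \<not> P y} (0, r *\<^sub>R u) \<partial>surface_measure) = (\<integral>\<^sup>+u. 0 \<partial>(surface_measure :: (real ^ 'n) measure))"
        using that P by (intro nn_integral_cong_AE eventually_mono[OF AE_surface_measure]) auto
      then show ?thesis by simp
    qed
    then have "(\<integral>\<^sup>+r\<in>{0<..<R}. ennreal (f r * r ^ (CARD('n) - 1)) *
      (\<integral>\<^sup>+u. indicator {y. \<not> P y} (0, r *\<^sub>R u) \<partial>surface_measure) \<partial>lborel) = (\<integral>\<^sup>+r\<in>{0<..<R}. 0 \<partial>lborel)"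
      by (intro set_nn_integral_cong refl) auto
    then show ?thesis by (subst nn_integral_radial_measure) auto
  qed
  then show ?thesis
    by (subst (asm) nn_integral_0_iff_AE) (auto simp: indicator_def)
qed

lemma disk_borel [measurable]: "disk R \<in> sets borel"
proof -
  have "closed (disk R :: (real \<times> (real ^ 'n)) set)"
    unfolding disk_def by (intro closed_Collect_conj closed_Collect_eq closed_Collect_le continuous_intros)
  then show ?thesis by (rule borel_closed)
qed

context monomial_field begin

definition candidate :: "(real \<times> (real ^ 'n)) measure" where
  "candidate = radial_measure R (f_Q d lam q \<alpha>)"

text \<open>Under the integral sign the hypergeometric form of the density is exchanged for the
  mixture, to which the formulas for potential and mass apply.\<close>

lemma nn_integral_candidate:
  fixes h :: "real \<times> (real ^ 'n) \<Rightarrow> ennreal"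
  assumes [measurable]: "h \<in> borel_measurable borel"
  shows "(\<integral>\<^sup>+y. h y \<partial>candidate) = ennreal c\<^sub>0 *
    (\<integral>\<^sup>+r\<in>{0<..<R}. radial_profile \<alpha> lam R r * ennreal (r ^ (CARD('n) - 1)) *
       (\<integral>\<^sup>+u. h (0, r *\<^sub>R u) \<partial>surface_measure) \<partial>lborel)"
proof -
  let ?S = "\<lambda>r. \<integral>\<^sup>+u. h (0, r *\<^sub>R u) \<partial>surface_measure"
  let ?p = "\<lambda>r. radial_profile \<alpha> lam R r * ennreal (r ^ (CARD('n) - 1))"
  interpret finite_measure "surface_measure :: (real ^ 'n) measure"
    by (rule finite_measure_surface_measure)
  have [measurable]: "(\<lambda>(r, u). h (0, r *\<^sub>R u)) \<in> borel_measurable (borel \<Otimes>\<^sub>M borel)"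
    using measurable_compose[OF measurable_ray assms] by (simp add: case_prod_beta)
  have "(\<integral>\<^sup>+y. h y \<partial>candidate) = (\<integral>\<^sup>+r. ennreal c\<^sub>0 * (?p r *
       ?S r * indicator {0<..<R} r) \<partial>lborel)"
    unfolding candidate_def
  proof (subst nn_integral_radial_measure, simp, simp, intro nn_integral_cong)
    fix r :: real
    have "ennreal (f_Q d lam q \<alpha> r * r ^ (CARD('n) - 1)) =
        ennreal c\<^sub>0 * (?p r)" if "0 < r" "r < R"
      using f_Q_eq_profile[OF that] by (simp add: ennreal_mult' mult.assoc)
    then show "ennreal (f_Q d lam q \<alpha> r * r ^ (CARD('n) - 1)) * ?S r * indicator {0<..<R} r =
       ennreal c\<^sub>0 * (?p r *
       ?S r * indicator {0<..<R} r)"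
      by (cases "r \<in> {0<..<R}") (auto simp: mult.assoc)
  qed
  also have "\<dots> = ennreal c\<^sub>0 * (\<integral>\<^sup>+r\<in>{0<..<R}. ?p r *
       ?S r \<partial>lborel)"
    by (rule nn_integral_cmult) simp
  finally show ?thesis .
qed

lemma sets_candidate [simp, measurable_cong]: "sets candidate = sets borel"
  by (simp add: candidate_def radial_measure_def)

lemma prob_space_candidate:
  assumes n: "d = real CARD('n) + 1"
  shows "prob_space (candidate :: (real \<times> (real ^ 'n)) measure)"
proof (rule prob_spaceI)
  let ?A = "sphere_area CARD('n)"
  let ?p = "\<lambda>r. radial_profile \<alpha> lam R r * ennreal (r ^ (CARD('n) - 1))"
  let ?S = "\<integral>\<^sup>+u. 1 \<partial>(surface_measure :: (real ^ 'n) measure)"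
  have A: "0 < ?A" by (simp add: sphere_area_pos)
  have "emeasure (candidate :: (real \<times> (real ^ 'n)) measure) (space candidate) = (\<integral>\<^sup>+y. 1 \<partial>(candidate :: (real \<times> (real ^ 'n)) measure))" by simp
  also have "\<dots> = ennreal c\<^sub>0 * (\<integral>\<^sup>+r\<in>{0<..<R}. ?p r *
       ?S \<partial>lborel)"
    by (rule nn_integral_candidate) simp
  also have "(\<integral>\<^sup>+r\<in>{0<..<R}. ?p r *
       ?S \<partial>lborel) =
      (\<integral>\<^sup>+r. ennreal ?A * (ennreal (r powr (real CARD('n) - 1)) * radial_profile \<alpha> lam R r * indicator {0<..<R} r) \<partial>lborel)"
  proof (intro nn_integral_cong)
    fix r :: real
    have "r ^ (CARD('n) - 1) = r powr (real CARD('n) - 1)" if "0 < r"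
      using that by (simp add: powr_realpow[symmetric] of_nat_diff Suc_leI)
    then show "?p r *
       ?S * indicator {0<..<R} r =
       ennreal ?A * (ennreal (r powr (real CARD('n) - 1)) * radial_profile \<alpha> lam R r * indicator {0<..<R} r)"
      by (cases "r \<in> {0<..<R}") (auto simp: emeasure_surface_measure_UNIV mult_ac)
  qed
  also have "\<dots> = ennreal ?A * ennreal (Beta (real CARD('n) / 2) lam / 2 *
      (R powr (\<alpha> + real CARD('n) + 2 * lam - 2) / (\<alpha> + real CARD('n) + 2 * lam - 2)))"
  proof -
    have "0 < \<alpha> + real CARD('n) + 2 * lam - 2" using n d \<alpha> lam by linarith
    then show ?thesis
      using lam \<alpha> R_pos by (subst nn_integral_cmult, simp, subst radial_profile_mass) auto
  qed
  also have "\<alpha> + real CARD('n) + 2 * lam - 2 = s + \<alpha>" using n unfolding s_def by linarith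
  also have "ennreal c\<^sub>0 * (ennreal ?A * ennreal (Beta (real CARD('n) / 2) lam / 2 * (R powr (s + \<alpha>) / (s + \<alpha>)))) =
     ennreal (c\<^sub>0 * ?A * (Beta (real CARD('n) / 2) lam / 2 * (R powr (s + \<alpha>) / (s + \<alpha>))))"
    using A density_const_pos by (simp add: ennreal_mult'[symmetric] mult.assoc)
  also have "\<dots> = 1" unfolding mass_const[OF zero_less_card_finite n] by simp
  finally show "emeasure (candidate :: (real \<times> (real ^ 'n)) measure) (space candidate) = 1" .
qed

text \<open>The value \<infinity> of the kernel on the diagonal can be met only at r = |x|, a single
  radius; elsewhere the kernel is the power that occurs in \<open>equilibrium\<close>.\<close>

lemma candidate_potential:
  fixes x :: "real ^ 'n"
  assumes n: "2 \<le> CARD('n)" "d = real CARD('n) + 1"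
  shows "(\<integral>\<^sup>+y. riesz_kernel s (0, x) y \<partial>candidate) = ennreal c\<^sub>0 *
      (\<integral>\<^sup>+r\<in>{0<..<R}. radial_profile \<alpha> lam R r * ennreal (r ^ (CARD('n) - 1)) *
         (\<integral>\<^sup>+u. ennreal (norm (x - r *\<^sub>R u) powr - s) \<partial>surface_measure) \<partial>lborel)"
proof (subst nn_integral_candidate, simp, rule arg_cong[where f = "\<lambda>I. ennreal c\<^sub>0 * I"],
    rule nn_integral_cong_AE, rule eventually_mono[OF AE_lborel_singleton[of "norm x"]])
  fix r assume r: "r \<noteq> norm x"
  let ?S = "\<integral>\<^sup>+u. ennreal (norm (x - r *\<^sub>R u) powr - s) \<partial>surface_measure"
  let ?p = "radial_profile \<alpha> lam R r * ennreal (r ^ (CARD('n) - 1))"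
  have K: "(\<integral>\<^sup>+u. riesz_kernel s (0 :: real, x) (0, r *\<^sub>R u) \<partial>surface_measure) =
      ?S" if "0 < r"
  proof (intro nn_integral_cong_AE eventually_mono[OF AE_surface_measure])
    fix u :: "real ^ 'n" assume "norm u = 1"
    then have "x \<noteq> r *\<^sub>R u" using r that by auto
    then show "riesz_kernel s (0 :: real, x) (0, r *\<^sub>R u) = ennreal (norm (x - r *\<^sub>R u) powr - s)"
      by (simp add: riesz_kernel_def dist_Pair_Pair dist_norm)
  qed
  show "?p *
      (\<integral>\<^sup>+u. riesz_kernel s (0 :: real, x) (0, r *\<^sub>R u) \<partial>surface_measure) * indicator {0<..<R} r =
      ?p *
      ?S * indicator {0<..<R} r"
  proof (cases "r \<in> {0<..<R}")
    case True
    then have "0 < r" by simp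
    show ?thesis unfolding K[OF \<open>0 < r\<close>] ..
  qed simp
qed

end

section \<open>Comparison of energies\<close>

context monomial_field begin

definition field :: "real \<times> (real ^ 'n) \<Rightarrow> real" where
  "field x = q * norm (snd x) powr \<alpha>"

lemma field_measurable [measurable]: "field \<in> borel_measurable (borel :: (real \<times> (real ^ 'n)) measure)"
proof -
  have [measurable]: "(\<lambda>x :: real \<times> (real ^ 'n). norm (snd x)) \<in> borel_measurable borel"
    by (intro borel_measurable_continuous_onI continuous_intros)
  show ?thesis unfolding field_def[abs_def] by measurable
qed

lemma field_nonneg: "0 \<le> field x" using q by (simp add: field_def)

definition total_energy :: "(real \<times> (real ^ 'n)) measure \<Rightarrow> ennreal" where
  "total_energy \<mu> = riesz_energy s \<mu> + 2 * (\<integral>\<^sup>+x. ennreal (field x) \<partial>\<mu>)"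

lemma disk_measuresD:
  assumes "\<mu> \<in> disk_measures"
  shows "sets \<mu> = sets borel" "prob_space \<mu>" "finite_measure \<mu>" "AE x in \<mu>. x \<in> disk 1"
  using assms by (auto simp: disk_measures_def supported_on_def prob_space.finite_measure)

lemma field_integral_finite:
  assumes "\<mu> \<in> disk_measures"
  shows "(\<integral>\<^sup>+x. ennreal (field x) \<partial>\<mu>) \<le> ennreal q"
proof -
  interpret prob_space \<mu> using assms by (rule disk_measuresD)
  have "(\<integral>\<^sup>+x. ennreal (field x) \<partial>\<mu>) \<le> (\<integral>\<^sup>+x. ennreal q \<partial>\<mu>)"
  proof (intro nn_integral_mono_AE eventually_mono[OF disk_measuresD(4)[OF assms]] ennreal_leI)
    fix x :: "real \<times> (real ^ 'n)" assume "x \<in> disk 1"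
    then have "norm (snd x) powr \<alpha> \<le> 1 powr \<alpha>" using \<alpha> by (intro powr_mono2) (auto simp: disk_def)
    then show "field x \<le> q" using q by (simp add: field_def)
  qed
  then show ?thesis by (simp add: emeasure_space_1)
qed

text \<open>An admissible measure lives on the unit disk, where Q is the field and the field is
  bounded by q. Its Bochner integral is therefore a genuine one, not the default value 0, and agrees
  with the nonnegative integral.\<close>

lemma weighted_energy_eq:
  fixes Q :: "real \<times> (real ^ 'n) \<Rightarrow> real"
  assumes Q: "\<And>x. x \<in> disk 1 \<Longrightarrow> Q x = field x" and \<mu>: "\<mu> \<in> disk_measures"
  shows "weighted_energy s Q \<mu> = enn2ereal (total_energy \<mu>)"
proof -
  note [measurable_cong] = disk_measuresD(1)[OF \<mu>]
  interpret prob_space \<mu> using \<mu> by (rule disk_measuresD)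
  define I where "I = (LINT x|\<mu>. field x)"
  have I0: "0 \<le> I" unfolding I_def by (simp add: field_nonneg)
  have "(LINT x:disk 1|\<mu>. Q x) = (LINT x:disk 1|\<mu>. field x)"
    unfolding set_lebesgue_integral_def
    by (intro Bochner_Integration.integral_cong refl) (auto simp: Q indicator_def)
  also have "\<dots> = I"
    unfolding set_lebesgue_integral_def I_def
    using disk_measuresD(4)[OF \<mu>]
    by (intro integral_cong_AE) (auto elim!: eventually_mono)
  finally have L: "(LINT x:disk 1|\<mu>. Q x) = I" .
  have "integrable \<mu> field"
    using field_integral_finite[OF \<mu>]
    by (intro integrableI_nonneg AE_I2[OF field_nonneg]) (auto intro: le_less_trans)
  then have "(\<integral>\<^sup>+x. ennreal (field x) \<partial>\<mu>) = ennreal I"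
    unfolding I_def by (rule nn_integral_eq_integral[OF _ AE_I2[OF field_nonneg]])
  then have "2 * (\<integral>\<^sup>+x. ennreal (field x) \<partial>\<mu>) = ennreal (2 * I)"
    by (simp add: ennreal_mult')
  then show ?thesis
    using I0 by (simp add: weighted_energy_def L total_energy_def plus_ennreal.rep_eq enn2ereal_ennreal)
qed

text \<open>The equilibrium inequality integrated against a competitor. Finite energy excludes a
  point mass at the origin, since an atom contributes \<infinity> times the square of its
  mass.\<close>

lemma mutual_energy_candidate_ge:
  fixes \<mu> :: "(real \<times> (real ^ 'n)) measure"
  assumes n: "2 \<le> CARD('n)" "d = real CARD('n) + 1"
    and \<mu>: "\<mu> \<in> disk_measures" and fin: "riesz_energy s \<mu> \<noteq> \<infinity>"
  shows "ennreal (equilibrium_const CARD('n)) \<le> mutual_energy s \<mu> candidate + (\<integral>\<^sup>+x. ennreal (field x) \<partial>\<mu>)"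
proof -
  note [measurable_cong] = disk_measuresD(1)[OF \<mu>]
  interpret prob_space \<mu> using \<mu> by (rule disk_measuresD)
  interpret C: prob_space "candidate :: (real \<times> (real ^ 'n)) measure" by (rule prob_space_candidate[OF n(2)])
  \<comment> \<open>The formula for the potential is not available at the origin.\<close>
  have atom: "emeasure \<mu> {0} = 0"
  proof (rule ccontr)
    assume "emeasure \<mu> {0} \<noteq> 0"
    then have "\<infinity> = (\<infinity> * emeasure \<mu> {0}) * emeasure \<mu> {0}"
      by (simp add: ennreal_top_mult)
    also have "\<dots> = (\<integral>\<^sup>+x. \<infinity> * emeasure \<mu> {0} * indicator {0} x \<partial>\<mu>)"
      by (rule nn_integral_cmult_indicator[symmetric]) simp
    also have "\<dots> \<le> riesz_energy s \<mu>"
      unfolding riesz_energy_def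
    proof (intro nn_integral_mono)
      fix x :: "real \<times> (real ^ 'n)"
      have "\<infinity> * emeasure \<mu> {0} = (\<integral>\<^sup>+y. \<infinity> * indicator {0} y \<partial>\<mu>)"
        by (rule nn_integral_cmult_indicator[symmetric]) simp
      also have "\<dots> \<le> (\<integral>\<^sup>+y. riesz_kernel s 0 y \<partial>\<mu>)"
        by (intro nn_integral_mono) (auto simp: riesz_kernel_def indicator_def)
      finally show "\<infinity> * emeasure \<mu> {0} * indicator {0} x \<le> (\<integral>\<^sup>+y. riesz_kernel s x y \<partial>\<mu>)"
        by (auto simp: indicator_def)
    qed
    finally show False using fin by (simp add: top_unique)
  qed
  have ne: "AE x in \<mu>. x \<noteq> 0"
    using atom by (intro AE_I[of _ _ "{0}"]) auto
  have "ennreal (equilibrium_const CARD('n)) = (\<integral>\<^sup>+x. ennreal (equilibrium_const CARD('n)) \<partial>\<mu>)"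
    by (simp add: emeasure_space_1)
  also have "\<dots> \<le> (\<integral>\<^sup>+x. (\<integral>\<^sup>+y. riesz_kernel s x y \<partial>candidate) + ennreal (field x) \<partial>\<mu>)"
    using disk_measuresD(4)[OF \<mu>] ne
  proof (intro nn_integral_mono_AE, eventually_elim)
    case (elim x)
    obtain y where x: "x = (0, y)" using elim by (cases x) (auto simp: disk_def)
    then have "0 < norm y" using elim by (auto simp: zero_prod_def)
    from equilibrium(1)[OF n this] show ?case
      unfolding x candidate_potential[OF n] by (simp add: field_def)
  qed
  also have "\<dots> = mutual_energy s \<mu> candidate + (\<integral>\<^sup>+x. ennreal (field x) \<partial>\<mu>)"
    unfolding mutual_energy_def by (rule nn_integral_add) auto
  finally show ?thesis .
qed

lemma AE_candidate_disk:
  "AE x in (candidate :: (real \<times> (real ^ 'n)) measure). x \<in> disk R \<and> x \<noteq> 0"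
  unfolding candidate_def
proof (rule AE_radial_measure)
  show "Measurable.pred borel (\<lambda>x :: real \<times> (real ^ 'n). x \<in> disk R \<and> x \<noteq> 0)"
    using sets.Diff[OF disk_borel[of R], of "{0}"] by (simp add: pred_def set_diff_eq)
qed (auto simp: disk_def zero_prod_def)

text \<open>The candidate lives where the equilibrium condition holds with equality, so the
  integrated inequality becomes an identity. In particular its energy is finite.\<close>

lemma energy_candidate:
  assumes n: "2 \<le> CARD('n)" "d = real CARD('n) + 1"
  shows "riesz_energy s (candidate :: (real \<times> (real ^ 'n)) measure) + (\<integral>\<^sup>+x. ennreal (field x) \<partial>(candidate :: (real \<times> (real ^ 'n)) measure)) =
      ennreal (equilibrium_const CARD('n))"
proof -
  let ?c = "candidate :: (real \<times> (real ^ 'n)) measure"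
  interpret C: prob_space ?c by (rule prob_space_candidate[OF n(2)])
  have "riesz_energy s ?c + (\<integral>\<^sup>+x. ennreal (field x) \<partial>?c) =
      (\<integral>\<^sup>+x. (\<integral>\<^sup>+y. riesz_kernel s x y \<partial>?c) + ennreal (field x) \<partial>?c)"
    unfolding riesz_energy_def by (rule nn_integral_add[symmetric]) auto
  also have "\<dots> = (\<integral>\<^sup>+x. ennreal (equilibrium_const CARD('n)) \<partial>?c)"
  proof (intro nn_integral_cong_AE eventually_mono[OF AE_candidate_disk])
    fix x :: "real \<times> (real ^ 'n)" assume x: "x \<in> disk R \<and> x \<noteq> 0"
    then obtain y where y: "x = (0, y)" by (cases x) (auto simp: disk_def)
    then have "0 < norm y" "norm y \<le> R" using x by (auto simp: disk_def zero_prod_def)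
    from equilibrium(2)[OF n this]
    show "(\<integral>\<^sup>+y. riesz_kernel s x y \<partial>?c) + ennreal (field x) = ennreal (equilibrium_const CARD('n))"
      unfolding y candidate_potential[OF n] by (simp add: field_def)
  qed
  finally show ?thesis by (simp add: C.emeasure_space_1)
qed

lemma candidate_in_disk_measures:
  assumes n: "d = real CARD('n) + 1" and "R \<le> 1"
  shows "(candidate :: (real \<times> (real ^ 'n)) measure) \<in> disk_measures"
proof -
  have "AE x in (candidate :: (real \<times> (real ^ 'n)) measure). x \<in> disk 1"
    using AE_candidate_disk by (rule eventually_mono) (use \<open>R \<le> 1\<close> in \<open>auto simp: disk_def\<close>)
  then show ?thesis
    using prob_space_candidate[OF n] by (simp add: disk_measures_def supported_on_def)
qed

text \<open>With c the candidate, F the equilibrium constant and Q the field: I(\<mu>) + I(c) + 2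
  \<integral>Q d\<mu> \<ge> 2 I(\<mu>, c) + 2 \<integral>Q d\<mu> \<ge> 2 F = I(c) + 2 \<integral>Q
  dc + I(c). The finite energy I(c) is carried on both sides and cancelled at the end. In the case
  of equality the same chain yields I(\<mu>) + I(c) \<le> 2 I(\<mu>, c), the assumption of
  \<open>mutual_energy_uniqueness\<close>.\<close>

lemma total_energy_minimal:
  fixes \<mu> :: "(real \<times> (real ^ 'n)) measure"
  assumes n: "2 \<le> CARD('n)" "d = real CARD('n) + 1" and "R \<le> 1" and \<mu>: "\<mu> \<in> disk_measures"
  shows "total_energy (candidate :: (real \<times> (real ^ 'n)) measure) \<le> total_energy \<mu>"
    and "total_energy \<mu> = total_energy (candidate :: (real \<times> (real ^ 'n)) measure) \<Longrightarrow> \<mu> = candidate"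
proof -
  let ?c = "candidate :: (real \<times> (real ^ 'n)) measure"
  have c: "?c \<in> disk_measures" using n(2) \<open>R \<le> 1\<close> by (rule candidate_in_disk_measures)
  define F where "F = ennreal (equilibrium_const CARD('n))"
  define Ic Im Icm fc fm where "Ic = riesz_energy s ?c" and "Im = riesz_energy s \<mu>"
    and "Icm = mutual_energy s \<mu> ?c" and "fc = (\<integral>\<^sup>+x. ennreal (field x) \<partial>?c)"
    and "fm = (\<integral>\<^sup>+x. ennreal (field x) \<partial>\<mu>)"
  have c_eq: "Ic + fc = F" unfolding Ic_def fc_def F_def by (rule energy_candidate[OF n])
  have "Ic \<le> F" "fc \<le> F" unfolding c_eq[symmetric] by simp_all
  then have Ic_fin: "Ic < \<infinity>" "fc < \<infinity>" by (auto simp: F_def intro: le_less_trans)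
  have fm_fin: "fm < \<infinity>"
    using field_integral_finite[OF \<mu>] by (auto simp: fm_def intro: le_less_trans)
  have gap: "2 * Icm \<le> Im + Ic"
    using energy_gap[OF s_pos disk_measuresD(3,1)[OF \<mu>] disk_measuresD(3,1)[OF c]]
    by (simp add: Im_def Ic_def Icm_def riesz_energy_eq)
  have tot: "total_energy ?c + Ic = 2 * F" "total_energy \<mu> + Ic = (Im + Ic) + 2 * fm"
    unfolding c_eq[symmetric] by (simp_all add: total_energy_def Ic_def fc_def Im_def fm_def distrib_left mult_2 ac_simps)
  have F_le: "2 * F \<le> 2 * Icm + 2 * fm" if "Im \<noteq> \<infinity>"
  proof -
    have "F \<le> Icm + fm"
      using mutual_energy_candidate_ge[OF n \<mu>] that by (simp add: F_def Icm_def fm_def Im_def)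
    then show ?thesis unfolding distrib_left[symmetric] by (rule mult_left_mono) simp
  qed
  show "total_energy ?c \<le> total_energy \<mu>"
  proof (cases "Im = \<infinity>")
    case True
    then show ?thesis by (simp add: total_energy_def Im_def)
  next
    case False
    have "total_energy ?c + Ic \<le> 2 * Icm + 2 * fm" unfolding tot(1) by (rule F_le[OF False])
    also have "\<dots> \<le> total_energy \<mu> + Ic" unfolding tot(2) using gap by (rule add_right_mono)
    finally show ?thesis using Ic_fin by (auto simp: ennreal_add_left_cancel_le add.commute[of _ Ic])
  qed
  assume eq: "total_energy \<mu> = total_energy ?c"
  have Im_fin: "Im < \<infinity>"
  proof -
    have "Im \<le> total_energy ?c" unfolding eq[symmetric] by (simp add: total_energy_def Im_def)
    also have "total_energy ?c < \<infinity>"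
      using Ic_fin by (simp add: total_energy_def Ic_def fc_def ennreal_mult_less_top)
    finally show ?thesis .
  qed
  have "(Im + Ic) + 2 * fm = 2 * F" using tot eq by simp
  also have "\<dots> \<le> 2 * Icm + 2 * fm" using Im_fin by (intro F_le) auto
  finally have "Im + Ic \<le> 2 * Icm"
    using fm_fin by (auto simp: ennreal_add_left_cancel_le add.commute[of _ "2 * fm"] ennreal_mult_eq_top_iff)
  moreover have "Icm \<noteq> \<infinity>"
  proof
    assume "Icm = \<infinity>"
    then have "Im + Ic = \<infinity>" using gap by (simp add: ennreal_mult_top top_unique)
    then show False using Im_fin Ic_fin by auto
  qed
  ultimately show "\<mu> = ?c"
    using mutual_energy_uniqueness[OF s_pos disk_measuresD(3,1)[OF \<mu>] disk_measuresD(3,1)[OF c]]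
    by (simp add: Im_def Ic_def Icm_def riesz_energy_eq)
qed

end

theorem theorem2p5:
  fixes d :: nat and s lam q \<alpha> :: real
    and Q :: "real \<times> (real ^ 'n) \<Rightarrow> real"
  assumes "d \<ge> 3" and "d = CARD('n) + 1"
    and "0 < lam" and "lam < 1"
    and "s = (real d - 3) + 2 * lam"
    and "q > 0" and "\<alpha> \<ge> 1"
    and "\<And>r u. 0 \<le> r \<Longrightarrow> r \<le> 1 \<Longrightarrow> u \<in> sphere 0 1 \<Longrightarrow> Q (0, r *\<^sub>R u) = q * r powr \<alpha>"
    and "R_star d lam q \<alpha> \<le> 1"
  shows "supported_on (extremal_measure s Q) (disk (R_star d lam q \<alpha>)) \<and>
         has_radial_density (extremal_measure s Q) (R_star d lam q \<alpha>) (f_Q d lam q \<alpha>)"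
proof -
  interpret M: monomial_field "real d" lam q \<alpha>
    using assms by unfold_locales auto
  have n: "2 \<le> CARD('n)" "real d = real CARD('n) + 1" using assms by auto
  have s: "s = M.s" using assms(5) unfolding M.s_def .
  let ?R = "R_star d lam q \<alpha>"
  let ?c = "M.candidate :: (real \<times> (real ^ 'n)) measure"
  have Q: "Q x = M.field x" if "x \<in> disk 1" for x
  proof -
    obtain y where x: "x = (0, y)" "norm y \<le> 1" using \<open>x \<in> disk 1\<close> by (cases x) (auto simp: disk_def)
    \<comment> \<open>The origin does not determine a direction; any unit vector serves there,
      because the prescribed value depends only on r.\<close>
    obtain u where u: "norm u = 1" "y = norm y *\<^sub>R u"
    proof (cases "y = 0")
      case True
      obtain b :: "real ^ 'n" where "norm b = 1" using vector_choose_size[of 1] by auto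
      with True show ?thesis by (intro that[of b]) auto
    next
      case False
      then show ?thesis by (intro that[of "sgn y"]) (auto simp: norm_sgn sgn_div_norm)
    qed
    have "Q (0, norm y *\<^sub>R u) = q * norm y powr \<alpha>" using x u by (intro assms) auto
    then show ?thesis using x u by (simp add: M.field_def)
  qed
  \<comment> \<open>The bound on \<open>R_star\<close> makes the candidate admissible: the disk that
    carries it must lie in the unit disk.\<close>
  have c: "?c \<in> disk_measures" using n(2) assms by (intro M.candidate_in_disk_measures) auto
  have we: "weighted_energy s Q \<mu> = enn2ereal (M.total_energy \<mu>)" if "\<mu> \<in> disk_measures" for \<mu>
    unfolding s by (rule M.weighted_energy_eq[OF Q that])
  have min: "minimal_energy s Q = enn2ereal (M.total_energy ?c)"
    unfolding minimal_energy_def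
  proof (rule antisym)
    show "(INF \<mu>\<in>disk_measures. weighted_energy s Q \<mu>) \<le> enn2ereal (M.total_energy ?c)"
      unfolding we[OF c, symmetric] by (rule INF_lower[OF c])
    show "enn2ereal (M.total_energy ?c) \<le> (INF \<mu>\<in>disk_measures. weighted_energy s Q \<mu>)"
      using M.total_energy_minimal(1)[OF n assms(9)]
      by (intro INF_greatest) (simp add: we less_eq_ennreal.rep_eq[symmetric])
  qed
  have ext: "extremal_measure s Q = ?c"
    unfolding extremal_measure_def
  proof (rule the_equality)
    show "?c \<in> disk_measures \<and> weighted_energy s Q ?c = minimal_energy s Q"
      using c by (simp add: we min)
    fix \<mu> :: "(real \<times> (real ^ 'n)) measure"
    assume "\<mu> \<in> disk_measures \<and> weighted_energy s Q \<mu> = minimal_energy s Q"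
    then have \<mu>: "\<mu> \<in> disk_measures" and "M.total_energy \<mu> = M.total_energy ?c"
      by (auto simp: we min enn2ereal_inject)
    then show "\<mu> = ?c" by (rule M.total_energy_minimal(2)[OF n assms(9)])
  qed
  have "supported_on ?c (disk ?R)"
    unfolding supported_on_def using M.AE_candidate_disk by (auto elim!: eventually_mono)
  moreover have "has_radial_density ?c ?R (f_Q d lam q \<alpha>)"
    unfolding has_radial_density_def
  proof
    \<comment> \<open>Nonnegativity is known for interior radii; the two endpoints are discarded as
      null sets.\<close>
    show "AE r in lborel. r \<in> {0..?R} \<longrightarrow> 0 \<le> f_Q d lam q \<alpha> r"
      using AE_lborel_singleton[of 0] AE_lborel_singleton[of ?R]
      by eventually_elim (auto intro: M.f_Q_eq_profile(1))
    show "?c = distr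
       (density lborel (\<lambda>r. ennreal (indicator {0..?R} r * f_Q d lam q \<alpha> r * r ^ (CARD('n) - 1))) \<Otimes>\<^sub>M surface_measure)
       borel (\<lambda>(r, u). (0, r *\<^sub>R u))"
      by (simp add: M.candidate_def radial_measure_def)
  qed
  ultimately show ?thesis unfolding ext by blast
qed

end
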